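(* Let $G=(V,E)$ be a tree with $n=|V|$ vertices and maximum degree $\Delta$. Let $0<\epsilon\leq 1$ be such that $\frac{\ln^{2}\Delta}{\Delta}\leq\frac{\epsilon^{2}}{100}$, and let $L=\{L(v)\}_{v\in V}$ be color lists satisfying $|L(v)|\geq \Delta(v)+\epsilon\Delta$ for every $v\in V$, where $\Delta(v)$ is the degree of $v$. Then the spectral gap of the Glauber dynamics for sampling proper $L$-vertex-list-colorings of $G$ is $\Omega(n^{-O(1/\epsilon)})$, therefore its mixing time is $O(n^{O(1/\epsilon)})$. Furthermore, if $\Delta\leq O(1)$, the modified and standard log-Sobolev constants are $\Omega_{\epsilon,\Delta}(1/n)$.
   Context: A proper $L$-vertex-list-coloring of $G$ is a map $\sigma$ on $V$ with $\sigma(v)\in L(v)$ for all $v$ and $\sigma(u)\neq\sigma(v)$ whenever $u,v$ are adjacent. The Glauber dynamics picks a uniformly random vertex $v$ and recolors it with a uniformly random color of $L(v)$ not used by any neighbor of $v$; its stationary distribution $\pi$ is uniform over proper $L$-vertex-list-colorings. For a reversible chain $P$ with stationary distribution $\pi$, write $\mathcal{E}(\phi,\psi)=\langle\phi,(I-P)\psi\rangle_\pi$, $\mathrm{Var}_\pi$ and $\mathrm{Ent}_\pi(f)=\mathbb{E}_\pi[f\log f]-\mathbb{E}_\pi[f]\log\mathbb{E}_\pi[f]$. The spectral gap is $\inf_{f}\mathcal{E}(f,f)/\mathrm{Var}_\pi(f)$, the modified log-Sobolev constant is $\inf_{f\geq 0}\mathcal{E}(f,\log f)/\mathrm{Ent}_\pi(f)$,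 the standard log-Sobolev constant is $\inf_{f\geq0}\mathcal{E}(\sqrt f,\sqrt f)/\mathrm{Ent}_\pi(f)$, and the mixing time is the least $t$ with total variation distance between $\mu P^t$ and $\pi$ at most $1/4$ for all initial $\mu$. $\Omega_{\epsilon,\Delta}(1/n)$ means at least $c(\epsilon,\Delta)/n$ for a positive constant depending only on $\epsilon,\Delta$.
   Formalization: Maximum degree at least 2 is assumed (the claim fails for a single edge with both lists {1,2}), and the constant in the standard log-Sobolev bound may also depend on the largest list size, since with unboundedly large lists no constant in ε and Δ alone can work. *)

theory Defs
  imports "HOL-Probability.Probability" "Graph_Theory.Graph_Theory"
begin

section \<open>Trees\<close>

text \<open>
  A finite simple undirected graph is a \<^locale>\<open>pair_graph\<close>, i.e. a finite symmetric loop-free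
  relation. In such a digraph every edge \<open>uv\<close> gives the directed cycle \<open>u, v, u\<close>, so the library's
  \<open>forest\<close> and \<open>tree\<close> do not describe undirected trees. The undirected cycles are exactly the
  directed ones with at least three arcs.
\<close>

definition undirected_tree :: "'v pair_pre_digraph \<Rightarrow> bool" where
  "undirected_tree G \<longleftrightarrow> pair_graph G \<and> Digraph_Component.connected (with_proj G) \<and>
     \<not> (\<exists>p. pre_digraph.cycle (with_proj G) p \<and> 3 \<le> length p)"

abbreviation degree_of :: "'v pair_pre_digraph \<Rightarrow> 'v \<Rightarrow> nat" where
  "degree_of G v \<equiv> out_degree (with_proj G) v"

definition max_degree :: "'v pair_pre_digraph \<Rightarrow> nat" where
  "max_degree G = (MAX v\<in>pverts G. degree_of G v)"


section \<open>List colorings and the Glauber dynamics\<close>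

text \<open>Colorings are extensional, so that they are determined by their values on the vertices.\<close>

definition proper_colorings :: "'v pair_pre_digraph \<Rightarrow> ('v \<Rightarrow> 'c set) \<Rightarrow> ('v \<Rightarrow> 'c) set" where
  "proper_colorings G L =
     {\<sigma> \<in> Pi\<^sub>E (pverts G) L. \<forall>(u, v)\<in>parcs G. \<sigma> u \<noteq> \<sigma> v}"

definition available_colors ::
  "'v pair_pre_digraph \<Rightarrow> ('v \<Rightarrow> 'c set) \<Rightarrow> ('v \<Rightarrow> 'c) \<Rightarrow> 'v \<Rightarrow> 'c set" where
  "available_colors G L \<sigma> v = {c \<in> L v. \<forall>u. (v, u) \<in> parcs G \<longrightarrow> c \<noteq> \<sigma> u}"

definition glauber ::
  "'v pair_pre_digraph \<Rightarrow> ('v \<Rightarrow> 'c set) \<Rightarrow> ('v \<Rightarrow> 'c) \<Rightarrow> ('v \<Rightarrow> 'c) pmf" where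
  "glauber G L \<sigma> = do {
     v \<leftarrow> pmf_of_set (pverts G);
     c \<leftarrow> pmf_of_set (available_colors G L \<sigma> v);
     return_pmf (\<sigma>(v := c))
   }"

definition coloring_distribution ::
  "'v pair_pre_digraph \<Rightarrow> ('v \<Rightarrow> 'c set) \<Rightarrow> ('v \<Rightarrow> 'c) pmf" where
  "coloring_distribution G L = pmf_of_set (proper_colorings G L)"


section \<open>Functional inequalities for a Markov chain\<close>

text \<open>
  A chain is given by its kernel \<open>K\<close> and its stationary distribution \<open>\<pi>\<close>; the state space is
  \<open>set_pmf \<pi>\<close>. The constants below are infima of quotients over all functions for which the
  denominator is nonzero. They are taken in \<^typ>\<open>ereal\<close>, where the infimum over the empty set
  (a chain with one state) is \<open>\<infinity>\<close>.
\<close>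

definition dirichlet_form ::
  "'s pmf \<Rightarrow> ('s \<Rightarrow> 's pmf) \<Rightarrow> ('s \<Rightarrow> real) \<Rightarrow> ('s \<Rightarrow> real) \<Rightarrow> real" where
  "dirichlet_form \<pi> K \<phi> \<psi> =
     measure_pmf.expectation \<pi> (\<lambda>x. \<phi> x * (\<psi> x - measure_pmf.expectation (K x) \<psi>))"

text \<open>The convention \<open>0 log 0 = 0\<close> is built in.\<close>

definition entropy_functional :: "'s pmf \<Rightarrow> ('s \<Rightarrow> real) \<Rightarrow> real" where
  "entropy_functional \<pi> f =
     measure_pmf.expectation \<pi> (\<lambda>x. f x * ln (f x)) -
     measure_pmf.expectation \<pi> f * ln (measure_pmf.expectation \<pi> f)"

definition spectral_gap :: "'s pmf \<Rightarrow> ('s \<Rightarrow> 's pmf) \<Rightarrow> ereal" where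
  "spectral_gap \<pi> K =
     (INF f\<in>{f :: 's \<Rightarrow> real. measure_pmf.variance \<pi> f \<noteq> 0}.
        ereal (dirichlet_form \<pi> K f f / measure_pmf.variance \<pi> f))"

text \<open>
  The form \<open>\<E>(f, log f)\<close> for \<open>f \<ge> 0\<close>, with \<open>log 0 = -\<infinity>\<close> and \<open>0 \<cdot> \<infinity> = 0\<close>. It is \<open>\<infinity>\<close> as soon as
  the chain can step from a state where \<open>f\<close> is positive to one where \<open>f\<close> vanishes. Otherwise
  the library value \<open>ln 0 = 0\<close> only occurs in terms with the factor \<open>f x = 0\<close>.
\<close>

definition dirichlet_log :: "'s pmf \<Rightarrow> ('s \<Rightarrow> 's pmf) \<Rightarrow> ('s \<Rightarrow> real) \<Rightarrow> ereal" where
  "dirichlet_log \<pi> K f =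
     (if \<exists>x\<in>set_pmf \<pi>. \<exists>y\<in>set_pmf (K x). 0 < f x \<and> f y = 0 then \<infinity>
      else ereal (dirichlet_form \<pi> K f (\<lambda>x. ln (f x))))"

definition modified_log_sobolev :: "'s pmf \<Rightarrow> ('s \<Rightarrow> 's pmf) \<Rightarrow> ereal" where
  "modified_log_sobolev \<pi> K =
     (INF f\<in>{f. (\<forall>x\<in>set_pmf \<pi>. 0 \<le> f x) \<and> entropy_functional \<pi> f \<noteq> 0}.
        dirichlet_log \<pi> K f / ereal (entropy_functional \<pi> f))"

definition standard_log_sobolev :: "'s pmf \<Rightarrow> ('s \<Rightarrow> 's pmf) \<Rightarrow> ereal" where
  "standard_log_sobolev \<pi> K =
     (INF f\<in>{f. (\<forall>x\<in>set_pmf \<pi>. 0 \<le> f x) \<and> entropy_functional \<pi> f \<noteq> 0}.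
        ereal (dirichlet_form \<pi> K (\<lambda>x. sqrt (f x)) (\<lambda>x. sqrt (f x)) /
               entropy_functional \<pi> f))"


section \<open>Mixing time\<close>

definition total_variation_distance :: "'s pmf \<Rightarrow> 's pmf \<Rightarrow> real" where
  "total_variation_distance \<mu> \<nu> =
     (SUP A. \<bar>measure_pmf.prob \<mu> A - measure_pmf.prob \<nu> A\<bar>)"

definition chain_law :: "('s \<Rightarrow> 's pmf) \<Rightarrow> 's pmf \<Rightarrow> nat \<Rightarrow> 's pmf" where
  "chain_law K \<mu> t = ((\<lambda>\<nu>. bind_pmf \<nu> K) ^^ t) \<mu>"

text \<open>The value is \<open>\<infinity>\<close> if the chain never comes within distance \<open>1/4\<close>.\<close>

definition mixing_time :: "'s pmf \<Rightarrow> ('s \<Rightarrow> 's pmf) \<Rightarrow> enat" where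
  "mixing_time \<pi> K =
     (INF t\<in>{t. \<forall>\<mu>. set_pmf \<mu> \<subseteq> set_pmf \<pi> \<longrightarrow>
                  total_variation_distance (chain_law K \<mu> t) \<pi> \<le> 1 / 4}. enat t)"

end

theory Submission
  imports Defs
begin

text \<open>
  Write \<open>a = \<epsilon>\<Delta>\<close>. A vertex always has at least \<open>a\<close> available colors, so changing the color of one
  neighbor moves its conditional distribution by at most \<open>1/a\<close> in total variation. In a tree every edge
  joins a vertex to its parent, hence the adjacency matrix has norm at most \<open>2\<surd>\<Delta>\<close>, and the
  Dobrushin matrix has \<open>\<ell>\<^sup>2\<close>-norm at most \<open>2\<surd>\<Delta>/a \<le> 1/2\<close>; this is where the condition on
  \<open>ln\<^sup>2 \<Delta> / \<Delta>\<close> enters. Consequently the Glauber dynamics contracts the vector of oscillations of a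
  function by the factor \<open>1 - 1/(2n)\<close>, which yields both the spectral gap (by log-convexity of
  \<open>t \<mapsto> \<parallel>P\<^sup>t f\<parallel>\<^sup>2\<close>) and the mixing time.

  The log-Sobolev constants follow from \<open>Ent f \<le> K \<Sum>\<^sub>v E Ent\<^sub>v f\<close> with \<open>K\<close> depending only on \<open>\<epsilon>\<close> and
  \<open>\<Delta>\<close>. Averaging the chain rule over the vertex revealed first, and using that the hypotheses survive
  pinning, reduces this to a bound on the sum of the entropies of the one-vertex marginals. There the
  Dobrushin comparison theorem applies, after the marginal has been resampled to make its
  density bounded independently of the list sizes.
\<close>

section \<open>Parents in an undirected tree\<close>

text \<open>Oscillation and comparison bounds are therefore vectors measured by
  \<open>L2_set\<close>. Passing to sup norms costs a factor n: log-convexity removes it from the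
  spectral gap, and the mixing time absorbs it by running longer. Pinning is expressed by
  restricting to the colorings that agree with \<tau> outside a set \<open>U\<close>. No new graph
  or lists are built, and the constants \<open>a\<close> and \<open>D\<close> stay the same along
  the induction on \<open>U\<close>. List sizes have no upper bound. They cancel from the
  tensorization constant and hence from the modified log-Sobolev constant, but not from the standard
  one: uniform resampling among q colors has standard log-Sobolev constant of order 1/ln q, so a
  dependence on the largest list cannot be avoided there.\<close>

lemma pcas_vwalk_arcs:
  "xs \<noteq> [] \<Longrightarrow> pcas (hd xs) (vwalk_arcs xs) (last xs) \<and> pawalk_verts (hd xs) (vwalk_arcs xs) = xs"
  by (induct xs rule: vwalk_arcs.induct) auto

text \<open>Putting the last vertex in front as well turns a simple path with adjacent ends into a
  directed cycle. The bound 3 excludes the walk u, v, u along a single edge.\<close>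

lemma undirected_tree_no_closed_path:
  assumes T: "undirected_tree G" and xs: "distinct xs" "3 \<le> length xs"
    and arcs: "set (vwalk_arcs xs) \<subseteq> parcs G" and close: "(last xs, hd xs) \<in> parcs G"
  shows False
proof -
  interpret pair_graph G using T by (simp add: undirected_tree_def)
  let ?ys = "last xs # xs" and ?p = "vwalk_arcs (last xs # xs)"
  have ne: "xs \<noteq> []" using xs by auto
  have p: "?p = (last xs, hd xs) # vwalk_arcs xs" using ne by simp
  have "pcas (last xs) ?p (last xs)" "pawalk_verts (last xs) ?p = ?ys"
    using pcas_vwalk_arcs[of ?ys] ne by auto
  moreover have "last xs \<in> pverts G" using close by (rule in_arcsD1)
  ultimately have "awalk (last xs) ?p (last xs)"
    using arcs close p by (auto simp: awalk_def)
  hence "cycle ?p"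
    unfolding cycle_def using xs \<open>pawalk_verts (last xs) ?p = ?ys\<close> p by (auto intro!: exI[of _ "last xs"])
  moreover have "length ?p \<ge> 3"
    using vwalk_length_simp[of ?ys] xs unfolding vwalk_length_def by simp
  ultimately show False using T by (auto simp: undirected_tree_def)
qed

text \<open>Connectivity of the subgraph induced on \<open>S\<close>, phrased with simple paths
  because these are what closes up to a cycle.\<close>

definition joined_within :: "'v pair_pre_digraph \<Rightarrow> 'v set \<Rightarrow> bool" where
  "joined_within G S \<longleftrightarrow> (\<forall>x\<in>S. \<forall>y\<in>S. \<exists>xs. xs \<noteq> [] \<and> hd xs = x \<and> last xs = y \<and> distinct xs \<and>
     set xs \<subseteq> S \<and> set (vwalk_arcs xs) \<subseteq> parcs G)"

text \<open>A connected vertex set is grown one vertex at a time. A new vertex \<open>v\<close>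
  adjacent to \<open>u\<close> in \<open>S\<close> has no second neighbour in \<open>S\<close>,
  since a path inside \<open>S\<close> between the two would close to a cycle through
  \<open>v\<close>. So making \<open>u\<close> the parent of \<open>v\<close> accounts for all new
  edges.\<close>

lemma undirected_tree_parent_within:
  assumes T: "undirected_tree G" and fin: "finite (pverts G)" and ne: "pverts G \<noteq> {}"
  shows "k < card (pverts G) \<Longrightarrow> \<exists>S p. S \<subseteq> pverts G \<and> card S = Suc k \<and> joined_within G S \<and>
    (\<forall>u\<in>S. \<forall>v\<in>S. (u, v) \<in> parcs G \<longrightarrow> u = p v \<or> v = p u)"
proof (induction k)
  case 0
  obtain r where r: "r \<in> pverts G" using ne by auto
  interpret pair_graph G using T by (simp add: undirected_tree_def)
  have "joined_within G {r}"
    unfolding joined_within_def by (auto intro!: exI[of _ "[r]"])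
  moreover have "\<forall>u\<in>{r}. \<forall>v\<in>{r}. (u, v) \<in> parcs G \<longrightarrow> u = r \<or> v = r" by auto
  ultimately show ?case using r by (intro exI[of _ "{r}"] exI[of _ "\<lambda>_. r"]) auto
next
  case (Suc k)
  obtain S p where S: "S \<subseteq> pverts G" "card S = Suc k" "joined_within G S"
    and p': "\<forall>u\<in>S. \<forall>v\<in>S. (u, v) \<in> parcs G \<longrightarrow> u = p v \<or> v = p u"
    using Suc.IH[OF Suc_lessD[OF Suc.prems]] by blast
  have p: "u = p v \<or> v = p u" if "u \<in> S" "v \<in> S" "(u, v) \<in> parcs G" for u v
    using p' that by blast
  interpret pair_graph G using T by (simp add: undirected_tree_def)
  have symG: "(u, v) \<in> parcs G \<Longrightarrow> (v, u) \<in> parcs G" for u v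
    using pair_sym_arcs by (auto simp: symmetric_def sym_def)
  have "S \<noteq> {}" "finite S" using S(2) by (auto intro: card_ge_0_finite)
  then obtain s where s: "s \<in> S" by auto
  have "\<not> pverts G \<subseteq> S"
    using card_mono[OF \<open>finite S\<close>, of "pverts G"] Suc.prems S(2) by auto
  then obtain t where t: "t \<in> pverts G" "t \<notin> S" by auto
  \<comment> \<open>Otherwise \<open>S\<close> is closed under reachability, which contradicts
    connectedness at \<open>t\<close>.\<close>
  have "\<exists>u\<in>S. \<exists>v. v \<notin> S \<and> (u, v) \<in> parcs G"
  proof (rule ccontr)
    assume no: "\<not> ?thesis"
    have conn: "strongly_connected (with_proj (mk_symmetric (with_proj G)))"
      using T by (simp add: undirected_tree_def connected_def)
    have "(s, t) \<in> rtrancl_on (pverts G) (parcs (mk_symmetric (with_proj G)))"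
      using conn s t S(1) unfolding strongly_connected_def reachable_def
      by (auto simp: mk_symmetric_def)
    hence "t \<in> S"
    proof (induction rule: rtrancl_on_induct)
      case base thus ?case using s by simp
    next
      case (step y z)
      hence "(y, z) \<in> parcs G" using symG by (auto simp: mk_symmetric_def)
      thus ?case using no step by auto
    qed
    thus False using t by simp
  qed
  then obtain u v where uv: "u \<in> S" "v \<notin> S" "(u, v) \<in> parcs G" by auto
  have uniq: "w = u" if w: "w \<in> S" "(w, v) \<in> parcs G" for w
  proof (rule ccontr)
    assume "w \<noteq> u"
    obtain xs where xs: "xs \<noteq> []" "hd xs = u" "last xs = w" "distinct xs" "set xs \<subseteq> S"
      "set (vwalk_arcs xs) \<subseteq> parcs G"
      using S(3) uv w unfolding joined_within_def by blast
    have "length xs \<ge> 2" using xs \<open>w \<noteq> u\<close> by (cases xs; cases "tl xs") auto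
    hence "3 \<le> length (v # xs)" by simp
    moreover have "distinct (v # xs)" using xs uv by auto
    moreover have "set (vwalk_arcs (v # xs)) \<subseteq> parcs G" using xs uv symG[OF uv(3)] by auto
    moreover have "(last (v # xs), hd (v # xs)) \<in> parcs G" using xs w by auto
    ultimately show False using undirected_tree_no_closed_path[OF T] by blast
  qed
  let ?S = "insert v S" and ?p = "p(v := u)"
  have noloop: "(v, v) \<notin> parcs G" using pair_no_loops by fastforce
  have par: "\<forall>x\<in>?S. \<forall>y\<in>?S. (x, y) \<in> parcs G \<longrightarrow> x = ?p y \<or> y = ?p x"
  proof (intro ballI impI)
    fix x y assume xy: "x \<in> ?S" "y \<in> ?S" "(x, y) \<in> parcs G"
    consider "x \<in> S" "y \<in> S" | "x = v" "y \<in> S" | "y = v" "x \<in> S" | "x = v" "y = v"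
      using xy by auto
    thus "x = ?p y \<or> y = ?p x"
    proof cases
      case 1
      hence "x \<noteq> v" "y \<noteq> v" using uv by auto
      thus ?thesis using p[OF 1 xy(3)] by simp
    next
      case 2 thus ?thesis using uniq[of y] symG[OF xy(3)] by simp
    next
      case 3 thus ?thesis using uniq[of x] xy(3) by simp
    next
      case 4 thus ?thesis using noloop xy by simp
    qed
  qed
  have ext: "\<exists>xs. xs \<noteq> [] \<and> hd xs = x \<and> last xs = v \<and> distinct xs \<and> set xs \<subseteq> ?S \<and>
      set (vwalk_arcs xs) \<subseteq> parcs G" if x: "x \<in> S" for x
  proof -
    obtain xs where xs: "xs \<noteq> []" "hd xs = x" "last xs = u" "distinct xs" "set xs \<subseteq> S"
      "set (vwalk_arcs xs) \<subseteq> parcs G"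
      using S(3) uv x unfolding joined_within_def by blast
    show ?thesis
      by (rule exI[of _ "xs @ [v]"]) (use xs uv in \<open>auto simp: vwalk_arcs_append\<close>)
  qed
  have ext': "\<exists>xs. xs \<noteq> [] \<and> hd xs = v \<and> last xs = x \<and> distinct xs \<and> set xs \<subseteq> ?S \<and>
      set (vwalk_arcs xs) \<subseteq> parcs G" if x: "x \<in> S" for x
  proof -
    obtain xs where xs: "xs \<noteq> []" "hd xs = u" "last xs = x" "distinct xs" "set xs \<subseteq> S"
      "set (vwalk_arcs xs) \<subseteq> parcs G"
      using S(3) uv x unfolding joined_within_def by blast
    have "v \<notin> set xs" using xs(5) uv(2) by blast
    moreover have "set xs \<subseteq> ?S" using xs(5) by blast
    ultimately show ?thesis
      by (intro exI[of _ "v # xs"]) (simp add: xs symG[OF uv(3)])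
  qed
  have "joined_within G ?S"
    unfolding joined_within_def
  proof (intro ballI)
    fix x y assume "x \<in> ?S" "y \<in> ?S"
    then consider "x \<in> S" "y \<in> S" | "x \<in> S" "y = v" | "x = v" "y \<in> S" | "x = v" "y = v" by auto
    thus "\<exists>xs. xs \<noteq> [] \<and> hd xs = x \<and> last xs = y \<and> distinct xs \<and>
      set xs \<subseteq> ?S \<and> set (vwalk_arcs xs) \<subseteq> parcs G"
    proof cases
      case 1
      then obtain xs where "xs \<noteq> []" "hd xs = x" "last xs = y" "distinct xs" "set xs \<subseteq> S"
        "set (vwalk_arcs xs) \<subseteq> parcs G"
        using S(3) unfolding joined_within_def by blast
      thus ?thesis by (intro exI[of _ xs]) (simp add: subset_insertI2)
    next
      case 2 thus ?thesis using ext[of x] by simp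
    next
      case 3 thus ?thesis using ext'[of y] by simp
    next
      case 4 thus ?thesis by (intro exI[of _ "[v]"]) auto
    qed
  qed
  moreover have "?S \<subseteq> pverts G" using S uv in_arcsD2 by auto
  moreover have "card ?S = Suc (Suc k)" using S uv \<open>finite S\<close> by simp
  ultimately show ?case using par by (intro exI[of _ ?S] exI[of _ ?p]) auto
qed

lemma undirected_tree_parent:
  assumes T: "undirected_tree G"
  shows "\<exists>p. \<forall>u v. (u, v) \<in> parcs G \<longrightarrow> u = p v \<or> v = p u"
proof -
  interpret pair_graph G using T by (simp add: undirected_tree_def)
  have fin: "finite (pverts G)" by (rule pair_finite_verts)
  have ne: "pverts G \<noteq> {}"
    using T by (auto simp: undirected_tree_def connected_def strongly_connected_def mk_symmetric_def)
  have "card (pverts G) > 0" using fin ne by (simp add: card_gt_0_iff)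
  then obtain S p where S: "S \<subseteq> pverts G" "card S = Suc (card (pverts G) - 1)"
    and p: "\<forall>u\<in>S. \<forall>v\<in>S. (u, v) \<in> parcs G \<longrightarrow> u = p v \<or> v = p u"
    using undirected_tree_parent_within[OF T fin ne, of "card (pverts G) - 1"] by auto
  have "S = pverts G" using S fin \<open>card (pverts G) > 0\<close> by (intro card_subset_eq) auto
  thus ?thesis using p in_arcsD1 in_arcsD2 by blast
qed

section \<open>Resampling one vertex\<close>

text \<open>The total variation distance of the two uniform distributions is at most the reciprocal
  of the larger cardinality. Either the sets agree, or one element is exchanged, or \<open>A\<close>
  has one extra element \<open>c\<close>; in the last case the difference is the average of
  \<open>F c - F x\<close> over \<open>A'\<close> divided by \<open>card A' + 1\<close>.\<close>

lemma average_diff_le_aux: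
  fixes F :: "'c \<Rightarrow> real"
  assumes fin: "finite A" "finite A'" and diff: "card (A - A') \<le> 1" "card (A' - A) \<le> 1"
    and le: "card A' \<le> card A" and a: "0 < a" "a \<le> real (card A')"
    and osc: "\<And>c c'. c \<in> A \<union> A' \<Longrightarrow> c' \<in> A \<union> A' \<Longrightarrow> \<bar>F c - F c'\<bar> \<le> d"
  shows "\<bar>sum F A / card A - sum F A' / card A'\<bar> \<le> d / a"
proof -
  have pos: "0 < real (card A')" "0 < real (card A)" using a le by linarith+
  have "A' \<noteq> {}" using pos by auto
  then obtain z where "z \<in> A'" by auto
  hence d: "0 \<le> d" using osc[of z z] by auto
  have aA: "a \<le> real (card A)" using a le by linarith
  have cA: "card A = card (A \<inter> A') + card (A - A')" and cA': "card A' = card (A \<inter> A') + card (A' - A)"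
    using card_Int_Diff[OF fin(1), of A'] card_Int_Diff[OF fin(2), of A] by (simp_all add: Int_commute)
  have sA: "sum F A = sum F (A \<inter> A') + sum F (A - A')" and sA': "sum F A' = sum F (A \<inter> A') + sum F (A' - A)"
    using sum.Int_Diff[OF fin(1), of F A'] sum.Int_Diff[OF fin(2), of F A] by (simp_all add: Int_commute)
  consider "card (A - A') = 0" | "card (A - A') = 1" "card (A' - A) = 1" | "card (A - A') = 1" "card (A' - A) = 0"
    using diff by linarith
  thus ?thesis
  proof cases
    case 1
    hence "card (A' - A) = 0" using cA cA' le by simp
    hence "A - A' = {}" "A' - A = {}" using 1 fin by simp_all
    hence "A = A'" by blast
    thus ?thesis using d a by simp
  next
    case 2
    then obtain c c' where c: "A - A' = {c}" "A' - A = {c'}" by (auto simp: card_1_singleton_iff)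
    have eq: "card A' = card A" using cA cA' 2 by simp
    have "sum F A / card A - sum F A' / card A' = (F c - F c') / card A"
      using c sA sA' by (simp add: eq diff_divide_distrib add_divide_distrib)
    also have "\<bar>\<dots>\<bar> \<le> d / a"
      using osc[of c c'] c aA a d pos by (auto simp: abs_divide intro!: frac_le)
    finally show ?thesis .
  next
    case 3
    then obtain c where c: "A - A' = {c}" by (auto simp: card_1_singleton_iff)
    have "A' - A = {}" using 3 fin by auto
    hence I: "A \<inter> A' = A'" by auto
    have n: "real (card A) = real (card A') + 1" using cA 3 I by simp
    have s: "sum F A = sum F A' + F c" using sA c I by simp
    define S where "S = sum F A'"
    define m where "m = real (card A')"
    have m: "m > 0" using pos by (simp add: m_def)
    have "sum F A / card A - sum F A' / card A' = ((m * F c - S) / m) / (m + 1)"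
      unfolding s n S_def[symmetric] m_def[symmetric] using m by (simp add: divide_simps) (simp add: algebra_simps)
    also have "m * F c - S = (\<Sum>x\<in>A'. F c - F x)"
      by (simp add: sum_subtractf S_def m_def)
    finally have e: "sum F A / card A - sum F A' / card A' = ((\<Sum>x\<in>A'. F c - F x) / m) / (m + 1)" .
    have "\<bar>\<Sum>x\<in>A'. F c - F x\<bar> \<le> (\<Sum>x\<in>A'. \<bar>F c - F x\<bar>)" by (rule sum_abs)
    also have "\<dots> \<le> (\<Sum>x\<in>A'. d)" using c by (intro sum_mono osc) auto
    also have "\<dots> = m * d" by (simp add: m_def)
    finally have "\<bar>\<Sum>x\<in>A'. F c - F x\<bar> / m \<le> d" using m by (simp add: divide_simps mult.commute)
    hence le: "\<bar>\<Sum>x\<in>A'. F c - F x\<bar> / m / (m + 1) \<le> d / (m + 1)"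
      using m by (intro divide_right_mono) auto
    have "\<bar>sum F A / card A - sum F A' / card A'\<bar> \<le> d / (m + 1)"
      unfolding e abs_divide using le m by simp
    also have "\<dots> \<le> d / a" using a d m by (intro divide_left_mono) (auto simp: m_def)
    finally show ?thesis .
  qed
qed

lemma average_diff_le:
  fixes F :: "'c \<Rightarrow> real"
  assumes fin: "finite A" "finite A'" and diff: "card (A - A') \<le> 1" "card (A' - A) \<le> 1"
    and a: "0 < a" "a \<le> real (card A)" "a \<le> real (card A')"
    and osc: "\<And>c c'. c \<in> A \<union> A' \<Longrightarrow> c' \<in> A \<union> A' \<Longrightarrow> \<bar>F c - F c'\<bar> \<le> d"
  shows "\<bar>sum F A / card A - sum F A' / card A'\<bar> \<le> d / a"
proof (cases "card A' \<le> card A")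
  case True
  thus ?thesis using assms by (intro average_diff_le_aux) auto
next
  case False
  have "\<bar>sum F A' / card A' - sum F A / card A\<bar> \<le> d / a"
    using False assms by (intro average_diff_le_aux) (auto simp: Un_commute)
  thus ?thesis by (simp add: abs_minus_commute)
qed

text \<open>The tree enters only through \<open>parent\<close>. In the application \<open>a\<close>
  is \<epsilon>\<Delta> and \<open>D\<close> is \<Delta>. \<open>a_ge\<close> makes the bound
  \<open>2 * sqrt D / a\<close> on the Euclidean norm of the influence matrix at most 1/2, and
  \<open>a_gt_1\<close> leaves an available color even after one more color is forbidden.\<close>

locale coloring_instance =
  fixes V :: "'v set" and N :: "'v \<Rightarrow> 'v set" and L :: "'v \<Rightarrow> 'c set"
    and a :: real and D :: nat and parent :: "'v \<Rightarrow> 'v"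
  assumes finite_V: "finite V" and V_nonempty: "V \<noteq> {}"
    and N_subset: "N v \<subseteq> V"
    and N_sym: "u \<in> N v \<Longrightarrow> v \<in> N u"
    and N_irrefl: "v \<notin> N v"
    and N_parent: "u \<in> N v \<Longrightarrow> u = parent v \<or> v = parent u"
    and finite_L: "v \<in> V \<Longrightarrow> finite (L v)"
    and card_L: "v \<in> V \<Longrightarrow> real (card (N v)) + a \<le> real (card (L v))"
    and degree_le: "v \<in> V \<Longrightarrow> card (N v) \<le> D"
    and a_gt_1: "1 < a" and a_ge: "4 * sqrt (real D) \<le> a"
begin

definition configs :: "('v \<Rightarrow> 'c) set" where
  "configs = Pi\<^sub>E V L"

definition colorings :: "('v \<Rightarrow> 'c) set" where
  "colorings = {\<sigma> \<in> configs. \<forall>v\<in>V. \<forall>u\<in>N v. \<sigma> v \<noteq> \<sigma> u}"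

definition avail :: "('v \<Rightarrow> 'c) \<Rightarrow> 'v \<Rightarrow> 'c set" where
  "avail \<sigma> v = {c \<in> L v. \<forall>u\<in>N v. c \<noteq> \<sigma> u}"

definition resample :: "'v \<Rightarrow> (('v \<Rightarrow> 'c) \<Rightarrow> real) \<Rightarrow> ('v \<Rightarrow> 'c) \<Rightarrow> real" where
  "resample v g \<sigma> = (\<Sum>c\<in>avail \<sigma> v. g (\<sigma>(v := c))) / card (avail \<sigma> v)"

text \<open>The oscillations are taken over all colorings, proper or not, so that any two of them can be
  joined by changing the vertices one at a time.\<close>

definition osc_le :: "(('v \<Rightarrow> 'c) \<Rightarrow> real) \<Rightarrow> ('v \<Rightarrow> real) \<Rightarrow> bool" where
  "osc_le g \<delta> \<longleftrightarrow> (\<forall>\<sigma>\<in>configs. \<forall>u\<in>V. \<forall>c\<in>L u. \<bar>g (\<sigma>(u := c)) - g \<sigma>\<bar> \<le> \<delta> u)"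

lemma finite_configs: "finite configs"
  unfolding configs_def using finite_V finite_L by (intro finite_PiE) auto

lemma colorings_subset: "colorings \<subseteq> configs"
  by (auto simp: colorings_def)

lemma finite_colorings: "finite colorings"
  using colorings_subset finite_configs finite_subset by blast

lemma finite_N: "finite (N v)"
  using N_subset finite_V finite_subset by blast

lemma finite_avail: "v \<in> V \<Longrightarrow> finite (avail \<sigma> v)"
  unfolding avail_def using finite_L by auto

lemma avail_subset: "avail \<sigma> v \<subseteq> L v"
  by (auto simp: avail_def)

text \<open>Besides yielding the lower bound \<open>a\<close>, this count is kept because for long
  lists \<open>card (L v) - card (N v)\<close> is comparable with \<open>card (L v)\<close>, which
  is what cancels the list size in \<open>resampled_marginal_le\<close>.\<close>

lemma card_avail_ge_diff:
  assumes "v \<in> V"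
  shows "real (card (L v)) - real (card (N v)) \<le> real (card (avail \<sigma> v))"
proof -
  have "L v - \<sigma> ` N v \<subseteq> avail \<sigma> v" by (auto simp: avail_def)
  hence "card (L v - \<sigma> ` N v) \<le> card (avail \<sigma> v)"
    using finite_avail[OF assms] by (rule card_mono[rotated])
  moreover have "card (L v) - card (\<sigma> ` N v) \<le> card (L v - \<sigma> ` N v)"
    by (rule diff_card_le_card_Diff) (simp add: finite_N)
  moreover have "card (\<sigma> ` N v) \<le> card (N v)" by (rule card_image_le[OF finite_N])
  ultimately show ?thesis by linarith
qed

lemma card_avail_ge: "v \<in> V \<Longrightarrow> a \<le> real (card (avail \<sigma> v))"
  using card_avail_ge_diff[of v \<sigma>] card_L[of v] by linarith

lemma card_avail_pos: "v \<in> V \<Longrightarrow> 0 < card (avail \<sigma> v)"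
  using card_avail_ge[of v \<sigma>] a_gt_1 by linarith

lemma avail_nonempty: "v \<in> V \<Longrightarrow> avail \<sigma> v \<noteq> {}"
  using card_avail_pos[of v \<sigma>] by auto

lemma configs_upd: "\<sigma> \<in> configs \<Longrightarrow> v \<in> V \<Longrightarrow> c \<in> L v \<Longrightarrow> \<sigma>(v := c) \<in> configs"
  unfolding configs_def by (auto simp: PiE_iff extensional_def)

lemma configs_in: "\<sigma> \<in> configs \<Longrightarrow> v \<in> V \<Longrightarrow> \<sigma> v \<in> L v"
  unfolding configs_def by auto

lemma avail_upd: "w \<notin> N v \<Longrightarrow> avail (\<sigma>(w := c)) v = avail \<sigma> v"
  by (auto simp: avail_def)

lemma osc_leD: "osc_le g \<delta> \<Longrightarrow> \<sigma> \<in> configs \<Longrightarrow> u \<in> V \<Longrightarrow> c \<in> L u \<Longrightarrow> \<bar>g (\<sigma>(u := c)) - g \<sigma>\<bar> \<le> \<delta> u"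
  by (auto simp: osc_le_def)

lemma osc_le_diff:
  assumes "osc_le g \<delta>" "\<sigma> \<in> configs" "finite U"
  shows "U \<subseteq> V \<Longrightarrow> \<eta> \<in> configs \<Longrightarrow> (\<And>x. x \<notin> U \<Longrightarrow> \<sigma> x = \<eta> x) \<Longrightarrow> \<bar>g \<sigma> - g \<eta>\<bar> \<le> sum \<delta> U"
  using assms(3)
proof (induction U arbitrary: \<eta> rule: finite_induct)
  case empty
  hence "\<sigma> = \<eta>" by auto
  thus ?case by simp
next
  case (insert u U)
  let ?\<eta> = "\<eta>(u := \<sigma> u)"
  have u: "u \<in> V" using insert by auto
  have "?\<eta> \<in> configs" using insert.prems u assms(2) by (intro configs_upd configs_in)
  hence "\<bar>g \<sigma> - g ?\<eta>\<bar> \<le> sum \<delta> U"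
    using insert.prems by (intro insert.IH[OF _ \<open>?\<eta> \<in> configs\<close>]) auto
  moreover have "\<bar>g ?\<eta> - g \<eta>\<bar> \<le> \<delta> u"
    using insert.prems u assms by (intro osc_leD[OF assms(1)] configs_in) auto
  ultimately show ?case using insert by simp
qed

text \<open>Changing the color at \<open>w\<close> acts on the average over
  \<open>avail \<sigma> u\<close> in two ways: the integrand changes by \<open>\<delta> w\<close>,
  and if \<open>w\<close> is a neighbour of \<open>u\<close> the available colors change by at most
  one element on each side, which costs \<open>\<delta> u / a\<close> by
  \<open>average_diff_le\<close>. The average forgets the color at \<open>u\<close> itself.\<close>

lemma resample_osc_le:
  assumes osc: "osc_le g \<delta>" and u: "u \<in> V"
  shows "osc_le (resample u g) (\<lambda>w. if w = u then 0 else \<delta> w + (if w \<in> N u then \<delta> u / a else 0))"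
  unfolding osc_le_def
proof (intro ballI)
  fix \<sigma> w c assume \<sigma>: "\<sigma> \<in> configs" and w: "w \<in> V" and c: "c \<in> L w"
  let ?A = "avail \<sigma> u" and ?\<tau> = "\<sigma>(w := c)"
  let ?A' = "avail ?\<tau> u"
  show "\<bar>resample u g ?\<tau> - resample u g \<sigma>\<bar> \<le> (if w = u then 0 else \<delta> w + (if w \<in> N u then \<delta> u / a else 0))"
  proof (cases "w = u")
    case True
    thus ?thesis using N_irrefl by (simp add: resample_def avail_upd)
  next
    case False
    let ?F = "\<lambda>d. g (\<sigma>(u := d))"
    have pos: "0 < real (card ?A')" using card_avail_pos[OF u, of ?\<tau>] by simp
    have "\<bar>(\<Sum>d\<in>?A'. g (?\<tau>(u := d))) - (\<Sum>d\<in>?A'. ?F d)\<bar> \<le> (\<Sum>d\<in>?A'. \<bar>g (?\<tau>(u := d)) - ?F d\<bar>)"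
      by (simp add: sum_subtractf[symmetric])
    also have "\<dots> \<le> (\<Sum>d\<in>?A'. \<delta> w)"
    proof (rule sum_mono)
      fix d assume "d \<in> ?A'"
      hence "d \<in> L u" using avail_subset by auto
      hence "\<sigma>(u := d) \<in> configs" using configs_upd \<sigma> u by auto
      from osc_leD[OF osc this w c] show "\<bar>g (?\<tau>(u := d)) - ?F d\<bar> \<le> \<delta> w"
        using False by (simp add: fun_upd_twist)
    qed
    finally have "\<bar>(\<Sum>d\<in>?A'. g (?\<tau>(u := d))) - (\<Sum>d\<in>?A'. ?F d)\<bar> / card ?A' \<le> \<delta> w"
      using pos by (simp add: divide_simps mult.commute)
    hence 1: "\<bar>resample u g ?\<tau> - sum ?F ?A' / card ?A'\<bar> \<le> \<delta> w"
      by (simp add: resample_def diff_divide_distrib[symmetric])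
    have 2: "\<bar>sum ?F ?A' / card ?A' - resample u g \<sigma>\<bar> \<le> (if w \<in> N u then \<delta> u / a else 0)"
    proof (cases "w \<in> N u")
      case True
      \<comment> \<open>At most the old color of \<open>w\<close> becomes available, and at most the
        new color \<open>c\<close> is lost.\<close>
      have "?A' - ?A \<subseteq> {\<sigma> w}" "?A - ?A' \<subseteq> {c}" by (auto simp: avail_def)
      hence cards: "card (?A' - ?A) \<le> 1" "card (?A - ?A') \<le> 1"
        using card_mono[of "{\<sigma> w}" "?A' - ?A"] card_mono[of "{c}" "?A - ?A'"] by simp_all
      have "\<bar>?F d - ?F d'\<bar> \<le> \<delta> u" if "d \<in> ?A' \<union> ?A" "d' \<in> ?A' \<union> ?A" for d d'
      proof -
        have "d \<in> L u" "d' \<in> L u" using that avail_subset by auto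
        hence "\<sigma>(u := d') \<in> configs" using configs_upd \<sigma> u by auto
        from osc_leD[OF osc this u \<open>d \<in> L u\<close>] show ?thesis by simp
      qed
      from average_diff_le[OF finite_avail[OF u] finite_avail[OF u] cards _ card_avail_ge[OF u] card_avail_ge[OF u] this]
      show ?thesis using True a_gt_1 by (simp add: resample_def)
    next
      case False
      thus ?thesis by (simp add: resample_def avail_upd)
    qed
    show ?thesis using 1 2 False by simp
  qed
qed

text \<open>Splitting the sum over neighbours into parent and children gives two operators of norm
  at most sqrt \<open>D\<close> each. In \<open>A\<close> a single entry is picked, and every
  \<open>x u\<close> is picked by at most \<open>D\<close> vertices; in \<open>C\<close>
  Cauchy-Schwarz costs the number of children, at most \<open>D\<close>, and every
  \<open>x u\<close> appears under one parent only.\<close>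

lemma adjacency_L2:
  assumes x: "\<And>v. v \<in> V \<Longrightarrow> 0 \<le> x v"
  shows "L2_set (\<lambda>v. \<Sum>u\<in>N v. x u) V \<le> 2 * sqrt (real D) * L2_set x V"
proof -
  define A where "A v = (\<Sum>u\<in>{u\<in>N v. u = parent v}. x u)" for v
  define C where "C v = (\<Sum>u\<in>{u\<in>N v. v = parent u}. x u)" for v
  have x0: "0 \<le> x u" if "u \<in> N v" for u v using x N_subset that by blast
  have AC: "A v \<ge> 0" "C v \<ge> 0" for v unfolding A_def C_def using x0 by (auto intro!: sum_nonneg)
  \<comment> \<open>Only an inequality, since \<open>N_parent\<close> allows two vertices to be each
    other's parent, and then a neighbour is counted in both parts.\<close>
  have le: "(\<Sum>u\<in>N v. x u) \<le> A v + C v" for v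
  proof -
    define P where "P = {u\<in>N v. u = parent v}"
    define Q where "Q = {u\<in>N v. v = parent u}"
    have PQ: "N v = P \<union> Q" "P \<subseteq> N v" "Q \<subseteq> N v" using N_parent[of _ v] unfolding P_def Q_def by blast+
    have "(\<Sum>u\<in>N v. x u) = sum x (P \<union> Q)" using PQ(1) by simp
    also have "\<dots> \<le> sum x P + sum x Q"
    proof -
      have "0 \<le> sum x (P \<inter> Q)" using x0[of _ v] PQ(2) by (intro sum_nonneg) blast
      moreover have "sum x (P \<union> Q) + sum x (P \<inter> Q) = sum x P + sum x Q"
        using PQ finite_N[of v] finite_subset by (intro sum.union_inter) blast+
      ultimately show ?thesis by linarith
    qed
    also have "\<dots> = A v + C v" by (simp only: A_def C_def P_def Q_def)
    finally show ?thesis .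
  qed
  have "(\<Sum>v\<in>V. (A v)\<^sup>2) \<le> (\<Sum>v\<in>V. \<Sum>u\<in>V. if u \<in> N v then (if u = parent v then (x u)\<^sup>2 else 0) else 0)"
  proof (rule sum_mono)
    fix v assume "v \<in> V"
    have "A v = (if parent v \<in> N v then x (parent v) else 0)"
    proof (cases "parent v \<in> N v")
      case True
      hence "{u\<in>N v. u = parent v} = {parent v}" by (intro set_eqI) (simp, metis)
      thus ?thesis using True by (simp add: A_def)
    next
      case False
      hence "{u\<in>N v. u = parent v} = {}" by auto
      thus ?thesis using False by (simp only: A_def) simp
    qed
    moreover have "(\<Sum>u\<in>V. if u \<in> N v then (if u = parent v then (x u)\<^sup>2 else 0) else 0)
      = (\<Sum>u\<in>V. if u = parent v then (if u \<in> N v then (x u)\<^sup>2 else 0) else 0)"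
      by (intro sum.cong) auto
    ultimately show "(A v)\<^sup>2 \<le> (\<Sum>u\<in>V. if u \<in> N v then (if u = parent v then (x u)\<^sup>2 else 0) else 0)"
      using finite_V N_subset[of v] by (auto simp: sum.delta)
  qed
  also have "\<dots> = (\<Sum>u\<in>V. \<Sum>v\<in>V. if u \<in> N v then (if u = parent v then (x u)\<^sup>2 else 0) else 0)"
    by (rule sum.swap)
  also have "\<dots> \<le> (\<Sum>u\<in>V. real D * (x u)\<^sup>2)"
  proof (rule sum_mono)
    fix u assume u: "u \<in> V"
    have "(\<Sum>v\<in>V. if u \<in> N v then (if u = parent v then (x u)\<^sup>2 else 0) else 0)
      \<le> (\<Sum>v\<in>V. if v \<in> N u then (x u)\<^sup>2 else 0)"
      using N_sym by (intro sum_mono) auto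
    also have "\<dots> = (\<Sum>v\<in>N u. (x u)\<^sup>2)"
      using finite_V N_subset[of u] by (subst sum.inter_restrict[symmetric]) (auto simp: Int_absorb1)
    also have "\<dots> \<le> real D * (x u)\<^sup>2"
      using degree_le[OF u] by (simp add: mult_right_mono)
    finally show "(\<Sum>v\<in>V. if u \<in> N v then (if u = parent v then (x u)\<^sup>2 else 0) else 0) \<le> real D * (x u)\<^sup>2" .
  qed
  finally have A2: "(\<Sum>v\<in>V. (A v)\<^sup>2) \<le> real D * (\<Sum>u\<in>V. (x u)\<^sup>2)" by (simp add: sum_distrib_left)
  have "(\<Sum>v\<in>V. (C v)\<^sup>2) \<le> (\<Sum>v\<in>V. real D * (\<Sum>u\<in>V. if v = parent u then (x u)\<^sup>2 else 0))"
  proof (rule sum_mono)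
    fix v assume v: "v \<in> V"
    have "(C v)\<^sup>2 \<le> (\<Sum>u\<in>{u\<in>N v. v = parent u}. (x u)\<^sup>2) * real (card {u\<in>N v. v = parent u})"
      unfolding C_def by (rule sum_squared_le_sum_of_squares)
    also have "real (card {u\<in>N v. v = parent u}) \<le> real D"
      using degree_le[OF v] card_mono[OF finite_N[of v], of "{u\<in>N v. v = parent u}"] by auto
    also have "(\<Sum>u\<in>{u\<in>N v. v = parent u}. (x u)\<^sup>2) \<le> (\<Sum>u\<in>{u\<in>V. v = parent u}. (x u)\<^sup>2)"
      using finite_V N_subset[of v] by (intro sum_mono2) auto
    also have "\<dots> = (\<Sum>u\<in>V. if v = parent u then (x u)\<^sup>2 else 0)"
      using finite_V by (simp add: sum.inter_filter)
    finally show "(C v)\<^sup>2 \<le> real D * (\<Sum>u\<in>V. if v = parent u then (x u)\<^sup>2 else 0)"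
      by (simp add: mult.commute mult_left_mono mult_right_mono sum_nonneg)
  qed
  also have "\<dots> = real D * (\<Sum>u\<in>V. \<Sum>v\<in>V. if v = parent u then (x u)\<^sup>2 else 0)"
    by (subst sum.swap) (simp add: sum_distrib_left)
  also have "\<dots> \<le> real D * (\<Sum>u\<in>V. (x u)\<^sup>2)"
    using finite_V by (intro mult_left_mono sum_mono) (auto simp: sum.delta)
  finally have C2: "(\<Sum>v\<in>V. (C v)\<^sup>2) \<le> real D * (\<Sum>u\<in>V. (x u)\<^sup>2)" .
  have "L2_set (\<lambda>v. \<Sum>u\<in>N v. x u) V \<le> L2_set (\<lambda>v. A v + C v) V"
    using le x0 by (intro L2_set_mono) (auto intro!: sum_nonneg)
  also have "\<dots> \<le> L2_set A V + L2_set C V" by (rule L2_set_triangle_ineq)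
  also have "L2_set A V \<le> sqrt (real D) * L2_set x V"
    using A2 unfolding L2_set_def by (simp add: real_sqrt_mult[symmetric])
  also have "L2_set C V \<le> sqrt (real D) * L2_set x V"
    using C2 unfolding L2_set_def by (simp add: real_sqrt_mult[symmetric])
  finally show ?thesis by (simp add: mult_ac)
qed

end

section \<open>Conditional averages and entropy\<close>

text \<open>Gibbs' inequality at one point, from ln x \<le> x - 1 with x = \<open>b * s / a\<close>.
  The logarithms of \<open>b\<close> and \<open>s\<close> are kept apart so that each can be
  averaged, and \<open>pos\<close> is the absolute continuity that keeps the value of
  \<open>ln 0\<close> out of terms with \<open>a > 0\<close>.\<close>

lemma mult_ln_diff_ge:
  fixes a b s :: real
  assumes "0 \<le> a" "0 \<le> b" "0 \<le> s" and pos: "0 < a \<Longrightarrow> 0 < b \<and> 0 < s"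
  shows "a - b * s \<le> a * ln a - a * ln b - a * ln s"
proof (cases "a = 0")
  case True
  thus ?thesis using assms by simp
next
  case False
  hence p: "0 < a" "0 < b" "0 < s" using assms by auto
  have "ln (b * s / a) \<le> b * s / a - 1" using p by (intro ln_le_minus_one) auto
  hence "a * ln (b * s / a) \<le> a * (b * s / a - 1)" using p by (intro mult_left_mono) auto
  also have "\<dots> = b * s - a" using p by (simp add: field_simps)
  finally show ?thesis using p by (simp add: ln_mult ln_div algebra_simps)
qed

context coloring_instance
begin

text \<open>The state space after pinning all colors outside \<open>U\<close>. For colorings
  \<sigma> these sets are the classes of an equivalence relation, so \<open>av U\<close> and
  \<open>ent U\<close> are conditional expectation and conditional entropy given the colors outside
  \<open>U\<close>.\<close>

definition block :: "'v set \<Rightarrow> ('v \<Rightarrow> 'c) \<Rightarrow> ('v \<Rightarrow> 'c) set" where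
  "block U \<sigma> = {\<eta> \<in> colorings. \<forall>x. x \<notin> U \<longrightarrow> \<eta> x = \<sigma> x}"

definition av :: "'v set \<Rightarrow> (('v \<Rightarrow> 'c) \<Rightarrow> real) \<Rightarrow> ('v \<Rightarrow> 'c) \<Rightarrow> real" where
  "av U f \<sigma> = (\<Sum>\<eta>\<in>block U \<sigma>. f \<eta>) / card (block U \<sigma>)"

definition ent :: "'v set \<Rightarrow> (('v \<Rightarrow> 'c) \<Rightarrow> real) \<Rightarrow> ('v \<Rightarrow> 'c) \<Rightarrow> real" where
  "ent U f \<sigma> = av U (\<lambda>\<eta>. f \<eta> * ln (f \<eta>)) \<sigma> - av U f \<sigma> * ln (av U f \<sigma>)"

lemma finite_block: "finite (block U \<sigma>)"
  unfolding block_def using finite_colorings by auto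

lemma block_subset: "block U \<sigma> \<subseteq> colorings"
  by (auto simp: block_def)

lemma self_in_block: "\<sigma> \<in> colorings \<Longrightarrow> \<sigma> \<in> block U \<sigma>"
  by (auto simp: block_def)

lemma card_block_pos: "\<sigma> \<in> colorings \<Longrightarrow> 0 < real (card (block U \<sigma>))"
  using self_in_block[of \<sigma> U] finite_block[of U \<sigma>] by (auto simp: card_gt_0_iff)

lemma block_eq: "\<eta> \<in> block U \<sigma> \<Longrightarrow> block U \<eta> = block U \<sigma>"
  by (auto simp: block_def)

lemma block_mono: "W \<subseteq> U \<Longrightarrow> \<eta> \<in> block U \<sigma> \<Longrightarrow> block W \<eta> \<subseteq> block U \<sigma>"
  unfolding block_def by (auto simp: subset_iff)

lemma block_sym: "\<sigma> \<in> colorings \<Longrightarrow> \<eta> \<in> block U \<sigma> \<Longrightarrow> \<sigma> \<in> block U \<eta>"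
  by (auto simp: block_def)

lemma av_eq: "\<eta> \<in> block U \<sigma> \<Longrightarrow> av U f \<eta> = av U f \<sigma>"
  by (simp add: av_def block_eq)

lemma av_cong: "(\<And>\<eta>. \<eta> \<in> block U \<sigma> \<Longrightarrow> f \<eta> = g \<eta>) \<Longrightarrow> av U f \<sigma> = av U g \<sigma>"
  by (simp add: av_def)

lemma av_add: "av U (\<lambda>\<eta>. f \<eta> + g \<eta>) \<sigma> = av U f \<sigma> + av U g \<sigma>"
  by (simp add: av_def sum.distrib add_divide_distrib)

lemma av_diff: "av U (\<lambda>\<eta>. f \<eta> - g \<eta>) \<sigma> = av U f \<sigma> - av U g \<sigma>"
  by (simp add: av_def sum_subtractf diff_divide_distrib)

lemma av_cmult: "av U (\<lambda>\<eta>. c * f \<eta>) \<sigma> = c * av U f \<sigma>"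
  by (simp add: av_def sum_distrib_left)

lemma av_sum: "av U (\<lambda>\<eta>. \<Sum>i\<in>I. f i \<eta>) \<sigma> = (\<Sum>i\<in>I. av U (f i) \<sigma>)"
  unfolding av_def by (subst sum.swap) (simp add: sum_divide_distrib)

lemma av_const: "\<sigma> \<in> colorings \<Longrightarrow> av U (\<lambda>_. c) \<sigma> = c"
  using card_block_pos[of \<sigma> U] by (simp add: av_def)

lemma av_mono: "(\<And>\<eta>. \<eta> \<in> block U \<sigma> \<Longrightarrow> f \<eta> \<le> g \<eta>) \<Longrightarrow> av U f \<sigma> \<le> av U g \<sigma>"
  unfolding av_def by (intro divide_right_mono sum_mono) auto

lemma av_nonneg: "(\<And>\<eta>. \<eta> \<in> block U \<sigma> \<Longrightarrow> 0 \<le> f \<eta>) \<Longrightarrow> 0 \<le> av U f \<sigma>"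
  unfolding av_def by (intro divide_nonneg_nonneg sum_nonneg) auto

lemma av_abs: "\<bar>av U f \<sigma>\<bar> \<le> av U (\<lambda>\<eta>. \<bar>f \<eta>\<bar>) \<sigma>"
  unfolding av_def by (simp add: abs_divide divide_right_mono)

lemma av_le_const: "\<sigma> \<in> colorings \<Longrightarrow> (\<And>\<eta>. \<eta> \<in> block U \<sigma> \<Longrightarrow> f \<eta> \<le> c) \<Longrightarrow> av U f \<sigma> \<le> c"
  using av_mono[of U \<sigma> f "\<lambda>_. c"] av_const[of \<sigma> U c] by simp

lemma av_pos:
  assumes "\<sigma> \<in> colorings" "\<And>\<eta>. \<eta> \<in> block U \<sigma> \<Longrightarrow> 0 \<le> f \<eta>" "\<eta> \<in> block U \<sigma>" "0 < f \<eta>"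
  shows "0 < av U f \<sigma>"
  unfolding av_def using assms finite_block card_block_pos[of \<sigma> U]
  by (intro divide_pos_pos sum_pos2[of _ \<eta>]) auto

lemma av_mult_inv:
  assumes "\<And>\<eta>. \<eta> \<in> block U \<sigma> \<Longrightarrow> h \<eta> = c"
  shows "av U (\<lambda>\<eta>. h \<eta> * g \<eta>) \<sigma> = c * av U g \<sigma>"
  using av_cong[of U \<sigma> "\<lambda>\<eta>. h \<eta> * g \<eta>" "\<lambda>\<eta>. c * g \<eta>"] assms by (simp add: av_cmult)

text \<open>Self-adjointness of a conditional expectation: lying in the same \<open>W\<close>-block
  is symmetric, and the normalizing cardinality is constant on blocks. With one factor equal to 1 it
  becomes the tower property.\<close>

lemma av_adj:
  assumes W: "W \<subseteq> U"
  shows "av U (\<lambda>\<sigma>. f \<sigma> * av W g \<sigma>) \<tau> = av U (\<lambda>\<sigma>. av W f \<sigma> * g \<sigma>) \<tau>"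
proof -
  let ?B = "block U \<tau>"
  have restr: "(\<Sum>\<eta>\<in>block W \<sigma>. F \<eta>) = (\<Sum>\<eta>\<in>?B. if \<eta> \<in> block W \<sigma> then F \<eta> else 0)"
    if "\<sigma> \<in> ?B" for \<sigma> and F :: "_ \<Rightarrow> real"
    using block_mono[OF W that] finite_block[of U \<tau>]
    by (simp add: sum.inter_restrict[symmetric] Int_absorb1)
  have "(\<Sum>\<sigma>\<in>?B. f \<sigma> * av W g \<sigma>)
    = (\<Sum>\<sigma>\<in>?B. \<Sum>\<eta>\<in>?B. if \<eta> \<in> block W \<sigma> then f \<sigma> * g \<eta> / card (block W \<sigma>) else 0)"
    unfolding av_def by (intro sum.cong refl) (simp add: restr sum_distrib_left sum_divide_distrib if_distrib[of "\<lambda>x. _ * x / _"] cong: if_cong)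
  also have "\<dots> = (\<Sum>\<eta>\<in>?B. \<Sum>\<sigma>\<in>?B. if \<eta> \<in> block W \<sigma> then f \<sigma> * g \<eta> / card (block W \<sigma>) else 0)"
    by (rule sum.swap)
  also have "\<dots> = (\<Sum>\<eta>\<in>?B. \<Sum>\<sigma>\<in>?B. if \<sigma> \<in> block W \<eta> then f \<sigma> * g \<eta> / card (block W \<eta>) else 0)"
  proof (intro sum.cong refl)
    fix \<eta> \<sigma> assume "\<eta> \<in> ?B" "\<sigma> \<in> ?B"
    hence "\<eta> \<in> colorings" "\<sigma> \<in> colorings" using block_subset by auto
    hence "\<eta> \<in> block W \<sigma> \<longleftrightarrow> \<sigma> \<in> block W \<eta>" using block_sym by blast
    thus "(if \<eta> \<in> block W \<sigma> then f \<sigma> * g \<eta> / card (block W \<sigma>) else 0)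
      = (if \<sigma> \<in> block W \<eta> then f \<sigma> * g \<eta> / card (block W \<eta>) else 0)"
      by (simp add: block_eq)
  qed
  also have "\<dots> = (\<Sum>\<eta>\<in>?B. av W f \<eta> * g \<eta>)"
    unfolding av_def by (intro sum.cong refl) (simp add: restr sum_distrib_right sum_divide_distrib if_distrib[of "\<lambda>x. x * _ / _"] cong: if_cong)
  finally show ?thesis by (simp add: av_def[of U])
qed

lemma av_tower:
  assumes "W \<subseteq> U"
  shows "av U (av W g) \<tau> = av U g \<tau>"
proof -
  have "av U (\<lambda>\<sigma>. 1 * av W g \<sigma>) \<tau> = av U (\<lambda>\<sigma>. av W (\<lambda>_. 1) \<sigma> * g \<sigma>) \<tau>"
    by (rule av_adj[OF assms])
  also have "\<dots> = av U g \<tau>"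
    using av_const block_subset by (intro av_cong) (auto simp: subset_iff)
  finally show ?thesis by simp
qed

lemma block_single:
  assumes "\<sigma> \<in> colorings" "v \<in> V"
  shows "block {v} \<sigma> = (\<lambda>c. \<sigma>(v := c)) ` avail \<sigma> v"
proof (intro set_eqI iffI)
  fix \<eta> assume \<eta>: "\<eta> \<in> block {v} \<sigma>"
  hence eq: "\<eta> = \<sigma>(v := \<eta> v)" by (auto simp: block_def)
  have "\<eta> v \<in> avail \<sigma> v"
    unfolding avail_def
  proof (intro CollectI conjI ballI)
    show "\<eta> v \<in> L v" using \<eta> assms(2) colorings_subset configs_in by (auto simp: block_def)
  next
    fix u assume u: "u \<in> N v"
    hence "\<eta> v \<noteq> \<eta> u" using \<eta> assms(2) by (auto simp: block_def colorings_def)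
    moreover have "u \<noteq> v" using u N_irrefl by auto
    ultimately show "\<eta> v \<noteq> \<sigma> u" using \<eta> by (simp add: block_def)
  qed
  thus "\<eta> \<in> (\<lambda>c. \<sigma>(v := c)) ` avail \<sigma> v" using eq by blast
next
  fix \<eta> assume "\<eta> \<in> (\<lambda>c. \<sigma>(v := c)) ` avail \<sigma> v"
  then obtain c where c: "c \<in> avail \<sigma> v" and eq: "\<eta> = \<sigma>(v := c)" by auto
  have "\<eta> \<in> configs" unfolding eq using assms c colorings_subset avail_subset by (intro configs_upd) auto
  moreover have "\<forall>w\<in>V. \<forall>u\<in>N w. \<eta> w \<noteq> \<eta> u"
  proof (intro ballI)
    fix w u assume w: "w \<in> V" and u: "u \<in> N w"
    have "u \<noteq> w" using u N_irrefl by auto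
    consider "w = v" | "u = v" | "w \<noteq> v" "u \<noteq> v" by auto
    thus "\<eta> w \<noteq> \<eta> u"
    proof cases
      case 1
      thus ?thesis using c u \<open>u \<noteq> w\<close> by (auto simp: eq avail_def)
    next
      case 2
      hence "w \<in> N v" using u N_sym by auto
      thus ?thesis using c 2 \<open>u \<noteq> w\<close> by (auto simp: eq avail_def)
    next
      case 3
      thus ?thesis using assms(1) w u by (auto simp: eq colorings_def)
    qed
  qed
  ultimately show "\<eta> \<in> block {v} \<sigma>" by (auto simp: block_def colorings_def eq)
qed

text \<open>The bridge between two descriptions of an update: \<open>resample\<close> makes sense on
  improper colorings, where oscillations are measured, while \<open>av {v}\<close> is an orthogonal
  projection for the uniform distribution on proper ones.\<close>

lemma av_single:
  assumes "\<sigma> \<in> colorings" "v \<in> V"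
  shows "av {v} g \<sigma> = resample v g \<sigma>"
proof -
  have inj: "inj_on (\<lambda>c. \<sigma>(v := c)) (avail \<sigma> v)"
    by (rule inj_onI) (metis fun_upd_same)
  show ?thesis
    unfolding av_def resample_def block_single[OF assms] using inj
    by (simp add: sum.reindex card_image)
qed

lemma block_remove:
  assumes "\<sigma> \<in> block U \<tau>" "v \<in> U"
  shows "block (U - {v}) \<sigma> = {\<eta> \<in> block U \<tau>. \<eta> v = \<sigma> v}"
  using assms by (auto simp: block_def)

lemma ent_nonneg:
  assumes \<tau>: "\<tau> \<in> colorings" and f: "\<And>\<eta>. \<eta> \<in> block U \<tau> \<Longrightarrow> 0 \<le> f \<eta>"
  shows "0 \<le> ent U f \<tau>"
proof -
  define m where "m = av U f \<tau>"
  have m: "0 \<le> m" unfolding m_def by (rule av_nonneg[OF f])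
  have "av U (\<lambda>\<eta>. f \<eta> - m) \<tau> \<le> av U (\<lambda>\<eta>. f \<eta> * ln (f \<eta>) - ln m * f \<eta>) \<tau>"
  proof (rule av_mono)
    fix \<eta> assume \<eta>: "\<eta> \<in> block U \<tau>"
    have "0 < m" if "0 < f \<eta>" unfolding m_def using av_pos[of \<tau> U f \<eta>] \<tau> f \<eta> that by blast
    with mult_ln_diff_ge[OF f[OF \<eta>] m zero_le_one]
    show "f \<eta> - m \<le> f \<eta> * ln (f \<eta>) - ln m * f \<eta>" by (simp add: mult.commute)
  qed
  thus ?thesis
    unfolding ent_def m_def[symmetric] av_diff av_cmult by (simp add: m_def[symmetric] av_const[OF \<tau>] mult.commute)
qed

lemma ent_chain:
  assumes "W \<subseteq> U"
  shows "ent U f \<tau> = av U (ent W f) \<tau> + ent U (av W f) \<tau>"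
  unfolding ent_def av_diff av_tower[OF assms] by simp

end

section \<open>Dobrushin comparison\<close>

context coloring_instance
begin

text \<open>With \<open>f\<close> read as a density on \<open>block U \<tau>\<close>, the vector
  \<open>m\<close> is what Dobrushin's comparison theorem calls an estimate for the measure with
  density \<open>f\<close> and the uniform one.\<close>

definition comparison :: "'v set \<Rightarrow> ('v \<Rightarrow> 'c) \<Rightarrow> (('v \<Rightarrow> 'c) \<Rightarrow> real) \<Rightarrow> ('v \<Rightarrow> real) \<Rightarrow> bool" where
  "comparison U \<tau> f m \<longleftrightarrow> (\<forall>g \<delta>. osc_le g \<delta> \<longrightarrow>
     \<bar>av U (\<lambda>\<sigma>. f \<sigma> * g \<sigma>) \<tau> - av U g \<tau>\<bar> \<le> (\<Sum>u\<in>U. m u * \<delta> u))"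

text \<open>For a density \<open>f\<close> this is, up to a factor 2, the mean total variation
  distance under that density between the conditional laws of the color at \<open>u\<close> for the
  two measures.\<close>

definition dev :: "'v set \<Rightarrow> ('v \<Rightarrow> 'c) \<Rightarrow> (('v \<Rightarrow> 'c) \<Rightarrow> real) \<Rightarrow> 'v \<Rightarrow> real" where
  "dev U \<tau> f u = av U (\<lambda>\<sigma>. \<bar>f \<sigma> - av {u} f \<sigma>\<bar>) \<tau>"

lemma diff_resample_le:
  assumes "osc_le g \<delta>" "\<sigma> \<in> configs" "u \<in> V"
  shows "\<bar>g \<sigma> - resample u g \<sigma>\<bar> \<le> \<delta> u"
proof -
  let ?A = "avail \<sigma> u"
  have pos: "0 < real (card ?A)" using card_avail_pos[OF assms(3), of \<sigma>] by simp
  have "g \<sigma> - resample u g \<sigma> = (\<Sum>c\<in>?A. g \<sigma> - g (\<sigma>(u := c))) / card ?A"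
    unfolding resample_def using pos by (simp add: sum_subtractf diff_divide_distrib)
  also have "\<bar>\<dots>\<bar> \<le> (\<Sum>c\<in>?A. \<bar>g \<sigma> - g (\<sigma>(u := c))\<bar>) / card ?A"
    unfolding abs_divide using sum_abs by (auto intro!: divide_right_mono)
  also have "\<dots> \<le> (\<Sum>c\<in>?A. \<delta> u) / card ?A"
    using osc_leD[OF assms] avail_subset
    by (intro divide_right_mono sum_mono) (auto simp: abs_minus_commute)
  also have "\<dots> = \<delta> u" using pos by simp
  finally show ?thesis .
qed

lemma adjacency_L2_within:
  assumes U: "U \<subseteq> V" and x: "\<And>v. v \<in> U \<Longrightarrow> 0 \<le> x v"
  shows "L2_set (\<lambda>v. \<Sum>u\<in>N v \<inter> U. x u) U \<le> 2 * sqrt (real D) * L2_set x U"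
proof -
  define y where "y v = (if v \<in> U then x v else 0)" for v
  have y: "0 \<le> y v" for v using x by (simp add: y_def)
  have s: "(\<Sum>u\<in>N v \<inter> U. x u) = (\<Sum>u\<in>N v. y u)" for v
    unfolding y_def using finite_N by (simp add: sum.inter_restrict)
  have "L2_set (\<lambda>v. \<Sum>u\<in>N v. y u) U \<le> L2_set (\<lambda>v. \<Sum>u\<in>N v. y u) V"
    unfolding L2_set_def using U finite_V by (intro real_sqrt_le_mono sum_mono2) auto
  also have "\<dots> \<le> 2 * sqrt (real D) * L2_set y V" using y by (intro adjacency_L2)
  also have "L2_set y V = L2_set x U"
  proof -
    have "(\<Sum>v\<in>V. (y v)\<^sup>2) = (\<Sum>v\<in>U. (x v)\<^sup>2)"
      using U finite_V by (intro sum.mono_neutral_cong_right) (auto simp: y_def)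
    thus ?thesis by (simp add: L2_set_def)
  qed
  finally show ?thesis by (simp add: s)
qed

lemma comparison_cong:
  "comparison U \<tau> f m \<Longrightarrow> (\<And>u. u \<in> U \<Longrightarrow> m u = m' u) \<Longrightarrow> comparison U \<tau> f m'"
  unfolding comparison_def by (simp cong: sum.cong)

text \<open>The starting estimate: colorings of one block are joined by at most one change per
  vertex of \<open>U\<close>.\<close>

lemma comparison_one:
  assumes U: "U \<subseteq> V" and \<tau>: "\<tau> \<in> colorings" and f: "\<And>\<eta>. \<eta> \<in> block U \<tau> \<Longrightarrow> 0 \<le> f \<eta>" and f1: "av U f \<tau> = 1"
  shows "comparison U \<tau> f (\<lambda>_. 1)"
  unfolding comparison_def
proof (intro allI impI)
  fix g \<delta> assume osc: "osc_le g \<delta>"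
  define c where "c = av U g \<tau>"
  have "\<bar>g \<eta> - c\<bar> \<le> sum \<delta> U" if \<eta>: "\<eta> \<in> block U \<tau>" for \<eta>
  proof -
    have "g \<eta> - c = av U (\<lambda>\<sigma>. g \<eta> - g \<sigma>) \<tau>" by (simp add: c_def av_diff av_const[OF \<tau>])
    also have "\<bar>\<dots>\<bar> \<le> av U (\<lambda>\<sigma>. \<bar>g \<eta> - g \<sigma>\<bar>) \<tau>" by (rule av_abs)
    also have "\<dots> \<le> sum \<delta> U"
    proof (rule av_le_const[OF \<tau>])
      fix \<sigma> assume "\<sigma> \<in> block U \<tau>"
      thus "\<bar>g \<eta> - g \<sigma>\<bar> \<le> sum \<delta> U"
        using \<eta> U colorings_subset finite_subset[OF U finite_V]
        by (intro osc_le_diff[OF osc]) (auto simp: block_def)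
    qed
    finally show ?thesis .
  qed
  hence le: "\<bar>f \<eta> * (g \<eta> - c)\<bar> \<le> sum \<delta> U * f \<eta>" if "\<eta> \<in> block U \<tau>" for \<eta>
    using f[OF that] that by (simp add: abs_mult mult.commute mult_left_mono)
  have "av U (\<lambda>\<sigma>. f \<sigma> * g \<sigma>) \<tau> - av U g \<tau> = av U (\<lambda>\<sigma>. f \<sigma> * (g \<sigma> - c)) \<tau>"
    using f1 by (simp add: right_diff_distrib av_diff c_def[symmetric] mult.commute[of _ c] av_cmult)
  also have "\<bar>\<dots>\<bar> \<le> av U (\<lambda>\<sigma>. \<bar>f \<sigma> * (g \<sigma> - c)\<bar>) \<tau>" by (rule av_abs)
  also have "\<dots> \<le> av U (\<lambda>\<sigma>. sum \<delta> U * f \<sigma>) \<tau>" by (rule av_mono[OF le])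
  also have "\<dots> = sum \<delta> U" by (simp add: av_cmult f1)
  finally show "\<bar>av U (\<lambda>\<sigma>. f \<sigma> * g \<sigma>) \<tau> - av U g \<tau>\<bar> \<le> (\<Sum>u\<in>U. 1 * \<delta> u)" by simp
qed

text \<open>Resampling \<open>u\<close> is a self-adjoint projection \<open>?P\<close>. Replacing
  \<open>g\<close> by \<open>?P g\<close> under \<open>f\<close> costs E((f - \<open>?P\<close> f)(g
  - \<open>?P\<close> g)), at most \<open>dev\<close> times \<open>\<delta> u\<close>. The old
  estimate is then applied to \<open>?P g\<close>, whose oscillation at \<open>u\<close> is gone and
  has partly moved to the neighbours.\<close>

lemma comparison_update:
  assumes U: "U \<subseteq> V" and \<tau>: "\<tau> \<in> colorings" and m: "comparison U \<tau> f m" and u: "u \<in> U"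
  shows "comparison U \<tau> f (m(u := dev U \<tau> f u + (\<Sum>w\<in>N u \<inter> U. m w) / a))"
  unfolding comparison_def
proof (intro allI impI)
  fix g \<delta> assume osc: "osc_le g \<delta>"
  have uV: "u \<in> V" and sub: "{u} \<subseteq> U" and finU: "finite U" using u U finite_V finite_subset by auto
  let ?E = "\<lambda>h. av U h \<tau>" and ?P = "av {u}"
  have R: "?P g \<sigma> = resample u g \<sigma>" if "\<sigma> \<in> block U \<tau>" for \<sigma>
    using that block_subset by (intro av_single uV) auto
  have idem: "?P (?P f) \<sigma> = ?P f \<sigma>" for \<sigma> by (rule av_tower) simp
  have "?E (\<lambda>\<sigma>. ?P f \<sigma> * ?P g \<sigma>) = ?E (\<lambda>\<sigma>. ?P f \<sigma> * g \<sigma>)"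
    using av_adj[OF sub, of "?P f" g \<tau>] by (simp add: idem)
  moreover have "?E (\<lambda>\<sigma>. (f \<sigma> - ?P f \<sigma>) * (g \<sigma> - ?P g \<sigma>)) =
    ?E (\<lambda>\<sigma>. (f \<sigma> * g \<sigma> - f \<sigma> * ?P g \<sigma>) - (?P f \<sigma> * g \<sigma> - ?P f \<sigma> * ?P g \<sigma>))"
    by (rule av_cong) (simp add: algebra_simps)
  ultimately have e1: "?E (\<lambda>\<sigma>. f \<sigma> * g \<sigma>) - ?E (\<lambda>\<sigma>. f \<sigma> * ?P g \<sigma>) = ?E (\<lambda>\<sigma>. (f \<sigma> - ?P f \<sigma>) * (g \<sigma> - ?P g \<sigma>))"
    by (simp only: av_diff)
  have "\<bar>?E (\<lambda>\<sigma>. (f \<sigma> - ?P f \<sigma>) * (g \<sigma> - ?P g \<sigma>))\<bar> \<le> ?E (\<lambda>\<sigma>. \<bar>(f \<sigma> - ?P f \<sigma>) * (g \<sigma> - ?P g \<sigma>)\<bar>)" by (rule av_abs)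
  also have "\<dots> \<le> ?E (\<lambda>\<sigma>. \<delta> u * \<bar>f \<sigma> - ?P f \<sigma>\<bar>)"
  proof (rule av_mono)
    fix \<sigma> assume \<sigma>: "\<sigma> \<in> block U \<tau>"
    have "\<sigma> \<in> configs" using \<sigma> block_subset colorings_subset by auto
    hence "\<bar>g \<sigma> - ?P g \<sigma>\<bar> \<le> \<delta> u" using diff_resample_le[OF osc _ uV] R[OF \<sigma>] by simp
    from mult_left_mono[OF this abs_ge_zero[of "f \<sigma> - ?P f \<sigma>"]]
    show "\<bar>(f \<sigma> - ?P f \<sigma>) * (g \<sigma> - ?P g \<sigma>)\<bar> \<le> \<delta> u * \<bar>f \<sigma> - ?P f \<sigma>\<bar>"
      by (simp only: abs_mult mult.commute)
  qed
  also have "\<dots> = dev U \<tau> f u * \<delta> u" by (simp add: av_cmult dev_def)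
  finally have 1: "\<bar>?E (\<lambda>\<sigma>. f \<sigma> * g \<sigma>) - ?E (\<lambda>\<sigma>. f \<sigma> * ?P g \<sigma>)\<bar> \<le> dev U \<tau> f u * \<delta> u"
    by (simp only: e1)
  let ?\<delta> = "\<lambda>w. if w = u then 0 else \<delta> w + (if w \<in> N u then \<delta> u / a else 0)"
  have e2: "?E (\<lambda>\<sigma>. f \<sigma> * ?P g \<sigma>) - ?E g = ?E (\<lambda>\<sigma>. f \<sigma> * resample u g \<sigma>) - ?E (resample u g)"
    using av_tower[OF sub, of g \<tau>] R av_cong[of U \<tau> "?P g" "resample u g"]
      av_cong[of U \<tau> "\<lambda>\<sigma>. f \<sigma> * ?P g \<sigma>" "\<lambda>\<sigma>. f \<sigma> * resample u g \<sigma>"] by simp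
  have "\<bar>?E (\<lambda>\<sigma>. f \<sigma> * resample u g \<sigma>) - ?E (resample u g)\<bar> \<le> (\<Sum>w\<in>U. m w * ?\<delta> w)"
    using m resample_osc_le[OF osc uV] unfolding comparison_def by blast
  also have "\<dots> = (\<Sum>w\<in>U - {u}. m w * \<delta> w + (if w \<in> N u then m w * (\<delta> u / a) else 0))"
  proof -
    have "m w * ?\<delta> w = m w * \<delta> w + (if w \<in> N u then m w * (\<delta> u / a) else 0)" if "w \<in> U - {u}" for w
      using that by (cases "w \<in> N u") (simp_all add: distrib_left)
    hence "(\<Sum>w\<in>U - {u}. m w * ?\<delta> w) = (\<Sum>w\<in>U - {u}. m w * \<delta> w + (if w \<in> N u then m w * (\<delta> u / a) else 0))"
      by (rule sum.cong[OF refl])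
    thus ?thesis by (subst sum.remove[OF finU u]) simp
  qed
  also have "\<dots> = (\<Sum>w\<in>U - {u}. m w * \<delta> w) + (\<Sum>w\<in>N u \<inter> U. m w * (\<delta> u / a))"
  proof -
    have "(\<Sum>w\<in>U - {u}. if w \<in> N u then m w * (\<delta> u / a) else 0) = (\<Sum>w\<in>(U - {u}) \<inter> N u. m w * (\<delta> u / a))"
      by (rule sum.inter_restrict[symmetric]) (use finU in simp)
    also have "(U - {u}) \<inter> N u = N u \<inter> U" using N_irrefl by auto
    finally show ?thesis by (simp add: sum.distrib)
  qed
  also have "(\<Sum>w\<in>N u \<inter> U. m w * (\<delta> u / a)) = (\<Sum>w\<in>N u \<inter> U. m w) / a * \<delta> u"
    by (simp add: sum_distrib_right sum_divide_distrib)
  finally have 2: "\<bar>?E (\<lambda>\<sigma>. f \<sigma> * ?P g \<sigma>) - ?E g\<bar> \<le>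
    (\<Sum>w\<in>U - {u}. m w * \<delta> w) + (\<Sum>w\<in>N u \<inter> U. m w) / a * \<delta> u"
    by (simp only: e2)
  have "(\<Sum>w\<in>U. (m(u := dev U \<tau> f u + (\<Sum>w\<in>N u \<inter> U. m w) / a)) w * \<delta> w)
    = (dev U \<tau> f u + (\<Sum>w\<in>N u \<inter> U. m w) / a) * \<delta> u + (\<Sum>w\<in>U - {u}. m w * \<delta> w)"
    using finU u by (subst sum.remove[OF finU u]) (auto intro!: sum.cong)
  thus "\<bar>?E (\<lambda>\<sigma>. f \<sigma> * g \<sigma>) - ?E g\<bar> \<le>
    (\<Sum>w\<in>U. (m(u := dev U \<tau> f u + (\<Sum>w\<in>N u \<inter> U. m w) / a)) w * \<delta> w)"
    using 1 2 by (simp add: distrib_right)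
qed

lemma comparison_average:
  assumes U: "finite U" "U \<noteq> {}" and m: "\<And>u. u \<in> U \<Longrightarrow> comparison U \<tau> f (m u)"
  shows "comparison U \<tau> f (\<lambda>w. (\<Sum>u\<in>U. m u w) / card U)"
  unfolding comparison_def
proof (intro allI impI)
  fix g \<delta> assume osc: "osc_le g \<delta>"
  let ?d = "\<bar>av U (\<lambda>\<sigma>. f \<sigma> * g \<sigma>) \<tau> - av U g \<tau>\<bar>"
  have pos: "0 < real (card U)" using U by (simp add: card_gt_0_iff)
  have "real (card U) * ?d = (\<Sum>u\<in>U. ?d)" by simp
  also have "\<dots> \<le> (\<Sum>u\<in>U. \<Sum>w\<in>U. m u w * \<delta> w)"
    using m osc unfolding comparison_def by (intro sum_mono) blast
  also have "\<dots> = (\<Sum>w\<in>U. (\<Sum>u\<in>U. m u w) * \<delta> w)"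
    by (subst sum.swap) (simp add: sum_distrib_right)
  finally have "?d \<le> (\<Sum>w\<in>U. (\<Sum>u\<in>U. m u w) * \<delta> w) / card U"
    using pos by (simp add: pos_le_divide_eq mult.commute)
  also have "\<dots> = (\<Sum>w\<in>U. (\<Sum>u\<in>U. m u w) / card U * \<delta> w)"
    by (subst sum_divide_distrib) simp
  finally show "?d \<le> (\<Sum>w\<in>U. (\<Sum>u\<in>U. m u w) / card U * \<delta> w)" .
qed

text \<open>Averaging the single-vertex updates over \<open>u\<close> turns them into one affine map
  of \<open>m\<close>, a lazy step with the adjacency matrix divided by \<open>a\<close>. Its
  Euclidean norm is controlled by \<open>adjacency_L2_within\<close>.\<close>

lemma comparison_step:
  assumes U: "U \<subseteq> V" "U \<noteq> {}" and \<tau>: "\<tau> \<in> colorings" and m: "comparison U \<tau> f m"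
  shows "comparison U \<tau> f (\<lambda>w. (1 - 1 / card U) * m w + (dev U \<tau> f w + (\<Sum>x\<in>N w \<inter> U. m x) / a) / card U)"
proof -
  have finU: "finite U" using U(1) finite_V finite_subset by auto
  define r where "r w = dev U \<tau> f w + (\<Sum>x\<in>N w \<inter> U. m x) / a" for w
  have pos: "0 < real (card U)" using U finU by (simp add: card_gt_0_iff)
  have "comparison U \<tau> f (\<lambda>w. (\<Sum>u\<in>U. (m(u := r u)) w) / card U)"
    unfolding r_def by (rule comparison_average[OF finU U(2) comparison_update[OF U(1) \<tau> m]])
  moreover have "(\<Sum>u\<in>U. (m(u := r u)) w) / card U = (1 - 1 / card U) * m w + r w / card U" if w: "w \<in> U" for w
  proof -
    have "(\<Sum>u\<in>U. (m(u := r u)) w) = r w + (\<Sum>u\<in>U - {w}. m w)"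
    proof -
      have "(\<Sum>u\<in>U - {w}. (m(u := r u)) w) = (\<Sum>u\<in>U - {w}. m w)" by (rule sum.cong) auto
      thus ?thesis by (subst sum.remove[OF finU w]) simp
    qed
    also have "\<dots> = r w + (real (card U) - 1) * m w"
      using card.remove[OF finU w] by simp
    finally show ?thesis using pos by (simp add: field_simps)
  qed
  ultimately show ?thesis unfolding r_def by (rule comparison_cong)
qed

text \<open>The linear part of the map in \<open>comparison_step\<close> has norm at most 1 -
  1/(2k), and its inhomogeneous term is \<open>dev\<close> over k, so the norms approach at most
  twice that of \<open>dev\<close>. Finitely many iterations from the estimate 1, of norm sqrt k,
  leave the slack \<open>e\<close>.\<close>

lemma comparison_small:
  assumes U: "U \<subseteq> V" "U \<noteq> {}" and \<tau>: "\<tau> \<in> colorings" and f: "\<And>\<eta>. \<eta> \<in> block U \<tau> \<Longrightarrow> 0 \<le> f \<eta>"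
    and f1: "av U f \<tau> = 1" and e: "0 < e"
  obtains m where "comparison U \<tau> f m" "\<And>u. u \<in> U \<Longrightarrow> 0 \<le> m u"
    "L2_set m U \<le> 2 * L2_set (dev U \<tau> f) U + e"
proof -
  have finU: "finite U" using U(1) finite_V finite_subset by auto
  define k where "k = real (card U)"
  have k: "1 \<le> k" using U finU by (simp add: k_def Suc_le_eq card_gt_0_iff)
  define \<theta> where "\<theta> = 1 - 1 / (2 * k)"
  have \<theta>: "0 \<le> \<theta>" "\<theta> < 1" using k by (auto simp: \<theta>_def field_simps)
  let ?d = "dev U \<tau> f"
  have d: "0 \<le> ?d u" for u unfolding dev_def by (rule av_nonneg) simp
  have ex: "\<exists>m. comparison U \<tau> f m \<and> (\<forall>u\<in>U. 0 \<le> m u) \<and> L2_set m U \<le> 2 * L2_set ?d U + \<theta> ^ t * sqrt k" for t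
  proof (induction t)
    case 0
    have "L2_set (\<lambda>_. 1) U = sqrt k" by (simp add: L2_set_def k_def)
    thus ?case using comparison_one[OF U(1) \<tau> f f1]
      by (intro exI[of _ "\<lambda>_. 1"]) (auto simp: L2_set_nonneg)
  next
    case (Suc t)
    then obtain m where m: "comparison U \<tau> f m" "\<And>u. u \<in> U \<Longrightarrow> 0 \<le> m u"
      and mL: "L2_set m U \<le> 2 * L2_set ?d U + \<theta> ^ t * sqrt k" by auto
    define s where "s w = (\<Sum>x\<in>N w \<inter> U. m x)" for w
    have s: "0 \<le> s w" for w unfolding s_def using m(2) by (auto intro!: sum_nonneg)
    let ?m = "\<lambda>w. (1 - 1 / k) * m w + (?d w + s w / a) / k"
    have "comparison U \<tau> f ?m" using comparison_step[OF U \<tau> m(1)] by (simp add: k_def s_def)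
    moreover have "\<forall>u\<in>U. 0 \<le> ?m u" using m(2) d s k a_gt_1 by auto
    moreover have "L2_set ?m U \<le> 2 * L2_set ?d U + \<theta> ^ Suc t * sqrt k"
    proof -
      have "L2_set s U \<le> 2 * sqrt (real D) * L2_set m U"
        unfolding s_def by (rule adjacency_L2_within[OF U(1) m(2)])
      hence "L2_set s U / a \<le> 2 * sqrt (real D) * L2_set m U / a"
        using a_gt_1 by (intro divide_right_mono) auto
      also have "\<dots> = (2 * sqrt (real D) / a) * L2_set m U" by simp
      \<comment> \<open>Here \<open>4 * sqrt D \<le> a\<close> turns the influence of the neighbours
        into a factor 1/2.\<close>
      also have "\<dots> \<le> (1 / 2) * L2_set m U"
        using a_ge a_gt_1 by (intro mult_right_mono) (auto simp: L2_set_nonneg field_simps)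
      finally have sa: "L2_set s U / a \<le> L2_set m U / 2" by simp
      have "L2_set (\<lambda>w. ?d w + s w / a) U \<le> L2_set ?d U + L2_set (\<lambda>w. s w / a) U"
        by (rule L2_set_triangle_ineq)
      also have "L2_set (\<lambda>w. s w / a) U = L2_set s U / a"
        using a_gt_1 L2_set_right_distrib[of "1 / a" s U] by simp
      finally have ds: "L2_set (\<lambda>w. ?d w + s w / a) U \<le> L2_set ?d U + L2_set m U / 2"
        using sa by linarith
      have "L2_set ?m U \<le> L2_set (\<lambda>w. (1 - 1 / k) * m w) U + L2_set (\<lambda>w. (?d w + s w / a) / k) U"
        by (rule L2_set_triangle_ineq)
      also have "L2_set (\<lambda>w. (1 - 1 / k) * m w) U = (1 - 1 / k) * L2_set m U"
        using k by (intro L2_set_right_distrib[symmetric]) simp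
      also have "L2_set (\<lambda>w. (?d w + s w / a) / k) U = (1 / k) * L2_set (\<lambda>w. ?d w + s w / a) U"
        using k by (subst L2_set_right_distrib) (auto simp: divide_simps)
      also have "(1 / k) * L2_set (\<lambda>w. ?d w + s w / a) U \<le> (1 / k) * (L2_set ?d U + L2_set m U / 2)"
        using ds k by (intro mult_left_mono) auto
      finally have "L2_set ?m U \<le> (1 - 1 / k) * L2_set m U + (1 / k) * (L2_set ?d U + L2_set m U / 2)"
        by simp
      also have "\<dots> = \<theta> * L2_set m U + L2_set ?d U / k" by (simp add: \<theta>_def algebra_simps)
      also have "\<dots> \<le> \<theta> * (2 * L2_set ?d U + \<theta> ^ t * sqrt k) + L2_set ?d U / k"
        using mL \<theta> by (intro add_right_mono mult_left_mono) auto
      also have "\<dots> = 2 * L2_set ?d U + \<theta> ^ Suc t * sqrt k"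
        using k by (simp add: \<theta>_def algebra_simps)
      finally show ?thesis .
    qed
    ultimately show ?case by blast
  qed
  have "(\<lambda>t. \<theta> ^ t * sqrt k) \<longlonglongrightarrow> 0 * sqrt k"
    using \<theta> by (intro tendsto_mult LIMSEQ_power_zero tendsto_const) auto
  hence "\<forall>\<^sub>F t in sequentially. \<theta> ^ t * sqrt k < e" using e by (intro order_tendstoD(2)) auto
  then obtain t where "\<theta> ^ t * sqrt k < e" by (auto simp: eventually_sequentially)
  thus thesis using ex[of t] that by (auto intro: order_trans)
qed

end

section \<open>Approximate tensorization of entropy\<close>

text \<open>Squared Hellinger distance is at most relative entropy, pointwise: ln(a/b) is twice the
  logarithm of the ratio s/r of square roots, and ln x \<le> x - 1 at x = r/s produces the cross
  term 2sr.\<close>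

lemma sqrt_diff_sq_le:
  fixes a b :: real
  assumes "0 \<le> a" "0 \<le> b" "0 < a \<Longrightarrow> 0 < b"
  shows "(sqrt a - sqrt b)\<^sup>2 \<le> a * ln a - a * ln b - a + b"
proof (cases "a = 0")
  case True
  thus ?thesis using assms by simp
next
  case False
  hence p: "0 < a" "0 < b" using assms by auto
  define s r where "s = sqrt a" and "r = sqrt b"
  have sr: "a = s * s" "b = r * r" "0 < s" "0 < r" using p by (auto simp: s_def r_def)
  have "s - r \<le> s * ln s - s * ln r"
    using mult_ln_diff_ge[of s r 1] sr by simp
  hence "2 * s * (s - r) \<le> 2 * s * (s * ln s - s * ln r)"
    using sr by (intro mult_left_mono) auto
  moreover have "ln a = 2 * ln s" "ln b = 2 * ln r" using sr by (simp_all add: ln_mult)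
  ultimately show ?thesis
    unfolding s_def[symmetric] r_def[symmetric] by (simp add: sr(1,2) power2_eq_square algebra_simps)
qed

text \<open>Bounds the ratio of \<open>1 / (card (L v) - card (N v))\<close>, a bound on the chance
  of any color when \<open>v\<close> is resampled, to \<open>(1 - 1 / a) ^ D / card (L v)\<close>, a
  lower bound on the marginal probability of a color that occurs. The list sizes cancel up to
  \<open>1 + D / a\<close>.\<close>

definition marginal_const :: "real \<Rightarrow> nat \<Rightarrow> real" where
  "marginal_const a D = (1 + D / a) / (1 - 1 / a) ^ D"

text \<open>The summand 2 comes from \<open>ent_marginal_le\<close>. The factor
  \<open>64 * D\<close> is \<open>4 * D\<close> from the adjacency norm, times 4 from doubling
  \<open>dev\<close> in \<open>comparison_small\<close>, times 4 from
  \<open>dev_sq_le\<close>.\<close>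

definition tensor_const :: "real \<Rightarrow> nat \<Rightarrow> real" where
  "tensor_const a D = 2 + 64 * D * (marginal_const a D)\<^sup>2"

text \<open>Stated for arbitrary \<open>a\<close> and \<open>D\<close>, since the constants of the
  theorem have to be positive at all arguments.\<close>

lemma tensor_const_pos: "0 < tensor_const a D"
  unfolding tensor_const_def by (intro add_pos_nonneg) auto

context coloring_instance
begin

section \<open>Relative entropy under conditional averaging\<close>

lemma av_inv:
  assumes W: "W \<subseteq> U" and \<phi>: "\<And>\<sigma> \<eta>. \<eta> \<in> block W \<sigma> \<Longrightarrow> \<phi> \<eta> = \<phi> \<sigma>"
  shows "av U (\<lambda>\<sigma>. \<phi> \<sigma> * f \<sigma>) \<tau> = av U (\<lambda>\<sigma>. \<phi> \<sigma> * av W f \<sigma>) \<tau>"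
proof -
  have "av U (\<lambda>\<sigma>. \<phi> \<sigma> * f \<sigma>) \<tau> = av U (av W (\<lambda>\<sigma>. \<phi> \<sigma> * f \<sigma>)) \<tau>" by (rule av_tower[OF W, symmetric])
  also have "\<dots> = av U (\<lambda>\<sigma>. \<phi> \<sigma> * av W f \<sigma>) \<tau>"
    using av_mult_inv[of W _ \<phi> _ f] \<phi> by (intro av_cong) blast
  finally show ?thesis .
qed

lemma av_pos_ex:
  assumes "0 < av U f \<sigma>"
  obtains \<eta> where "\<eta> \<in> block U \<sigma>" "0 < f \<eta>"
proof -
  have "\<exists>\<eta>\<in>block U \<sigma>. 0 < f \<eta>"
  proof (rule ccontr)
    assume "\<not> ?thesis"
    hence "sum f (block U \<sigma>) \<le> 0" by (intro sum_nonpos) auto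
    hence "av U f \<sigma> \<le> 0" unfolding av_def by (intro divide_nonpos_nonneg) auto
    thus False using assms by simp
  qed
  thus thesis using that by blast
qed

lemma av_ent_single:
  assumes W: "W \<subseteq> U"
  shows "av U (ent W f) \<tau> = av U (\<lambda>\<sigma>. f \<sigma> * ln (f \<sigma>) - f \<sigma> * ln (av W f \<sigma>)) \<tau>"
proof -
  have "av U (\<lambda>\<sigma>. ln (av W f \<sigma>) * f \<sigma>) \<tau> = av U (\<lambda>\<sigma>. ln (av W f \<sigma>) * av W f \<sigma>) \<tau>"
    by (rule av_inv[OF W]) (simp add: av_eq)
  thus ?thesis unfolding ent_def by (simp add: av_diff av_tower[OF W] mult.commute)
qed

text \<open>Data processing: averaging over \<open>W\<close> does not increase the relative entropy
  of \<open>f\<close> with respect to \<open>av P f\<close>, which is the mean of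
  \<open>ent P f\<close>. Gibbs' inequality is used with the weight \<open>g / g'\<close>; this
  depends on the \<open>W\<close>-block only, so the linear terms cancel in the mean.\<close>

lemma relative_entropy_av_le:
  assumes W: "W \<subseteq> U" and P: "P \<subseteq> U" and \<tau>: "\<tau> \<in> colorings" and f: "\<And>\<eta>. \<eta> \<in> block U \<tau> \<Longrightarrow> 0 \<le> f \<eta>"
  defines "g \<equiv> av W f" and "g' \<equiv> av W (av P f)"
  shows "av U (\<lambda>\<sigma>. g \<sigma> * ln (g \<sigma>) - g \<sigma> * ln (g' \<sigma>)) \<tau> \<le> av U (ent P f) \<tau>"
    and "\<And>\<sigma>. \<sigma> \<in> block U \<tau> \<Longrightarrow> 0 < g \<sigma> \<Longrightarrow> 0 < g' \<sigma>"
    and "\<And>\<sigma>. \<sigma> \<in> block U \<tau> \<Longrightarrow> 0 \<le> g \<sigma>"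
    and "\<And>\<sigma>. \<sigma> \<in> block U \<tau> \<Longrightarrow> 0 \<le> g' \<sigma>"
proof -
  define h where "h = av P f"
  have col: "\<sigma> \<in> colorings" if "\<sigma> \<in> block U \<tau>" for \<sigma> using that block_subset by auto
  have inW: "\<eta> \<in> block U \<tau>" if "\<sigma> \<in> block U \<tau>" "\<eta> \<in> block W \<sigma>" for \<sigma> \<eta>
    using block_mono[OF W that(1)] that(2) by auto
  have inP: "\<eta> \<in> block U \<tau>" if "\<sigma> \<in> block U \<tau>" "\<eta> \<in> block P \<sigma>" for \<sigma> \<eta>
    using block_mono[OF P that(1)] that(2) by auto
  have h: "0 \<le> h \<sigma>" if "\<sigma> \<in> block U \<tau>" for \<sigma>
    unfolding h_def using f inP[OF that] by (intro av_nonneg) auto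
  show g: "0 \<le> g \<sigma>" if "\<sigma> \<in> block U \<tau>" for \<sigma>
    unfolding g_def using f inW[OF that] by (intro av_nonneg) auto
  show g': "0 \<le> g' \<sigma>" if "\<sigma> \<in> block U \<tau>" for \<sigma>
    unfolding g'_def h_def[symmetric] using h inW[OF that] by (intro av_nonneg) auto
  have fh: "0 < h \<sigma>" if "\<sigma> \<in> block U \<tau>" "0 < f \<sigma>" for \<sigma>
    unfolding h_def using that f inP[OF that(1)] self_in_block[OF col]
    by (intro av_pos[where \<eta> = \<sigma>]) (auto intro: col)
  have fg: "0 < g \<sigma>" if "\<sigma> \<in> block U \<tau>" "0 < f \<sigma>" for \<sigma>
    unfolding g_def using that f inW[OF that(1)] self_in_block[OF col]
    by (intro av_pos[where \<eta> = \<sigma>]) (auto intro: col)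
  have hg: "0 < g' \<sigma>" if "\<sigma> \<in> block U \<tau>" "0 < h \<sigma>" for \<sigma>
    unfolding g'_def h_def[symmetric] using that h inW[OF that(1)] self_in_block[OF col]
    by (intro av_pos[where \<eta> = \<sigma>]) (auto intro: col)
  show gg: "0 < g' \<sigma>" if \<sigma>: "\<sigma> \<in> block U \<tau>" and pos: "0 < g \<sigma>" for \<sigma>
  proof -
    obtain \<eta> where \<eta>: "\<eta> \<in> block W \<sigma>" "0 < f \<eta>" using pos unfolding g_def by (rule av_pos_ex)
    have "0 < g' \<eta>" using inW[OF \<sigma> \<eta>(1)] \<eta>(2) by (intro hg fh)
    thus ?thesis unfolding g'_def using av_eq[OF \<eta>(1)] by simp
  qed
  have "av U (\<lambda>\<sigma>. f \<sigma> - (g \<sigma> / g' \<sigma>) * h \<sigma>) \<tau> \<le>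
    av U (\<lambda>\<sigma>. (f \<sigma> * ln (f \<sigma>) - f \<sigma> * ln (h \<sigma>)) - (ln (g \<sigma>) - ln (g' \<sigma>)) * f \<sigma>) \<tau>"
  proof (rule av_mono)
    fix \<sigma> assume \<sigma>: "\<sigma> \<in> block U \<tau>"
    have pos: "0 < f \<sigma> \<Longrightarrow> 0 < h \<sigma> \<and> 0 < g \<sigma> / g' \<sigma>" using fh[OF \<sigma>] fg[OF \<sigma>] gg[OF \<sigma>] by auto
    have "f \<sigma> * ln (g \<sigma> / g' \<sigma>) = (ln (g \<sigma>) - ln (g' \<sigma>)) * f \<sigma>"
      using f[OF \<sigma>] fg[OF \<sigma>] gg[OF \<sigma>] by (cases "f \<sigma> = 0") (auto simp: ln_div less_le)
    moreover have "f \<sigma> - h \<sigma> * (g \<sigma> / g' \<sigma>) \<le> f \<sigma> * ln (f \<sigma>) - f \<sigma> * ln (h \<sigma>) - f \<sigma> * ln (g \<sigma> / g' \<sigma>)"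
      using g[OF \<sigma>] g'[OF \<sigma>] by (intro mult_ln_diff_ge f[OF \<sigma>] h[OF \<sigma>] pos) auto
    ultimately show "f \<sigma> - (g \<sigma> / g' \<sigma>) * h \<sigma> \<le> (f \<sigma> * ln (f \<sigma>) - f \<sigma> * ln (h \<sigma>)) - (ln (g \<sigma>) - ln (g' \<sigma>)) * f \<sigma>"
      by (subst mult.commute[of "g \<sigma> / g' \<sigma>"]) linarith
  qed
  also have "\<dots> = av U (ent P f) \<tau> - av U (\<lambda>\<sigma>. (ln (g \<sigma>) - ln (g' \<sigma>)) * g \<sigma>) \<tau>"
  proof -
    have "av U (\<lambda>\<sigma>. (ln (g \<sigma>) - ln (g' \<sigma>)) * f \<sigma>) \<tau> = av U (\<lambda>\<sigma>. (ln (g \<sigma>) - ln (g' \<sigma>)) * av W f \<sigma>) \<tau>"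
      unfolding g_def g'_def by (rule av_inv[OF W]) (simp add: av_eq)
    thus ?thesis unfolding av_ent_single[OF P] h_def g_def[symmetric] by (simp only: av_diff)
  qed
  also have "av U (\<lambda>\<sigma>. f \<sigma> - (g \<sigma> / g' \<sigma>) * h \<sigma>) \<tau> = 0"
  proof -
    have "av U (\<lambda>\<sigma>. (g \<sigma> / g' \<sigma>) * h \<sigma>) \<tau> = av U (\<lambda>\<sigma>. (g \<sigma> / g' \<sigma>) * av W h \<sigma>) \<tau>"
      unfolding g_def g'_def by (rule av_inv[OF W]) (simp add: av_eq)
    also have "\<dots> = av U g \<tau>"
    proof (rule av_cong)
      fix \<sigma> assume \<sigma>: "\<sigma> \<in> block U \<tau>"
      have "av W h \<sigma> = g' \<sigma>" by (simp add: g'_def h_def)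
      thus "(g \<sigma> / g' \<sigma>) * av W h \<sigma> = g \<sigma>" using gg[OF \<sigma>] g[OF \<sigma>] by (cases "g \<sigma> = 0") auto
    qed
    also have "\<dots> = av U f \<tau>" unfolding g_def by (rule av_tower[OF W])
    finally show ?thesis by (simp add: av_diff)
  qed
  finally have "av U (\<lambda>\<sigma>. (ln (g \<sigma>) - ln (g' \<sigma>)) * g \<sigma>) \<tau> \<le> av U (ent P f) \<tau>" by simp
  thus "av U (\<lambda>\<sigma>. g \<sigma> * ln (g \<sigma>) - g \<sigma> * ln (g' \<sigma>)) \<tau> \<le> av U (ent P f) \<tau>"
    by (simp add: algebra_simps)
qed

text \<open>With \<open>g\<close> the marginal density and \<open>g'\<close> the one after resampling, Gibbs' inequality turns the
  cross term \<open>E g ln g'\<close> into another relative entropy and the variance of \<open>g'\<close>. The latter is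
  harmless because, unlike \<open>g\<close>, the density \<open>g'\<close> is bounded independently of the list sizes.\<close>

lemma ent_marginal_le:
  assumes W: "W \<subseteq> U" and P: "P \<subseteq> U" and \<tau>: "\<tau> \<in> colorings" and f: "\<And>\<eta>. \<eta> \<in> block U \<tau> \<Longrightarrow> 0 \<le> f \<eta>"
    and f1: "av U f \<tau> = 1"
  shows "ent U (av W f) \<tau> \<le> 2 * av U (ent P f) \<tau> + av U (\<lambda>\<sigma>. (av W (av P f) \<sigma> - 1)\<^sup>2) \<tau>"
proof -
  define g where "g = av W f"
  define g' where "g' = av W (av P f)"
  have R1: "av U (\<lambda>\<sigma>. g \<sigma> * ln (g \<sigma>) - g \<sigma> * ln (g' \<sigma>)) \<tau> \<le> av U (ent P f) \<tau>"
    unfolding g_def g'_def by (rule relative_entropy_av_le(1)[OF W P \<tau> f])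
  have R2: "0 < g \<sigma> \<Longrightarrow> 0 < g' \<sigma>" and R3: "0 \<le> g \<sigma>" and R4: "0 \<le> g' \<sigma>" if "\<sigma> \<in> block U \<tau>" for \<sigma>
    unfolding g_def g'_def using relative_entropy_av_le(2-4)[OF W P \<tau>, of f \<sigma>] f that by auto
  have Eg: "av U g \<tau> = 1" unfolding g_def using f1 by (simp add: av_tower[OF W])
  have Eg': "av U g' \<tau> = 1" unfolding g'_def using f1 by (simp add: av_tower[OF W] av_tower[OF P])
  \<comment> \<open>Gibbs' inequality with \<open>b = s = g'\<close>. Since \<open>g'\<close> has
    mean 1, the mean of \<open>g' * g'\<close> minus 1 is its variance.\<close>
  have "av U (\<lambda>\<sigma>. g \<sigma> - g' \<sigma> * g' \<sigma>) \<tau> \<le> av U (\<lambda>\<sigma>. 2 * (g \<sigma> * ln (g \<sigma>) - g \<sigma> * ln (g' \<sigma>)) - g \<sigma> * ln (g \<sigma>)) \<tau>"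
  proof (rule av_mono)
    fix \<sigma> assume \<sigma>: "\<sigma> \<in> block U \<tau>"
    show "g \<sigma> - g' \<sigma> * g' \<sigma> \<le> 2 * (g \<sigma> * ln (g \<sigma>) - g \<sigma> * ln (g' \<sigma>)) - g \<sigma> * ln (g \<sigma>)"
      using mult_ln_diff_ge[of "g \<sigma>" "g' \<sigma>" "g' \<sigma>"] R2[OF \<sigma>] R3[OF \<sigma>] R4[OF \<sigma>] by auto
  qed
  also have "\<dots> = 2 * av U (\<lambda>\<sigma>. g \<sigma> * ln (g \<sigma>) - g \<sigma> * ln (g' \<sigma>)) \<tau> - av U (\<lambda>\<sigma>. g \<sigma> * ln (g \<sigma>)) \<tau>"
    by (simp only: av_diff av_cmult)
  finally have 1: "av U (\<lambda>\<sigma>. g \<sigma> * ln (g \<sigma>)) \<tau> \<le> 2 * av U (ent P f) \<tau> + (av U (\<lambda>\<sigma>. g' \<sigma> * g' \<sigma>) \<tau> - 1)"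
    using R1 by (simp add: av_diff Eg)
  have "av U (\<lambda>\<sigma>. (g' \<sigma> - 1)\<^sup>2) \<tau> = av U (\<lambda>\<sigma>. (g' \<sigma> * g' \<sigma> - 2 * g' \<sigma>) + 1) \<tau>"
    by (rule av_cong) (simp add: power2_eq_square algebra_simps)
  also have "\<dots> = av U (\<lambda>\<sigma>. g' \<sigma> * g' \<sigma>) \<tau> - 1"
    by (simp add: av_add av_diff av_cmult av_const[OF \<tau>] Eg')
  finally show ?thesis using 1 unfolding ent_def g_def[symmetric] g'_def[symmetric] by (simp add: Eg)
qed

text \<open>Avoidance is imposed one vertex at a time: resampling \<open>u\<close> leaves the colors
  on \<open>S\<close> alone, and among at least \<open>a\<close> available colors \<open>x\<close>
  has chance at most 1/\<open>a\<close>.\<close>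

lemma av_avoid_ge:
  assumes U: "U \<subseteq> V" and \<tau>: "\<tau> \<in> colorings" and S: "finite S"
  shows "S \<subseteq> U \<Longrightarrow> (1 - 1 / a) ^ card S \<le> av U (\<lambda>\<eta>. if \<forall>u\<in>S. \<eta> u \<noteq> x then 1 else 0) \<tau>"
  using S
proof (induction S rule: finite_induct)
  case empty
  thus ?case by (simp add: av_const[OF \<tau>])
next
  case (insert u S)
  let ?I = "\<lambda>S (\<eta>::'v \<Rightarrow> 'c). if \<forall>u\<in>S. \<eta> u \<noteq> x then 1 else (0::real)"
  have uV: "u \<in> V" and uU: "{u} \<subseteq> U" using insert U by auto
  have a01: "0 \<le> 1 - 1 / a" using a_gt_1 by simp
  have ge: "1 - 1 / a \<le> av {u} (?I {u}) \<sigma>" if "\<sigma> \<in> block U \<tau>" for \<sigma>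
  proof -
    let ?A = "avail \<sigma> u"
    have \<sigma>: "\<sigma> \<in> colorings" using that block_subset by auto
    have pos: "0 < real (card ?A)" using card_avail_pos[OF uV, of \<sigma>] by simp
    have "real (card ?A) - 1 \<le> real (card (?A - {x}))"
      using pos by (simp add: card_Diff_singleton_if of_nat_diff Suc_le_eq)
    also have "\<dots> = (\<Sum>c\<in>?A - {x}. if c \<noteq> x then 1 else 0)" by simp
    also have "\<dots> \<le> (\<Sum>c\<in>?A. if c \<noteq> x then 1 else 0)"
      using finite_avail[OF uV, of \<sigma>] by (intro sum_mono2) auto
    finally have "(real (card ?A) - 1) / card ?A \<le> av {u} (?I {u}) \<sigma>"
      unfolding av_single[OF \<sigma> uV] resample_def by (intro divide_right_mono) auto
    moreover have "1 - 1 / a \<le> (real (card ?A) - 1) / card ?A"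
      using card_avail_ge[OF uV, of \<sigma>] a_gt_1 pos by (simp add: field_simps)
    ultimately show ?thesis by linarith
  qed
  have "(1 - 1 / a) ^ card (insert u S) = (1 - 1 / a) * (1 - 1 / a) ^ card S" using insert by simp
  also have "\<dots> \<le> (1 - 1 / a) * av U (?I S) \<tau>" using insert a01 by (intro mult_left_mono) auto
  also have "\<dots> = av U (\<lambda>\<sigma>. (1 - 1 / a) * ?I S \<sigma>) \<tau>" by (rule av_cmult[symmetric])
  also have "\<dots> \<le> av U (\<lambda>\<sigma>. ?I S \<sigma> * av {u} (?I {u}) \<sigma>) \<tau>"
    using ge by (intro av_mono) (simp add: av_nonneg)
  also have "\<dots> = av U (\<lambda>\<sigma>. ?I S \<sigma> * ?I {u} \<sigma>) \<tau>"
  proof (rule av_inv[OF uU, symmetric])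
    fix \<sigma> \<eta> assume "\<eta> \<in> block {u} \<sigma>"
    hence "\<eta> w = \<sigma> w" if "w \<in> S" for w using that insert(2) by (auto simp: block_def)
    thus "?I S \<eta> = ?I S \<sigma>" by (auto cong: ball_cong)
  qed
  also have "\<dots> = av U (?I (insert u S)) \<tau>" by (rule av_cong) auto
  finally show ?case .
qed

lemma marginal_const_nonneg: "0 \<le> marginal_const a D"
  unfolding marginal_const_def using a_gt_1 by (intro divide_nonneg_nonneg) auto

text \<open>The average on the left is the density of the color \<open>\<sigma> v\<close> after
  resampling and equals E(fk)/E(k), where \<open>k\<close> is the chance that resampling
  \<open>v\<close> produces this color. The indicator \<iota> can oscillate by 1 at
  \<open>v\<close>, whereas \<open>k\<close> varies by at most 1/s and only with the neighbours;
  this is comparable with the mean of \<open>k\<close>.\<close>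

lemma resampled_marginal_le:
  assumes U: "U \<subseteq> V" and v: "v \<in> U" and \<sigma>: "\<sigma> \<in> block U \<tau>" and \<tau>: "\<tau> \<in> colorings"
    and m: "comparison U \<tau> f m" and m0: "\<And>u. u \<in> U \<Longrightarrow> 0 \<le> m u"
  shows "\<bar>av (U - {v}) (av {v} f) \<sigma> - 1\<bar> \<le> marginal_const a D * (\<Sum>u\<in>N v \<inter> U. m u)"
proof -
  define \<iota> :: "('v \<Rightarrow> 'c) \<Rightarrow> real" where "\<iota> \<eta> = (if \<eta> v = \<sigma> v then 1 else 0)" for \<eta>
  define k where "k = resample v \<iota>"
  define s where "s = real (card (L v)) - real (card (N v))"
  let ?E = "\<lambda>h. av U h \<tau>"
  have vV: "v \<in> V" and vU: "{v} \<subseteq> U" using v U by auto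
  have finU: "finite U" using U finite_V finite_subset by auto
  have \<sigma>c: "\<sigma> \<in> colorings" using \<sigma> block_subset by auto
  have s: "a \<le> s" "0 < s" unfolding s_def using card_L[OF vV] a_gt_1 by linarith+
  have L: "0 < real (card (L v))" using s by (simp add: s_def)
  have k_eq: "k \<eta> = (if \<sigma> v \<in> avail \<eta> v then 1 / card (avail \<eta> v) else 0)" for \<eta>
    unfolding k_def resample_def \<iota>_def using finite_avail[OF vV, of \<eta>]
    by (simp add: sum.delta)
  have avk: "av {v} \<iota> \<eta> = k \<eta>" if "\<eta> \<in> block U \<tau>" for \<eta>
    unfolding k_def using that block_subset by (intro av_single vV) auto
  have Ek: "?E \<iota> = ?E k"
    using av_tower[OF vU, of \<iota> \<tau>] av_cong[of U \<tau> "av {v} \<iota>" k] avk by simp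
  have Efk: "?E (\<lambda>\<eta>. \<iota> \<eta> * av {v} f \<eta>) = ?E (\<lambda>\<eta>. f \<eta> * k \<eta>)"
    using av_adj[OF vU, of \<iota> f \<tau>] av_cong[of U \<tau> "\<lambda>\<eta>. av {v} \<iota> \<eta> * f \<eta>" "\<lambda>\<eta>. f \<eta> * k \<eta>"] avk
    by (simp add: mult.commute)
  have "(1 - 1 / a) ^ D / card (L v) \<le> (1 - 1 / a) ^ card (N v \<inter> U) / card (L v)"
  proof (intro divide_right_mono power_decreasing)
    show "card (N v \<inter> U) \<le> D"
      using card_mono[OF finite_N[of v], of "N v \<inter> U"] degree_le[OF vV] by simp
  qed (use a_gt_1 in auto)
  also have "\<dots> \<le> ?E (\<lambda>\<eta>. if \<forall>u\<in>N v \<inter> U. \<eta> u \<noteq> \<sigma> v then 1 else 0) / card (L v)"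
    using av_avoid_ge[OF U \<tau>, of "N v \<inter> U" "\<sigma> v"] finU by (intro divide_right_mono) auto
  also have "\<dots> = ?E (\<lambda>\<eta>. (1 / card (L v)) * (if \<forall>u\<in>N v \<inter> U. \<eta> u \<noteq> \<sigma> v then 1 else 0))"
    by (simp only: av_cmult) simp
  also have "\<dots> \<le> ?E k"
  proof (rule av_mono)
    fix \<eta> assume \<eta>: "\<eta> \<in> block U \<tau>"
    have card: "1 / real (card (L v)) \<le> 1 / card (avail \<eta> v)"
      using card_mono[OF finite_L[OF vV] avail_subset, of \<eta>] card_avail_pos[OF vV, of \<eta>] by (intro frac_le) auto
    have "\<sigma> v \<in> avail \<eta> v" if avoid: "\<forall>u\<in>N v \<inter> U. \<eta> u \<noteq> \<sigma> v"
      unfolding avail_def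
    proof (intro CollectI conjI ballI)
      show "\<sigma> v \<in> L v" using \<sigma>c colorings_subset configs_in vV by auto
      fix u assume u: "u \<in> N v"
      show "\<sigma> v \<noteq> \<eta> u"
      proof (cases "u \<in> U")
        case True
        thus ?thesis using avoid u by auto
      next
        case False
        \<comment> \<open>Pinned neighbours carry their color from \<sigma>, and properness of
          \<sigma> keeps it different from the color of \<open>v\<close>.\<close>
        hence "\<eta> u = \<sigma> u" using \<eta> \<sigma> by (simp add: block_def)
        thus ?thesis using \<sigma>c vV u by (auto simp: colorings_def)
      qed
    qed
    thus "(1 / card (L v)) * (if \<forall>u\<in>N v \<inter> U. \<eta> u \<noteq> \<sigma> v then 1 else 0) \<le> k \<eta>"
      using card by (auto simp: k_eq)
  qed
  finally have kE: "(1 - 1 / a) ^ D / card (L v) \<le> ?E k" .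
  have q: "0 < (1 - 1 / a) ^ D" using a_gt_1 by (intro zero_less_power) simp
  hence kpos: "0 < ?E k" using kE L divide_pos_pos[OF q L] by linarith
  have osc: "osc_le k (\<lambda>u. if u \<in> N v then 1 / s else 0)"
    unfolding osc_le_def
  proof (intro ballI)
    fix \<eta> u c
    have k01: "0 \<le> k \<eta>" "k \<eta> \<le> 1 / s" for \<eta>
    proof -
      have "s \<le> card (avail \<eta> v)" using card_avail_ge_diff[OF vV, of \<eta>] by (simp add: s_def)
      hence "1 / card (avail \<eta> v) \<le> 1 / s" using s by (intro divide_left_mono) auto
      thus "k \<eta> \<le> 1 / s" using s by (simp add: k_eq)
      show "0 \<le> k \<eta>" by (simp add: k_eq)
    qed
    show "\<bar>k (\<eta>(u := c)) - k \<eta>\<bar> \<le> (if u \<in> N v then 1 / s else 0)"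
      using k01[of \<eta>] k01[of "\<eta>(u := c)"] by (cases "u \<in> N v") (auto simp: k_eq avail_upd)
  qed
  have blk: "block (U - {v}) \<sigma> = {\<eta> \<in> block U \<tau>. \<eta> v = \<sigma> v}" by (rule block_remove[OF \<sigma> v])
  have ind: "(\<Sum>\<eta>\<in>block (U - {v}) \<sigma>. h \<eta>) = (\<Sum>\<eta>\<in>block U \<tau>. \<iota> \<eta> * h \<eta>)" for h :: "_ \<Rightarrow> real"
    unfolding blk \<iota>_def by (simp add: sum.inter_filter[OF finite_block] if_distrib[of "\<lambda>x. x * _"] cong: if_cong)
  have "real (card (block (U - {v}) \<sigma>)) = (\<Sum>\<eta>\<in>block U \<tau>. \<iota> \<eta>)" using ind[of "\<lambda>_. 1"] by simp
  \<comment> \<open>Fixing the color of \<open>v\<close> means weighting by \<iota>, so the smaller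
    average is a quotient of two averages over \<open>block U \<tau>\<close>.\<close>
  hence "av (U - {v}) (av {v} f) \<sigma> = ?E (\<lambda>\<eta>. \<iota> \<eta> * av {v} f \<eta>) / ?E \<iota>"
    unfolding av_def[of "U - {v}"] av_def[of U] ind using card_block_pos[OF \<tau>, of U] by simp
  hence "av (U - {v}) (av {v} f) \<sigma> - 1 = (?E (\<lambda>\<eta>. f \<eta> * k \<eta>) - ?E k) / ?E k"
    unfolding Efk Ek using kpos by (simp add: diff_divide_distrib)
  hence "\<bar>av (U - {v}) (av {v} f) \<sigma> - 1\<bar> = \<bar>?E (\<lambda>\<eta>. f \<eta> * k \<eta>) - ?E k\<bar> / ?E k"
    using kpos by (simp add: abs_divide)
  also have "\<dots> \<le> (\<Sum>u\<in>U. m u * (if u \<in> N v then 1 / s else 0)) / ?E k"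
    using m osc kpos unfolding comparison_def by (intro divide_right_mono) auto
  also have "(\<Sum>u\<in>U. m u * (if u \<in> N v then 1 / s else 0)) = (\<Sum>u\<in>N v \<inter> U. m u) / s"
  proof -
    have "(\<Sum>u\<in>U. m u * (if u \<in> N v then 1 / s else 0)) = (\<Sum>u\<in>U. if u \<in> N v then m u / s else 0)"
      by (rule sum.cong) auto
    also have "\<dots> = (\<Sum>u\<in>U \<inter> N v. m u / s)" by (rule sum.inter_restrict[OF finU, symmetric])
    finally show ?thesis by (simp add: sum_divide_distrib Int_commute)
  qed
  also have "(\<Sum>u\<in>N v \<inter> U. m u) / s / ?E k \<le> (\<Sum>u\<in>N v \<inter> U. m u) / s / ((1 - 1 / a) ^ D / card (L v))"
    using kE kpos s L q m0 by (intro divide_left_mono) (auto intro!: sum_nonneg divide_nonneg_nonneg mult_pos_pos)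
  also have "\<dots> = (card (L v) / s) / (1 - 1 / a) ^ D * (\<Sum>u\<in>N v \<inter> U. m u)" by simp
  also have "\<dots> \<le> marginal_const a D * (\<Sum>u\<in>N v \<inter> U. m u)"
    unfolding marginal_const_def
  proof (intro mult_right_mono divide_right_mono)
    have "real (card (L v)) / s = 1 + real (card (N v)) / s" using s by (simp add: s_def field_simps)
    also have "real (card (N v)) / s \<le> D / a"
      using degree_le[OF vV] s a_gt_1 by (intro frac_le) auto
    finally show "real (card (L v)) / s \<le> 1 + D / a" by simp
  qed (use q m0 in \<open>auto intro!: sum_nonneg\<close>)
  finally show ?thesis .
qed

section \<open>From marginal entropies to the full entropy\<close>

lemma av_Cauchy_Schwarz: "(av U (\<lambda>\<sigma>. f \<sigma> * g \<sigma>) \<tau>)\<^sup>2 \<le> av U (\<lambda>\<sigma>. (f \<sigma>)\<^sup>2) \<tau> * av U (\<lambda>\<sigma>. (g \<sigma>)\<^sup>2) \<tau>"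
  unfolding av_def power_divide
  using divide_right_mono[OF Cauchy_Schwarz_ineq_sum[of f g "block U \<tau>"], of "(real (card (block U \<tau>)))\<^sup>2"]
  by (simp add: power2_eq_square)

text \<open>A Pinsker-type bound with 4 in place of 2. Factoring f - h through square roots and
  applying Cauchy-Schwarz leaves the Hellinger term, bounded by the entropy, and a second factor of
  mean at most 2E(f) + 2E(h) = 4.\<close>

lemma dev_sq_le:
  assumes W: "{u} \<subseteq> U" and \<tau>: "\<tau> \<in> colorings" and f: "\<And>\<eta>. \<eta> \<in> block U \<tau> \<Longrightarrow> 0 \<le> f \<eta>" and f1: "av U f \<tau> = 1"
  shows "(dev U \<tau> f u)\<^sup>2 \<le> 4 * av U (ent {u} f) \<tau>"
proof -
  define h where "h = av {u} f"
  let ?E = "\<lambda>h. av U h \<tau>"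
  have col: "\<sigma> \<in> colorings" if "\<sigma> \<in> block U \<tau>" for \<sigma> using that block_subset by auto
  have inW: "\<eta> \<in> block U \<tau>" if "\<sigma> \<in> block U \<tau>" "\<eta> \<in> block {u} \<sigma>" for \<sigma> \<eta>
    using block_mono[OF W that(1)] that(2) by auto
  have h: "0 \<le> h \<sigma>" if "\<sigma> \<in> block U \<tau>" for \<sigma>
    unfolding h_def using f inW[OF that] by (intro av_nonneg) auto
  have fh: "0 < h \<sigma>" if "\<sigma> \<in> block U \<tau>" "0 < f \<sigma>" for \<sigma>
    unfolding h_def using that f inW[OF that(1)] self_in_block[OF col]
    by (intro av_pos[where \<eta> = \<sigma>]) (auto intro: col)
  have Eh: "?E h = 1" unfolding h_def using f1 by (simp add: av_tower[OF W])
  have "dev U \<tau> f u = ?E (\<lambda>\<sigma>. \<bar>sqrt (f \<sigma>) - sqrt (h \<sigma>)\<bar> * (sqrt (f \<sigma>) + sqrt (h \<sigma>)))"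
    unfolding dev_def h_def[symmetric]
  proof (rule av_cong)
    fix \<sigma> assume \<sigma>: "\<sigma> \<in> block U \<tau>"
    have "f \<sigma> - h \<sigma> = (sqrt (f \<sigma>) - sqrt (h \<sigma>)) * (sqrt (f \<sigma>) + sqrt (h \<sigma>))"
      using f[OF \<sigma>] h[OF \<sigma>] by (simp add: algebra_simps)
    thus "\<bar>f \<sigma> - h \<sigma>\<bar> = \<bar>sqrt (f \<sigma>) - sqrt (h \<sigma>)\<bar> * (sqrt (f \<sigma>) + sqrt (h \<sigma>))"
      using f[OF \<sigma>] h[OF \<sigma>] by (simp add: abs_mult)
  qed
  hence "(dev U \<tau> f u)\<^sup>2 \<le> ?E (\<lambda>\<sigma>. \<bar>sqrt (f \<sigma>) - sqrt (h \<sigma>)\<bar>\<^sup>2) * ?E (\<lambda>\<sigma>. (sqrt (f \<sigma>) + sqrt (h \<sigma>))\<^sup>2)"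
    by (simp only: av_Cauchy_Schwarz)
  also have "\<dots> \<le> av U (ent {u} f) \<tau> * 4"
  proof (rule mult_mono)
    have "?E (\<lambda>\<sigma>. \<bar>sqrt (f \<sigma>) - sqrt (h \<sigma>)\<bar>\<^sup>2) \<le> ?E (\<lambda>\<sigma>. (f \<sigma> * ln (f \<sigma>) - f \<sigma> * ln (h \<sigma>)) - f \<sigma> + h \<sigma>)"
      using sqrt_diff_sq_le f h fh by (intro av_mono) auto
    also have "\<dots> = av U (ent {u} f) \<tau>"
      unfolding av_ent_single[OF W] h_def[symmetric] by (simp only: av_add av_diff Eh f1)
    finally show "?E (\<lambda>\<sigma>. \<bar>sqrt (f \<sigma>) - sqrt (h \<sigma>)\<bar>\<^sup>2) \<le> av U (ent {u} f) \<tau>" .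
    have "?E (\<lambda>\<sigma>. (sqrt (f \<sigma>) + sqrt (h \<sigma>))\<^sup>2) \<le> ?E (\<lambda>\<sigma>. 2 * f \<sigma> + 2 * h \<sigma>)"
    proof (rule av_mono)
      fix \<sigma> assume \<sigma>: "\<sigma> \<in> block U \<tau>"
      have "0 \<le> (sqrt (f \<sigma>) - sqrt (h \<sigma>))\<^sup>2" by simp
      thus "(sqrt (f \<sigma>) + sqrt (h \<sigma>))\<^sup>2 \<le> 2 * f \<sigma> + 2 * h \<sigma>"
        using f[OF \<sigma>] h[OF \<sigma>] by (simp add: power2_sum power2_diff)
    qed
    thus "?E (\<lambda>\<sigma>. (sqrt (f \<sigma>) + sqrt (h \<sigma>))\<^sup>2) \<le> 4" by (simp add: av_add av_cmult Eh f1)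
    show "0 \<le> av U (ent {u} f) \<tau>" using f inW col by (intro av_nonneg ent_nonneg) auto
    show "0 \<le> ?E (\<lambda>\<sigma>. (sqrt (f \<sigma>) + sqrt (h \<sigma>))\<^sup>2)" by (intro av_nonneg) simp
  qed
  finally show ?thesis by simp
qed

text \<open>On the block, \<open>av (U - {v}) f\<close> depends on the color of \<open>v\<close>
  alone and is the density of its marginal. The sum \<open>X\<close> of the variances after
  resampling is controlled by a comparison vector, hence by \<open>dev\<close>, hence by the local
  entropies.\<close>

lemma sum_ent_marginal_le_normalized:
  assumes U: "U \<subseteq> V" "U \<noteq> {}" and \<tau>: "\<tau> \<in> colorings" and f: "\<And>\<eta>. \<eta> \<in> block U \<tau> \<Longrightarrow> 0 \<le> f \<eta>"
    and f1: "av U f \<tau> = 1"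
  shows "(\<Sum>v\<in>U. ent U (av (U - {v}) f) \<tau>) \<le> tensor_const a D * (\<Sum>v\<in>U. av U (ent {v} f) \<tau>)"
proof -
  have finU: "finite U" using U finite_V finite_subset by auto
  define S where "S = (\<Sum>v\<in>U. av U (ent {v} f) \<tau>)"
  define X where "X = (\<Sum>v\<in>U. av U (\<lambda>\<sigma>. (av (U - {v}) (av {v} f) \<sigma> - 1)\<^sup>2) \<tau>)"
  define M where "M = marginal_const a D"
  define n where "n = L2_set (dev U \<tau> f) U"
  have M: "0 \<le> M" unfolding M_def by (rule marginal_const_nonneg)
  have Xe: "X \<le> M\<^sup>2 * (4 * D) * (2 * n + e)\<^sup>2" if e: "0 < e" for e
  proof -
    obtain m where m: "comparison U \<tau> f m" "\<And>u. u \<in> U \<Longrightarrow> 0 \<le> m u" "L2_set m U \<le> 2 * n + e"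
      using comparison_small[OF U \<tau> f f1 e] unfolding n_def by blast
    have "X \<le> (\<Sum>v\<in>U. M\<^sup>2 * (\<Sum>u\<in>N v \<inter> U. m u)\<^sup>2)"
      unfolding X_def
    proof (intro sum_mono av_le_const[OF \<tau>])
      fix v \<sigma> assume "v \<in> U" "\<sigma> \<in> block U \<tau>"
      from resampled_marginal_le[OF U(1) this \<tau> m(1,2)]
      have "\<bar>av (U - {v}) (av {v} f) \<sigma> - 1\<bar>\<^sup>2 \<le> (M * (\<Sum>u\<in>N v \<inter> U. m u))\<^sup>2"
        unfolding M_def by (intro power_mono) auto
      thus "(av (U - {v}) (av {v} f) \<sigma> - 1)\<^sup>2 \<le> M\<^sup>2 * (\<Sum>u\<in>N v \<inter> U. m u)\<^sup>2"
        by (simp add: power_mult_distrib)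
    qed
    also have "\<dots> = M\<^sup>2 * (L2_set (\<lambda>v. \<Sum>u\<in>N v \<inter> U. m u) U)\<^sup>2"
      by (simp add: L2_set_def sum_nonneg sum_distrib_left)
    also have "\<dots> \<le> M\<^sup>2 * (2 * sqrt D * (2 * n + e))\<^sup>2"
    proof (intro mult_left_mono power_mono)
      have "L2_set (\<lambda>v. \<Sum>u\<in>N v \<inter> U. m u) U \<le> 2 * sqrt D * L2_set m U"
        by (rule adjacency_L2_within[OF U(1) m(2)])
      also have "\<dots> \<le> 2 * sqrt D * (2 * n + e)" using m(3) by (intro mult_left_mono) auto
      finally show "L2_set (\<lambda>v. \<Sum>u\<in>N v \<inter> U. m u) U \<le> 2 * sqrt D * (2 * n + e)" .
    qed (auto simp: L2_set_nonneg)
    also have "\<dots> = M\<^sup>2 * (4 * D) * (2 * n + e)\<^sup>2" by (simp add: power_mult_distrib)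
    finally show ?thesis .
  qed
  \<comment> \<open>\<open>X\<close> does not involve \<open>e\<close>, so the slack is removed by
    letting it tend to 0.\<close>
  have "X \<le> M\<^sup>2 * (4 * D) * (2 * n + 0)\<^sup>2"
  proof (rule LIMSEQ_le_const)
    show "(\<lambda>j. M\<^sup>2 * (4 * D) * (2 * n + inverse (real (Suc j)))\<^sup>2) \<longlonglongrightarrow> M\<^sup>2 * (4 * D) * (2 * n + 0)\<^sup>2"
      by (intro tendsto_intros LIMSEQ_inverse_real_of_nat)
    show "\<exists>j0. \<forall>j\<ge>j0. X \<le> M\<^sup>2 * (4 * D) * (2 * n + inverse (real (Suc j)))\<^sup>2"
      by (intro exI[of _ 0] allI impI Xe) simp
  qed
  also have "\<dots> = 16 * D * M\<^sup>2 * n\<^sup>2" by (simp add: power_mult_distrib)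
  also have "n\<^sup>2 \<le> 4 * S"
  proof -
    have "n\<^sup>2 = (\<Sum>u\<in>U. (dev U \<tau> f u)\<^sup>2)" by (simp add: n_def L2_set_def sum_nonneg)
    also have "\<dots> \<le> (\<Sum>u\<in>U. 4 * av U (ent {u} f) \<tau>)"
      using dev_sq_le[OF _ \<tau> f f1] by (intro sum_mono) auto
    finally show ?thesis by (simp add: S_def sum_distrib_left)
  qed
  finally have X: "X \<le> 64 * D * M\<^sup>2 * S" by (simp add: mult_left_mono)
  have "(\<Sum>v\<in>U. ent U (av (U - {v}) f) \<tau>) \<le> (\<Sum>v\<in>U. 2 * av U (ent {v} f) \<tau> +
      av U (\<lambda>\<sigma>. (av (U - {v}) (av {v} f) \<sigma> - 1)\<^sup>2) \<tau>)"
    by (intro sum_mono ent_marginal_le \<tau> f f1) auto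
  also have "\<dots> = 2 * S + X" by (simp add: S_def X_def sum.distrib sum_distrib_left)
  also have "\<dots> \<le> tensor_const a D * S" using X by (simp add: tensor_const_def M_def algebra_simps)
  finally show ?thesis by (simp add: S_def)
qed

lemma ent_scale:
  assumes c: "0 < c"
  shows "ent U (\<lambda>\<eta>. c * f \<eta>) \<sigma> = c * ent U f \<sigma>"
proof -
  have ln: "c * x * ln (c * x) = (c * ln c) * x + c * (x * ln x)" for x :: real
    using c by (cases "x = 0") (auto simp: ln_mult_pos algebra_simps ln_mult)
  have "av U (\<lambda>\<eta>. c * f \<eta> * ln (c * f \<eta>)) \<sigma> = (c * ln c) * av U f \<sigma> + c * av U (\<lambda>\<eta>. f \<eta> * ln (f \<eta>)) \<sigma>"
    unfolding ln by (simp only: av_add av_cmult)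
  thus ?thesis unfolding ent_def av_cmult ln by (simp add: algebra_simps)
qed

lemma ent_zero:
  assumes "\<And>\<eta>. \<eta> \<in> block U \<sigma> \<Longrightarrow> f \<eta> = 0"
  shows "ent U f \<sigma> = 0"
  unfolding ent_def using assms by (simp add: av_def)

text \<open>Both sides are homogeneous in \<open>f\<close>, so \<open>f\<close> may be scaled to
  mean 1; mean 0 forces \<open>f\<close> to vanish on the block.\<close>

lemma sum_ent_marginal_le:
  assumes U: "U \<subseteq> V" "U \<noteq> {}" and \<tau>: "\<tau> \<in> colorings" and f: "\<And>\<eta>. \<eta> \<in> block U \<tau> \<Longrightarrow> 0 \<le> f \<eta>"
  shows "(\<Sum>v\<in>U. ent U (av (U - {v}) f) \<tau>) \<le> tensor_const a D * (\<Sum>v\<in>U. av U (ent {v} f) \<tau>)"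
proof (cases "av U f \<tau> = 0")
  case True
  have "f \<eta> = 0" if \<eta>: "\<eta> \<in> block U \<tau>" for \<eta>
    using av_pos[OF \<tau> f \<eta>] f[OF \<eta>] True by fastforce
  moreover have "\<eta> \<in> block U \<tau>" if "\<sigma> \<in> block U \<tau>" "\<eta> \<in> block W \<sigma>" "W \<subseteq> U" for \<sigma> \<eta> W
    using block_mono[OF that(3,1)] that(2) by auto
  ultimately have "ent U (av (U - {v}) f) \<tau> = 0" "av U (ent {v} f) \<tau> = 0" if "v \<in> U" for v
    using that by (auto intro!: ent_zero simp: av_def[of "U - {v}"] av_def[of U] intro!: sum.neutral)
  thus ?thesis by simp
next
  case False
  hence pos: "0 < av U f \<tau>" using av_nonneg[OF f] by (simp add: less_le)
  define c where "c = 1 / av U f \<tau>"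
  have c: "0 < c" using pos by (simp add: c_def)
  have "av U (\<lambda>\<eta>. c * f \<eta>) \<tau> = 1" unfolding av_cmult c_def using pos by simp
  hence "(\<Sum>v\<in>U. ent U (av (U - {v}) (\<lambda>\<eta>. c * f \<eta>)) \<tau>) \<le> tensor_const a D * (\<Sum>v\<in>U. av U (ent {v} (\<lambda>\<eta>. c * f \<eta>)) \<tau>)"
    using f c by (intro sum_ent_marginal_le_normalized[OF U \<tau>]) auto
  moreover have "av (U - {v}) (\<lambda>\<eta>. c * f \<eta>) = (\<lambda>\<eta>. c * av (U - {v}) f \<eta>)" for v
    by (simp add: av_cmult fun_eq_iff)
  moreover have "ent {v} (\<lambda>\<eta>. c * f \<eta>) = (\<lambda>\<eta>. c * ent {v} f \<eta>)" for v
    by (simp add: ent_scale[OF c] fun_eq_iff)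
  ultimately have "c * (\<Sum>v\<in>U. ent U (av (U - {v}) f) \<tau>) \<le> c * (tensor_const a D * (\<Sum>v\<in>U. av U (ent {v} f) \<tau>))"
    by (simp add: ent_scale[OF c] av_cmult sum_distrib_left mult_ac)
  thus ?thesis using c by simp
qed

text \<open>Revealing \<open>v\<close> first leaves the other vertices to the induction hypothesis.
  Summed over \<open>v\<close>, this counts each local entropy \<open>card U - 1\<close> times, and
  the marginal terms supply exactly the missing one. So the constant does not grow along the
  induction.\<close>

lemma approximate_tensorization:
  assumes "U \<subseteq> V" "\<tau> \<in> colorings" "\<And>\<eta>. \<eta> \<in> colorings \<Longrightarrow> 0 \<le> f \<eta>"
  shows "ent U f \<tau> \<le> tensor_const a D * (\<Sum>v\<in>U. av U (ent {v} f) \<tau>)"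
  using assms(1,2)
proof (induction "card U" arbitrary: U \<tau>)
  case 0
  hence "U = {}" using finite_subset[OF 0(2) finite_V] by simp
  moreover have "block {} \<tau> = {\<tau>}" using 0 by (auto simp: block_def)
  ultimately show ?case by (simp add: ent_def av_def)
next
  case (Suc k)
  note \<tau> = Suc.prems(2)
  have finU: "finite U" using Suc.prems finite_V finite_subset by auto
  have ne: "U \<noteq> {}" using Suc.hyps(2) by auto
  define e where "e v = av U (ent {v} f) \<tau>" for v
  have IH: "av U (ent (U - {v}) f) \<tau> \<le> tensor_const a D * (\<Sum>w\<in>U - {v}. e w)" if v: "v \<in> U" for v
  proof -
    have sub: "U - {v} \<subseteq> U" by auto
    have "av U (ent (U - {v}) f) \<tau> \<le> av U (\<lambda>\<sigma>. tensor_const a D * (\<Sum>w\<in>U - {v}. av (U - {v}) (ent {w} f) \<sigma>)) \<tau>"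
    proof (rule av_mono)
      fix \<sigma> assume "\<sigma> \<in> block U \<tau>"
      hence "\<sigma> \<in> colorings" using block_subset by auto
      moreover have "k = card (U - {v})" using Suc.hyps(2) v finU by simp
      ultimately show "ent (U - {v}) f \<sigma> \<le> tensor_const a D * (\<Sum>w\<in>U - {v}. av (U - {v}) (ent {w} f) \<sigma>)"
        using Suc.prems(1) by (intro Suc.hyps(1)) auto
    qed
    also have "\<dots> = tensor_const a D * (\<Sum>w\<in>U - {v}. e w)"
      by (simp add: av_cmult av_sum av_tower[OF sub] e_def)
    finally show ?thesis .
  qed
  have "real (card U) * ent U f \<tau> = (\<Sum>v\<in>U. ent U f \<tau>)" by simp
  also have "\<dots> = (\<Sum>v\<in>U. av U (ent (U - {v}) f) \<tau> + ent U (av (U - {v}) f) \<tau>)"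
    by (intro sum.cong refl ent_chain) auto
  also have "\<dots> = (\<Sum>v\<in>U. av U (ent (U - {v}) f) \<tau>) + (\<Sum>v\<in>U. ent U (av (U - {v}) f) \<tau>)"
    by (rule sum.distrib)
  also have "\<dots> \<le> (\<Sum>v\<in>U. tensor_const a D * (\<Sum>w\<in>U - {v}. e w)) + tensor_const a D * (\<Sum>w\<in>U. e w)"
    using sum_ent_marginal_le[OF Suc.prems(1) ne \<tau>, of f] assms(3) block_subset IH unfolding e_def
    by (intro add_mono sum_mono) auto
  also have "(\<Sum>v\<in>U. tensor_const a D * (\<Sum>w\<in>U - {v}. e w)) = tensor_const a D * (real (card U) - 1) * (\<Sum>w\<in>U. e w)"
  proof -
    have "(\<Sum>v\<in>U. \<Sum>w\<in>U - {v}. e w) = (\<Sum>v\<in>U. (\<Sum>w\<in>U. e w) - e v)"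
      using finU by (intro sum.cong refl) (simp add: sum_diff1)
    also have "\<dots> = (real (card U) - 1) * (\<Sum>w\<in>U. e w)"
      by (simp add: sum_subtractf left_diff_distrib)
    finally show ?thesis by (simp add: sum_distrib_left[symmetric])
  qed
  finally have "real (card U) * ent U f \<tau> \<le> real (card U) * (tensor_const a D * (\<Sum>w\<in>U. e w))"
    by (simp add: algebra_simps)
  thus ?case using ne finU by (simp add: e_def card_gt_0_iff)
qed

end

section \<open>Spectral gap, entropy decay and mixing of the Glauber dynamics\<close>

text \<open>Ratios of successive terms of a log-convex sequence increase, so a first ratio r above
  \<open>q\<close> would force \<open>s t \<ge> r ^ t * s 0\<close>, eventually above
  \<open>C * q ^ t\<close>. Thus an arbitrarily poor prefactor \<open>C\<close> still gives the rate
  \<open>q\<close> at the first step.\<close>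

lemma log_convex_decay:
  fixes s :: "nat \<Rightarrow> real"
  assumes nonneg: "\<And>t. 0 \<le> s t" and convex: "\<And>t. (s (Suc t))\<^sup>2 \<le> s t * s (Suc (Suc t))"
    and decay: "\<And>t. s t \<le> C * q ^ t" and q: "0 < q"
  shows "s 1 \<le> q * s 0"
proof (cases "s 0 = 0")
  case True
  thus ?thesis using convex[of 0] by simp
next
  case False
  hence s0: "0 < s 0" using nonneg[of 0] by simp
  show ?thesis
  proof (rule ccontr)
    assume neg: "\<not> ?thesis"
    define r where "r = s 1 / s 0"
    have r: "q < r" using neg s0 by (simp add: r_def field_simps)
    have step: "0 < s t \<and> r * s t \<le> s (Suc t)" for t
    proof (induction t)
      case 0 thus ?case using s0 by (simp add: r_def)
    next
      case (Suc t)
      have "0 < r * s t" using Suc r q by (intro mult_pos_pos) auto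
      hence pos: "0 < s (Suc t)" using Suc by linarith
      have "s t * (r * s (Suc t)) \<le> s (Suc t) * s (Suc t)"
        using Suc pos mult_right_mono[of "r * s t" "s (Suc t)" "s (Suc t)"] by (simp add: mult_ac)
      also have "\<dots> \<le> s t * s (Suc (Suc t))" using convex[of t] by (simp add: power2_eq_square)
      finally show ?case using Suc pos by simp
    qed
    have pow: "r ^ t * s 0 \<le> s t" for t
    proof (induction t)
      case 0 thus ?case by simp
    next
      case (Suc t)
      have "r ^ Suc t * s 0 = r * (r ^ t * s 0)" by simp
      also have "\<dots> \<le> r * s t" using Suc r q by (intro mult_left_mono) auto
      also have "\<dots> \<le> s (Suc t)" using step by simp
      finally show ?case .
    qed
    have "1 < r / q" using r q by simp
    then obtain t where t: "C / s 0 < (r / q) ^ t" using real_arch_pow by blast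
    have "r ^ t * s 0 \<le> C * q ^ t" using pow[of t] decay[of t] by linarith
    hence "(r / q) ^ t \<le> C / s 0" using s0 q by (simp add: power_divide field_simps)
    thus False using t by simp
  qed
qed

context coloring_instance
begin

section \<open>The transition operator and its action on oscillations\<close>

definition chain_op :: "(('v \<Rightarrow> 'c) \<Rightarrow> real) \<Rightarrow> ('v \<Rightarrow> 'c) \<Rightarrow> real" where
  "chain_op g \<sigma> = (\<Sum>v\<in>V. resample v g \<sigma>) / card V"

definition contraction :: real where
  "contraction = 1 - 1 / (2 * real (card V))"

lemma card_V_ge_1: "1 \<le> real (card V)"
  using finite_V V_nonempty by (simp add: Suc_le_eq card_gt_0_iff)

lemma contraction_bounds: "1 / 2 \<le> contraction" "contraction < 1"
  using card_V_ge_1 by (simp_all add: contraction_def field_simps)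

text \<open>Greedy coloring: whatever the other colors are, a vertex has an available one, so
  vertices are recolored one by one while properness within the treated set is kept.\<close>

lemma colorings_nonempty: "colorings \<noteq> {}"
proof -
  have "\<exists>\<sigma>\<in>configs. \<forall>v\<in>S. \<forall>u\<in>N v \<inter> S. \<sigma> v \<noteq> \<sigma> u" if "S \<subseteq> V" "finite S" for S
    using that(2,1)
  proof (induction S rule: finite_induct)
    case empty
    have "L v \<noteq> {}" if "v \<in> V" for v using avail_nonempty[OF that] avail_subset by fastforce
    hence "configs \<noteq> {}" unfolding configs_def by (simp add: PiE_eq_empty_iff)
    thus ?case by auto
  next
    case (insert v S)
    then obtain \<sigma> where \<sigma>: "\<sigma> \<in> configs" "\<forall>w\<in>S. \<forall>u\<in>N w \<inter> S. \<sigma> w \<noteq> \<sigma> u" by auto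
    have vV: "v \<in> V" using insert by auto
    obtain c where c: "c \<in> avail \<sigma> v" using avail_nonempty[OF vV] by blast
    have "\<sigma>(v := c) \<in> configs" using c avail_subset by (intro configs_upd \<sigma> vV) auto
    moreover have "(\<sigma>(v := c)) w \<noteq> (\<sigma>(v := c)) u" if w: "w \<in> insert v S" and u: "u \<in> N w \<inter> insert v S" for w u
    proof -
      have uw: "u \<noteq> w" using u N_irrefl by auto
      consider "w = v" | "w \<noteq> v" "u = v" | "w \<noteq> v" "u \<noteq> v" by auto
      thus ?thesis
      proof cases
        case 1
        thus ?thesis using c u uw by (auto simp: avail_def)
      next
        case 2
        hence "w \<in> N v" using u N_sym by auto
        thus ?thesis using c 2 by (auto simp: avail_def)
      next
        case 3
        thus ?thesis using \<sigma>(2) w u by auto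
      qed
    qed
    ultimately show ?case by blast
  qed
  from this[OF subset_refl finite_V] obtain \<sigma> where \<sigma>: "\<sigma> \<in> configs" "\<forall>v\<in>V. \<forall>u\<in>N v \<inter> V. \<sigma> v \<noteq> \<sigma> u" by auto
  hence "\<sigma> \<in> colorings" using N_subset unfolding colorings_def by blast
  thus ?thesis by auto
qed

lemma block_V: "\<sigma> \<in> colorings \<Longrightarrow> block V \<sigma> = colorings"
  unfolding block_def colorings_def configs_def by (auto simp: PiE_iff extensional_def)

lemma chain_op_osc_le:
  assumes osc: "osc_le g \<delta>"
  shows "osc_le (chain_op g) (\<lambda>w. (1 - 1 / card V) * \<delta> w + (\<Sum>u\<in>N w. \<delta> u) / a / card V)"
  unfolding osc_le_def
proof (intro ballI)
  fix \<sigma> w c assume \<sigma>: "\<sigma> \<in> configs" and w: "w \<in> V" and c: "c \<in> L w"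
  let ?b = "\<lambda>u. if w = u then 0 else \<delta> w + (if w \<in> N u then \<delta> u / a else 0)"
  have "\<bar>chain_op g (\<sigma>(w := c)) - chain_op g \<sigma>\<bar> = \<bar>\<Sum>u\<in>V. resample u g (\<sigma>(w := c)) - resample u g \<sigma>\<bar> / card V"
    unfolding chain_op_def by (simp add: sum_subtractf diff_divide_distrib[symmetric] abs_divide)
  also have "\<dots> \<le> (\<Sum>u\<in>V. ?b u) / card V"
  proof (intro divide_right_mono order_trans[OF sum_abs] sum_mono)
    fix u assume "u \<in> V"
    from osc_leD[OF resample_osc_le[OF osc this] \<sigma> w c]
    show "\<bar>resample u g (\<sigma>(w := c)) - resample u g \<sigma>\<bar> \<le> ?b u" .
  qed simp
  also have "(\<Sum>u\<in>V. ?b u) = (real (card V) - 1) * \<delta> w + (\<Sum>u\<in>N w. \<delta> u) / a"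
  proof -
    have "(\<Sum>u\<in>V. ?b u) = (\<Sum>u\<in>V - {w}. \<delta> w + (if u \<in> N w then \<delta> u / a else 0))"
    proof -
      \<comment> \<open>By symmetry of \<open>N\<close> the vertices influenced by \<open>w\<close>
        are the neighbours of \<open>w\<close>, so the adjacency matrix itself acts on
        \<delta>.\<close>
      have "?b u = \<delta> w + (if u \<in> N w then \<delta> u / a else 0)" if "u \<in> V - {w}" for u
        using that N_sym[of u w] N_sym[of w u] by auto
      hence "(\<Sum>u\<in>V - {w}. ?b u) = (\<Sum>u\<in>V - {w}. \<delta> w + (if u \<in> N w then \<delta> u / a else 0))"
        by (rule sum.cong[OF refl])
      thus ?thesis by (subst sum.remove[OF finite_V w]) simp
    qed
    also have "\<dots> = real (card (V - {w})) * \<delta> w + (\<Sum>u\<in>(V - {w}) \<inter> N w. \<delta> u / a)"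
      using finite_V by (simp add: sum.distrib sum.inter_restrict)
    also have "(V - {w}) \<inter> N w = N w" using N_subset N_irrefl by auto
    also have "real (card (V - {w})) = real (card V) - 1" using card.remove[OF finite_V w] by simp
    finally show ?thesis by (simp add: sum_divide_distrib)
  qed
  also have "((real (card V) - 1) * \<delta> w + (\<Sum>u\<in>N w. \<delta> u) / a) / card V
    = (1 - 1 / card V) * \<delta> w + (\<Sum>u\<in>N w. \<delta> u) / a / card V"
    using card_V_ge_1 by (simp add: field_simps)
  finally show "\<bar>chain_op g (\<sigma>(w := c)) - chain_op g \<sigma>\<bar> \<le> (1 - 1 / card V) * \<delta> w + (\<Sum>u\<in>N w. \<delta> u) / a / card V" .
qed

text \<open>The weight 1 - 1/n of not choosing a vertex plus 1/n times the norm bound 1/2 is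
  \<open>contraction\<close>. Only the Euclidean norm decreases; single entries of \<delta> may
  grow.\<close>

lemma chain_op_iterate_osc:
  assumes "osc_le g (\<lambda>_. M)" "0 \<le> M"
  shows "\<exists>\<delta>. osc_le ((chain_op ^^ t) g) \<delta> \<and> (\<forall>v\<in>V. 0 \<le> \<delta> v) \<and> L2_set \<delta> V \<le> contraction ^ t * sqrt (card V) * M"
proof (induction t)
  case 0
  have "L2_set (\<lambda>_. M) V = sqrt (card V) * M"
    using assms(2) by (simp add: L2_set_def real_sqrt_mult)
  thus ?case using assms by (intro exI[of _ "\<lambda>_. M"]) auto
next
  case (Suc t)
  then obtain \<delta> where \<delta>: "osc_le ((chain_op ^^ t) g) \<delta>" "\<And>v. v \<in> V \<Longrightarrow> 0 \<le> \<delta> v"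
    "L2_set \<delta> V \<le> contraction ^ t * sqrt (card V) * M" by auto
  define k where "k = real (card V)"
  have k: "1 \<le> k" using card_V_ge_1 by (simp add: k_def)
  define s where "s w = (\<Sum>u\<in>N w. \<delta> u)" for w
  have s: "0 \<le> s w" for w unfolding s_def using \<delta>(2) N_subset by (auto intro!: sum_nonneg)
  let ?\<delta> = "\<lambda>w. (1 - 1 / k) * \<delta> w + s w / a / k"
  have "osc_le ((chain_op ^^ Suc t) g) ?\<delta>"
    using chain_op_osc_le[OF \<delta>(1)] by (simp add: k_def s_def)
  moreover have "\<forall>v\<in>V. 0 \<le> ?\<delta> v" using \<delta>(2) s k a_gt_1 by auto
  moreover have "L2_set ?\<delta> V \<le> contraction ^ Suc t * sqrt (card V) * M"
  proof -
    have "L2_set s V \<le> 2 * sqrt (real D) * L2_set \<delta> V"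
      unfolding s_def by (rule adjacency_L2[OF \<delta>(2)])
    hence "L2_set s V / a \<le> 2 * sqrt (real D) * L2_set \<delta> V / a"
      using a_gt_1 by (intro divide_right_mono) auto
    also have "\<dots> = (2 * sqrt (real D) / a) * L2_set \<delta> V" by simp
    also have "\<dots> \<le> (1 / 2) * L2_set \<delta> V"
      using a_ge a_gt_1 by (intro mult_right_mono) (auto simp: L2_set_nonneg field_simps)
    finally have sa: "L2_set s V / a \<le> L2_set \<delta> V / 2" by simp
    have "L2_set ?\<delta> V \<le> L2_set (\<lambda>w. (1 - 1 / k) * \<delta> w) V + L2_set (\<lambda>w. s w / a / k) V"
      by (rule L2_set_triangle_ineq)
    also have "L2_set (\<lambda>w. (1 - 1 / k) * \<delta> w) V = (1 - 1 / k) * L2_set \<delta> V"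
      using k by (intro L2_set_right_distrib[symmetric]) simp
    also have "L2_set (\<lambda>w. s w / a / k) V = L2_set s V / a / k"
      using k a_gt_1 L2_set_right_distrib[of "1 / (a * k)" s V] by simp
    also have "L2_set s V / a / k \<le> L2_set \<delta> V / 2 / k" using sa k by (intro divide_right_mono) auto
    finally have "L2_set ?\<delta> V \<le> (1 - 1 / k) * L2_set \<delta> V + L2_set \<delta> V / 2 / k" by simp
    also have "\<dots> = contraction * L2_set \<delta> V" by (simp add: contraction_def k_def algebra_simps)
    also have "\<dots> \<le> contraction * (contraction ^ t * sqrt (card V) * M)"
      using \<delta>(3) contraction_bounds by (intro mult_left_mono) auto
    finally show ?thesis by simp
  qed
  ultimately show ?case by blast
qed

text \<open>The factor \<open>card V\<close> is a product of two square roots: one from the norm of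
  the constant initial bound, one from Cauchy-Schwarz when the norm is turned into a sum over
  vertices.\<close>

lemma chain_op_iterate_diff_le:
  assumes g: "osc_le g (\<lambda>_. M)" "0 \<le> M" and \<sigma>: "\<sigma> \<in> configs" "\<eta> \<in> configs"
  shows "\<bar>(chain_op ^^ t) g \<sigma> - (chain_op ^^ t) g \<eta>\<bar> \<le> card V * contraction ^ t * M"
proof -
  obtain \<delta> where \<delta>: "osc_le ((chain_op ^^ t) g) \<delta>" "\<And>v. v \<in> V \<Longrightarrow> 0 \<le> \<delta> v"
    "L2_set \<delta> V \<le> contraction ^ t * sqrt (card V) * M"
    using chain_op_iterate_osc[OF g, of t] by auto
  have "\<bar>(chain_op ^^ t) g \<sigma> - (chain_op ^^ t) g \<eta>\<bar> \<le> sum \<delta> V"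
    using \<sigma> by (intro osc_le_diff[OF \<delta>(1) \<sigma>(1) finite_V]) (auto simp: configs_def PiE_iff extensional_def)
  also have "\<dots> = (\<Sum>v\<in>V. \<bar>\<delta> v\<bar> * \<bar>1\<bar>)" using \<delta>(2) by (intro sum.cong) auto
  also have "\<dots> \<le> L2_set \<delta> V * L2_set (\<lambda>_. 1) V" by (rule L2_set_mult_ineq)
  also have "L2_set (\<lambda>_. 1) V = sqrt (card V)" by (simp add: L2_set_def)
  also have "L2_set \<delta> V * sqrt (card V) \<le> (contraction ^ t * sqrt (card V) * M) * sqrt (card V)"
    using \<delta>(3) by (intro mult_right_mono) auto
  also have "\<dots> = contraction ^ t * (sqrt (card V) * sqrt (card V)) * M" by (simp only: mult_ac)
  also have "\<dots> = card V * contraction ^ t * M" by simp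
  finally show ?thesis .
qed

section \<open>Reversibility and the spectral gap\<close>

lemma chain_op_eq_av:
  assumes "\<sigma> \<in> colorings"
  shows "chain_op g \<sigma> = (\<Sum>v\<in>V. av {v} g \<sigma>) / card V"
  unfolding chain_op_def using av_single[OF assms] by simp

lemma chain_op_adj:
  assumes \<tau>: "\<tau> \<in> colorings"
  shows "av V (\<lambda>\<sigma>. f \<sigma> * chain_op g \<sigma>) \<tau> = av V (\<lambda>\<sigma>. chain_op f \<sigma> * g \<sigma>) \<tau>"
proof -
  have "av V (\<lambda>\<sigma>. f \<sigma> * chain_op g \<sigma>) \<tau> = av V (\<lambda>\<sigma>. (1 / card V) * (\<Sum>v\<in>V. f \<sigma> * av {v} g \<sigma>)) \<tau>"
    using block_subset by (intro av_cong) (auto simp: chain_op_eq_av sum_distrib_left sum_divide_distrib subset_iff)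
  also have "\<dots> = av V (\<lambda>\<sigma>. (1 / card V) * (\<Sum>v\<in>V. av {v} f \<sigma> * g \<sigma>)) \<tau>"
    unfolding av_cmult av_sum by (intro arg_cong[where f = "\<lambda>x. _ * x"] sum.cong refl av_adj) auto
  also have "\<dots> = av V (\<lambda>\<sigma>. chain_op f \<sigma> * g \<sigma>) \<tau>"
    using block_subset by (intro av_cong) (auto simp: chain_op_eq_av sum_distrib_right subset_iff)
  finally show ?thesis .
qed

lemma chain_op_const: "chain_op (\<lambda>_. c) \<sigma> = c"
proof -
  have "resample v (\<lambda>_. c) \<sigma> = c" if "v \<in> V" for v
    using card_avail_pos[OF that, of \<sigma>] by (simp add: resample_def)
  thus ?thesis using card_V_ge_1 by (simp add: chain_op_def)
qed

lemma chain_op_diff: "chain_op (\<lambda>\<eta>. f \<eta> - g \<eta>) \<sigma> = chain_op f \<sigma> - chain_op g \<sigma>"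
  by (simp add: chain_op_def resample_def sum_subtractf diff_divide_distrib)

lemma av_chain_op:
  assumes "\<tau> \<in> colorings"
  shows "av V (chain_op g) \<tau> = av V g \<tau>"
  using chain_op_adj[OF assms, of "\<lambda>_. 1" g] by (simp add: chain_op_const)

lemma av_chain_op_iterate: "\<tau> \<in> colorings \<Longrightarrow> av V ((chain_op ^^ t) g) \<tau> = av V g \<tau>"
  by (induction t) (simp_all add: av_chain_op)

lemma chain_op_iterate_mean_le:
  assumes g: "osc_le g (\<lambda>_. M)" "0 \<le> M" and \<sigma>: "\<sigma> \<in> colorings" and \<tau>: "\<tau> \<in> colorings"
  shows "\<bar>(chain_op ^^ t) g \<sigma> - av V g \<tau>\<bar> \<le> card V * contraction ^ t * M"
proof -
  let ?h = "(chain_op ^^ t) g"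
  have eq: "?h \<sigma> - av V g \<tau> = av V (\<lambda>\<eta>. ?h \<sigma> - ?h \<eta>) \<tau>"
    by (simp add: av_diff av_const[OF \<tau>] av_chain_op_iterate[OF \<tau>])
  have "\<bar>av V (\<lambda>\<eta>. ?h \<sigma> - ?h \<eta>) \<tau>\<bar> \<le> av V (\<lambda>\<eta>. \<bar>?h \<sigma> - ?h \<eta>\<bar>) \<tau>" by (rule av_abs)
  also have "\<dots> \<le> card V * contraction ^ t * M"
    using \<sigma> block_subset colorings_subset
    by (intro av_le_const[OF \<tau>] chain_op_iterate_diff_le[OF g]) auto
  finally show ?thesis unfolding eq .
qed

lemma osc_le_bounded: "\<exists>M\<ge>0. osc_le g (\<lambda>_. M)"
proof -
  define M where "M = (\<Sum>\<sigma>\<in>configs. \<bar>g \<sigma>\<bar>)"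
  have M: "\<bar>g \<sigma>\<bar> \<le> M" if "\<sigma> \<in> configs" for \<sigma>
    unfolding M_def using that finite_configs by (intro member_le_sum) auto
  have "osc_le g (\<lambda>_. 2 * M)"
    unfolding osc_le_def
  proof (intro ballI)
    fix \<sigma> u c assume "\<sigma> \<in> configs" "u \<in> V" "c \<in> L u"
    thus "\<bar>g (\<sigma>(u := c)) - g \<sigma>\<bar> \<le> 2 * M"
      using M[of \<sigma>] M[OF configs_upd[of \<sigma> u c]] by linarith
  qed
  moreover have "0 \<le> M" unfolding M_def by (rule sum_nonneg) simp
  ultimately show ?thesis by (intro exI[of _ "2 * M"]) auto
qed

lemma gap_centered:
  assumes \<tau>: "\<tau> \<in> colorings" and F: "av V F \<tau> = 0"
  shows "av V (\<lambda>\<sigma>. F \<sigma> * chain_op F \<sigma>) \<tau> \<le> contraction * av V (\<lambda>\<sigma>. (F \<sigma>)\<^sup>2) \<tau>"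
proof -
  define s where "s t = av V (\<lambda>\<sigma>. ((chain_op ^^ t) F \<sigma>)\<^sup>2) \<tau>" for t
  obtain M where M: "0 \<le> M" "osc_le F (\<lambda>_. M)" using osc_le_bounded by blast
  have s0: "0 \<le> s t" for t unfolding s_def by (rule av_nonneg) simp
  have "s 1 \<le> contraction\<^sup>2 * s 0"
  proof (rule log_convex_decay[OF s0])
    fix t
    let ?h = "(chain_op ^^ t) F"
    have "s (Suc t) = av V (\<lambda>\<sigma>. chain_op ?h \<sigma> * chain_op ?h \<sigma>) \<tau>"
      by (simp add: s_def power2_eq_square)
    also have "\<dots> = av V (\<lambda>\<sigma>. ?h \<sigma> * chain_op (chain_op ?h) \<sigma>) \<tau>" by (rule chain_op_adj[OF \<tau>, symmetric])
    finally show "(s (Suc t))\<^sup>2 \<le> s t * s (Suc (Suc t))"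
      using av_Cauchy_Schwarz[of V ?h "chain_op (chain_op ?h)" \<tau>] by (simp add: s_def)
  next
    fix t
    \<comment> \<open>Since \<open>F\<close> has mean 0, its iterates are uniformly close to 0;
      squaring the bound gives the rate \<open>contraction\<^sup>2\<close>.\<close>
    show "s t \<le> (card V * M)\<^sup>2 * (contraction\<^sup>2) ^ t"
      unfolding s_def
    proof (rule av_le_const[OF \<tau>])
      fix \<sigma> assume "\<sigma> \<in> block V \<tau>"
      hence "\<sigma> \<in> colorings" using block_subset by auto
      hence "\<bar>(chain_op ^^ t) F \<sigma>\<bar> \<le> card V * contraction ^ t * M"
        using chain_op_iterate_mean_le[OF M(2,1) _ \<tau>, of \<sigma> t] F by simp
      hence "\<bar>(chain_op ^^ t) F \<sigma>\<bar>\<^sup>2 \<le> (card V * contraction ^ t * M)\<^sup>2" by (intro power_mono) auto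
      thus "((chain_op ^^ t) F \<sigma>)\<^sup>2 \<le> (card V * M)\<^sup>2 * (contraction\<^sup>2) ^ t"
        by (simp add: power_mult_distrib power_mult[symmetric] mult_ac)
    qed
  next
    show "0 < contraction\<^sup>2" using contraction_bounds by simp
  qed
  \<comment> \<open>Cauchy-Schwarz passes from the norm of \<open>chain_op F\<close> to the
    quadratic form.\<close>
  have "(av V (\<lambda>\<sigma>. F \<sigma> * chain_op F \<sigma>) \<tau>)\<^sup>2 \<le> s 0 * s 1"
    using av_Cauchy_Schwarz[of V F "chain_op F" \<tau>] by (simp add: s_def)
  moreover have "s 0 * s 1 \<le> s 0 * (contraction\<^sup>2 * s 0)"
    using \<open>s 1 \<le> contraction\<^sup>2 * s 0\<close> s0 by (intro mult_left_mono) auto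
  moreover have "s 0 * (contraction\<^sup>2 * s 0) = (contraction * s 0)\<^sup>2" by (simp add: power2_eq_square mult_ac)
  ultimately have "(av V (\<lambda>\<sigma>. F \<sigma> * chain_op F \<sigma>) \<tau>)\<^sup>2 \<le> (contraction * s 0)\<^sup>2" by linarith
  hence "av V (\<lambda>\<sigma>. F \<sigma> * chain_op F \<sigma>) \<tau> \<le> contraction * s 0"
    by (rule power2_le_imp_le) (use contraction_bounds s0 in \<open>auto intro!: mult_nonneg_nonneg\<close>)
  thus ?thesis by (simp add: s_def)
qed

lemma dirichlet_ge_variance:
  assumes \<tau>: "\<tau> \<in> colorings"
  shows "av V (\<lambda>\<sigma>. (f \<sigma> - av V f \<tau>)\<^sup>2) \<tau> / (2 * card V) \<le> av V (\<lambda>\<sigma>. f \<sigma> * (f \<sigma> - chain_op f \<sigma>)) \<tau>"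
proof -
  define c where "c = av V f \<tau>"
  define F where "F \<sigma> = f \<sigma> - c" for \<sigma>
  have F0: "av V F \<tau> = 0" unfolding F_def by (simp add: av_diff av_const[OF \<tau>] c_def)
  have PF: "chain_op F \<sigma> = chain_op f \<sigma> - c" for \<sigma>
    unfolding F_def chain_op_diff chain_op_const ..
  \<comment> \<open>Constants are fixed by the chain, and the leftover multiple of
    \<open>f - chain_op f\<close> has mean 0 by stationarity.\<close>
  have "av V (\<lambda>\<sigma>. f \<sigma> * (f \<sigma> - chain_op f \<sigma>)) \<tau> =
    av V (\<lambda>\<sigma>. ((F \<sigma>)\<^sup>2 - F \<sigma> * chain_op F \<sigma>) + c * (f \<sigma> - chain_op f \<sigma>)) \<tau>"
    by (rule av_cong) (simp only: PF, simp add: F_def power2_eq_square algebra_simps)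
  also have "\<dots> = av V (\<lambda>\<sigma>. (F \<sigma>)\<^sup>2) \<tau> - av V (\<lambda>\<sigma>. F \<sigma> * chain_op F \<sigma>) \<tau>"
    by (simp only: av_add av_diff av_cmult av_chain_op[OF \<tau>]) simp
  finally have "(1 - contraction) * av V (\<lambda>\<sigma>. (F \<sigma>)\<^sup>2) \<tau> \<le> av V (\<lambda>\<sigma>. f \<sigma> * (f \<sigma> - chain_op f \<sigma>)) \<tau>"
    using gap_centered[OF \<tau> F0] by (simp add: left_diff_distrib)
  thus ?thesis by (simp add: contraction_def F_def c_def mult.commute)
qed

text \<open>The form splits into one term per vertex. Jensen's inequality for the logarithm, used as
  Gibbs' inequality for \<open>h\<close> against \<open>f\<close>, makes each term at least the mean
  local entropy. By \<open>pos\<close>, \<open>f\<close> vanishes everywhere or nowhere on a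
  single-vertex block, so \<open>ln 0\<close> meets only the factor 0.\<close>

lemma dirichlet_log_ge:
  assumes \<tau>: "\<tau> \<in> colorings" and f: "\<And>\<sigma>. \<sigma> \<in> colorings \<Longrightarrow> 0 \<le> f \<sigma>"
    and pos: "\<And>\<sigma> v \<eta>. \<sigma> \<in> colorings \<Longrightarrow> v \<in> V \<Longrightarrow> \<eta> \<in> block {v} \<sigma> \<Longrightarrow> 0 < f \<sigma> \<Longrightarrow> f \<eta> \<noteq> 0"
  shows "ent V f \<tau> / (tensor_const a D * card V) \<le> av V (\<lambda>\<sigma>. f \<sigma> * (ln (f \<sigma>) - chain_op (\<lambda>\<eta>. ln (f \<eta>)) \<sigma>)) \<tau>"
proof -
  let ?E = "\<lambda>h. av V h \<tau>" and ?l = "\<lambda>\<eta>. ln (f \<eta>)"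
  note K = tensor_const_pos[of a D]
  have single: "?E (ent {v} f) \<le> ?E (\<lambda>\<sigma>. f \<sigma> * (?l \<sigma> - av {v} ?l \<sigma>))" if v: "v \<in> V" for v
  proof -
    define h where "h = av {v} f"
    have vV: "{v} \<subseteq> V" using v by simp
    have h: "0 \<le> h \<sigma>" for \<sigma> unfolding h_def using f block_subset by (intro av_nonneg) auto
    have "?E (\<lambda>\<sigma>. h \<sigma> - f \<sigma>) \<le> ?E (\<lambda>\<sigma>. ln (h \<sigma>) * h \<sigma> - h \<sigma> * ?l \<sigma>)"
    proof (rule av_mono)
      fix \<sigma> assume "\<sigma> \<in> block V \<tau>"
      hence \<sigma>: "\<sigma> \<in> colorings" using block_subset by auto
      have "0 < f \<sigma>" if hpos: "0 < h \<sigma>"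
      proof -
        obtain \<eta> where \<eta>: "\<eta> \<in> block {v} \<sigma>" "0 < f \<eta>" using hpos unfolding h_def by (rule av_pos_ex)
        hence "\<eta> \<in> colorings" "\<sigma> \<in> block {v} \<eta>" using block_subset block_sym[OF \<sigma>] by auto
        hence "f \<sigma> \<noteq> 0" using pos[of \<eta> v \<sigma>] v \<eta> by simp
        thus ?thesis using f[OF \<sigma>] by simp
      qed
      thus "h \<sigma> - f \<sigma> \<le> ln (h \<sigma>) * h \<sigma> - h \<sigma> * ?l \<sigma>"
        using mult_ln_diff_ge[OF h[of \<sigma>] f[OF \<sigma>], of 1] by (simp add: mult.commute)
    qed
    moreover have "?E (\<lambda>\<sigma>. h \<sigma> - f \<sigma>) = 0" unfolding h_def by (simp add: av_diff av_tower[OF vV])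
    moreover have "?E (\<lambda>\<sigma>. ln (h \<sigma>) * h \<sigma>) = ?E (\<lambda>\<sigma>. f \<sigma> * ln (h \<sigma>))"
      using av_inv[OF vV, of "\<lambda>\<sigma>. ln (h \<sigma>)" f \<tau>] unfolding h_def by (simp add: av_eq mult.commute)
    moreover have "?E (\<lambda>\<sigma>. h \<sigma> * ?l \<sigma>) = ?E (\<lambda>\<sigma>. f \<sigma> * av {v} ?l \<sigma>)"
      unfolding h_def by (rule av_adj[OF vV, symmetric])
    ultimately have "?E (\<lambda>\<sigma>. f \<sigma> * av {v} ?l \<sigma>) \<le> ?E (\<lambda>\<sigma>. f \<sigma> * ln (h \<sigma>))"
      by (simp add: av_diff)
    thus ?thesis unfolding av_ent_single[OF vV] h_def by (simp add: right_diff_distrib av_diff)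
  qed
  have "ent V f \<tau> \<le> tensor_const a D * (\<Sum>v\<in>V. ?E (ent {v} f))"
    by (rule approximate_tensorization[OF subset_refl \<tau> f])
  also have "\<dots> \<le> tensor_const a D * (\<Sum>v\<in>V. ?E (\<lambda>\<sigma>. f \<sigma> * (?l \<sigma> - av {v} ?l \<sigma>)))"
    using single K by (intro mult_left_mono sum_mono) auto
  also have "(\<Sum>v\<in>V. ?E (\<lambda>\<sigma>. f \<sigma> * (?l \<sigma> - av {v} ?l \<sigma>))) = ?E (\<lambda>\<sigma>. card V * (f \<sigma> * (?l \<sigma> - chain_op ?l \<sigma>)))"
    unfolding av_sum[symmetric]
  proof (rule av_cong)
    fix \<sigma> assume "\<sigma> \<in> block V \<tau>"
    hence "chain_op ?l \<sigma> = (\<Sum>v\<in>V. av {v} ?l \<sigma>) / card V" using block_subset by (intro chain_op_eq_av) auto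
    moreover have "(\<Sum>v\<in>V. f \<sigma> * (?l \<sigma> - av {v} ?l \<sigma>)) = f \<sigma> * (card V * ?l \<sigma> - (\<Sum>v\<in>V. av {v} ?l \<sigma>))"
      by (simp add: sum_distrib_left[symmetric] sum_subtractf)
    ultimately show "(\<Sum>v\<in>V. f \<sigma> * (?l \<sigma> - av {v} ?l \<sigma>)) = card V * (f \<sigma> * (?l \<sigma> - chain_op ?l \<sigma>))"
      using card_V_ge_1 by (simp add: field_simps)
  qed
  also have "\<dots> = card V * ?E (\<lambda>\<sigma>. f \<sigma> * (?l \<sigma> - chain_op ?l \<sigma>))" by (rule av_cmult)
  finally show ?thesis using K card_V_ge_1 by (simp add: divide_le_eq mult_ac)
qed

text \<open>A log-Sobolev inequality for resampling a whole block, with constant linear in its size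
  where the true order is logarithmic. By ln x \<le> x - 1 the entropy is at most the variance of
  \<open>f\<close> over its mean \<open>h\<close>. Centering at \<open>G\<^sup>2\<close> instead
  lets the difference factor as (g - G)(g + G), and the square of g + G is at most
  \<open>4 * m * h\<close> because a nonnegative function is at most \<open>m\<close> times its
  mean.\<close>

lemma ent_single_le_variance:
  assumes \<sigma>: "\<sigma> \<in> colorings" and f: "\<And>\<eta>. \<eta> \<in> block U \<sigma> \<Longrightarrow> 0 \<le> f \<eta>"
  defines "g \<equiv> \<lambda>\<eta>. sqrt (f \<eta>)"
  shows "ent U f \<sigma> \<le> 4 * card (block U \<sigma>) * (av U f \<sigma> - (av U g \<sigma>)\<^sup>2)"
proof -
  define h where "h = av U f \<sigma>"
  define G where "G = av U g \<sigma>"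
  define m where "m = real (card (block U \<sigma>))"
  let ?E = "\<lambda>k. av U k \<sigma>"
  have m: "0 < m" unfolding m_def by (rule card_block_pos[OF \<sigma>])
  hence m1: "1 \<le> m" by (simp add: m_def Suc_le_eq)
  have h: "0 \<le> h" unfolding h_def by (rule av_nonneg[OF f])
  have G: "0 \<le> G" unfolding G_def g_def using f by (intro av_nonneg) auto
  have g2: "(g \<eta>)\<^sup>2 = f \<eta>" "0 \<le> g \<eta>" if "\<eta> \<in> block U \<sigma>" for \<eta> using f[OF that] by (simp_all add: g_def)
  have var: "?E (\<lambda>\<eta>. (g \<eta> - G)\<^sup>2) = h - G\<^sup>2"
  proof -
    have "?E (\<lambda>\<eta>. (g \<eta> - G)\<^sup>2) = ?E (\<lambda>\<eta>. (f \<eta> - (2 * G) * g \<eta>) + G\<^sup>2)"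
      by (rule av_cong) (simp add: power2_diff g2)
    also have "\<dots> = h - G\<^sup>2" unfolding av_add av_diff av_cmult av_const[OF \<sigma>] h_def G_def
      by (simp add: power2_eq_square)
    finally show ?thesis .
  qed
  have "0 \<le> ?E (\<lambda>\<eta>. (g \<eta> - G)\<^sup>2)" by (rule av_nonneg) simp
  hence Gh: "G\<^sup>2 \<le> h" using var by simp
  show ?thesis
  proof (cases "h = 0")
    case True
    have "f \<eta> = 0" if \<eta>: "\<eta> \<in> block U \<sigma>" for \<eta>
    proof (rule ccontr)
      assume "f \<eta> \<noteq> 0"
      hence "0 < h" unfolding h_def using f[OF \<eta>] by (intro av_pos[OF \<sigma> f \<eta>]) auto
      thus False using True by simp
    qed
    thus ?thesis using Gh m by (simp add: ent_zero h_def[symmetric] G_def[symmetric] m_def[symmetric])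
  next
    case False
    hence h0: "0 < h" using h by simp
    have fm: "f \<eta> \<le> m * h" if "\<eta> \<in> block U \<sigma>" for \<eta>
    proof -
      have "f \<eta> \<le> sum f (block U \<sigma>)" using that f finite_block by (intro member_le_sum) auto
      also have "\<dots> = m * h" using m by (simp add: h_def av_def m_def)
      finally show ?thesis .
    qed
    have "?E (\<lambda>\<eta>. f \<eta> * ln (f \<eta>)) \<le> ?E (\<lambda>\<eta>. ln h * f \<eta> + ((f \<eta> - G\<^sup>2)\<^sup>2 / h + (2 * G\<^sup>2 / h - 1) * f \<eta> - G\<^sup>2 * G\<^sup>2 / h))"
    proof (rule av_mono)
      fix \<eta> assume \<eta>: "\<eta> \<in> block U \<sigma>"
      have "f \<eta> * ln (f \<eta>) \<le> ln h * f \<eta> + (f \<eta> * f \<eta> / h - f \<eta>)"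
      proof (cases "f \<eta> = 0")
        case True thus ?thesis by simp
      next
        case False
        hence fp: "0 < f \<eta>" using f[OF \<eta>] by simp
        have "ln (f \<eta> / h) \<le> f \<eta> / h - 1" using fp h0 by (intro ln_le_minus_one) auto
        hence "f \<eta> * ln (f \<eta> / h) \<le> f \<eta> * (f \<eta> / h - 1)" using fp by (intro mult_left_mono) auto
        thus ?thesis using fp h0 by (simp add: ln_div algebra_simps)
      qed
      also have "\<dots> = ln h * f \<eta> + ((f \<eta> - G\<^sup>2)\<^sup>2 / h + (2 * G\<^sup>2 / h - 1) * f \<eta> - G\<^sup>2 * G\<^sup>2 / h)"
        using h0 by (simp add: field_simps power2_eq_square)
      finally show "f \<eta> * ln (f \<eta>) \<le> \<dots>" .
    qed
    also have "\<dots> = ln h * h + (?E (\<lambda>\<eta>. (f \<eta> - G\<^sup>2)\<^sup>2) / h + (2 * G\<^sup>2 / h - 1) * h - G\<^sup>2 * G\<^sup>2 / h)"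
    proof -
      have "?E (\<lambda>\<eta>. (f \<eta> - G\<^sup>2)\<^sup>2 / h) = ?E (\<lambda>\<eta>. (f \<eta> - G\<^sup>2)\<^sup>2) / h"
        using av_cmult[of U "1 / h" "\<lambda>\<eta>. (f \<eta> - G\<^sup>2)\<^sup>2" \<sigma>] by simp
      thus ?thesis by (simp only: av_add av_diff av_cmult av_const[OF \<sigma>] h_def[symmetric])
    qed
    \<comment> \<open>The dropped term is what centering at the mean \<open>h\<close> would gain
      over centering at \<open>G\<^sup>2\<close>, so it has the right sign.\<close>
    also have "\<dots> \<le> ln h * h + ?E (\<lambda>\<eta>. (f \<eta> - G\<^sup>2)\<^sup>2) / h"
    proof -
      have "(2 * G\<^sup>2 / h - 1) * h - G\<^sup>2 * G\<^sup>2 / h = - ((h - G\<^sup>2)\<^sup>2 / h)"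
        using h0 by (simp add: field_simps power2_eq_square)
      also have "\<dots> \<le> 0" using h0 by simp
      finally show ?thesis by simp
    qed
    finally have "ent U f \<sigma> \<le> ?E (\<lambda>\<eta>. (f \<eta> - G\<^sup>2)\<^sup>2) / h" unfolding ent_def h_def[symmetric] by (simp add: mult.commute)
    also have "?E (\<lambda>\<eta>. (f \<eta> - G\<^sup>2)\<^sup>2) \<le> ?E (\<lambda>\<eta>. (4 * m * h) * (g \<eta> - G)\<^sup>2)"
    proof (rule av_mono)
      fix \<eta> assume \<eta>: "\<eta> \<in> block U \<sigma>"
      have "(g \<eta> + G)\<^sup>2 \<le> 2 * (g \<eta>)\<^sup>2 + 2 * G\<^sup>2"
        using zero_le_power2[of "g \<eta> - G"] by (simp add: power2_sum power2_diff)
      also have "\<dots> \<le> 4 * m * h"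
        using fm[OF \<eta>] Gh mult_right_mono[OF m1 h] by (simp add: g2[OF \<eta>])
      finally have le: "(g \<eta> + G)\<^sup>2 \<le> 4 * m * h" .
      have "(f \<eta> - G\<^sup>2)\<^sup>2 = (g \<eta> + G)\<^sup>2 * (g \<eta> - G)\<^sup>2"
        unfolding g2(1)[OF \<eta>, symmetric] by (simp add: power2_eq_square algebra_simps)
      also have "\<dots> \<le> (4 * m * h) * (g \<eta> - G)\<^sup>2" by (intro mult_right_mono le) simp
      finally show "(f \<eta> - G\<^sup>2)\<^sup>2 \<le> (4 * m * h) * (g \<eta> - G)\<^sup>2" .
    qed
    also have "?E (\<lambda>\<eta>. (4 * m * h) * (g \<eta> - G)\<^sup>2) = 4 * m * h * (h - G\<^sup>2)" by (simp only: av_cmult var)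
    finally show ?thesis using h0 by (simp add: divide_right_mono h_def[symmetric] G_def[symmetric] m_def[symmetric])
  qed
qed

text \<open>An upper bound on the list sizes enters here, through the size of single-vertex blocks.
  The mean variances of \<open>g\<close> on these blocks add up to n times the Dirichlet
  form.\<close>

lemma dirichlet_sqrt_ge:
  assumes \<tau>: "\<tau> \<in> colorings" and f: "\<And>\<sigma>. \<sigma> \<in> colorings \<Longrightarrow> 0 \<le> f \<sigma>"
    and q: "\<And>v. v \<in> V \<Longrightarrow> card (L v) \<le> q"
  defines "g \<equiv> \<lambda>\<sigma>. sqrt (f \<sigma>)"
  shows "ent V f \<tau> / (tensor_const a D * (4 * q) * card V) \<le> av V (\<lambda>\<sigma>. g \<sigma> * (g \<sigma> - chain_op g \<sigma>)) \<tau>"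
proof -
  let ?E = "\<lambda>h. av V h \<tau>"
  note K = tensor_const_pos[of a D]
  have q0: "0 < q"
  proof -
    obtain v where v: "v \<in> V" using V_nonempty by auto
    thus ?thesis using q[OF v] card_L[OF v] a_gt_1 by linarith
  qed
  have single: "?E (ent {v} f) \<le> (4 * q) * ?E (\<lambda>\<sigma>. g \<sigma> * (g \<sigma> - av {v} g \<sigma>))" if v: "v \<in> V" for v
  proof -
    have vV: "{v} \<subseteq> V" using v by simp
    have "?E (ent {v} f) \<le> ?E (\<lambda>\<sigma>. (4 * q) * (av {v} f \<sigma> - av {v} g \<sigma> * av {v} g \<sigma>))"
    proof (rule av_mono)
      fix \<sigma> assume "\<sigma> \<in> block V \<tau>"
      hence \<sigma>: "\<sigma> \<in> colorings" using block_subset by auto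
      have cb: "card (block {v} \<sigma>) \<le> q"
      proof -
        have "card (block {v} \<sigma>) \<le> card (avail \<sigma> v)"
          unfolding block_single[OF \<sigma> v] by (rule card_image_le[OF finite_avail[OF v]])
        also have "\<dots> \<le> card (L v)" by (rule card_mono[OF finite_L[OF v] avail_subset])
        finally show ?thesis using q[OF v] by simp
      qed
      have nn: "0 \<le> av {v} f \<sigma> - (av {v} g \<sigma>)\<^sup>2"
      proof -
        have "(av {v} (\<lambda>\<eta>. 1 * g \<eta>) \<sigma>)\<^sup>2 \<le> av {v} (\<lambda>\<eta>. 1\<^sup>2) \<sigma> * av {v} (\<lambda>\<eta>. (g \<eta>)\<^sup>2) \<sigma>"
          by (rule av_Cauchy_Schwarz)
        moreover have "av {v} (\<lambda>\<eta>. (g \<eta>)\<^sup>2) \<sigma> = av {v} f \<sigma>"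
          using f block_subset unfolding g_def by (intro av_cong) auto
        ultimately show ?thesis by (simp add: av_const[OF \<sigma>])
      qed
      have "ent {v} f \<sigma> \<le> 4 * card (block {v} \<sigma>) * (av {v} f \<sigma> - (av {v} g \<sigma>)\<^sup>2)"
        unfolding g_def using f block_subset by (intro ent_single_le_variance[OF \<sigma>]) auto
      also have "\<dots> \<le> 4 * q * (av {v} f \<sigma> - (av {v} g \<sigma>)\<^sup>2)"
        using cb nn by (intro mult_right_mono) auto
      finally show "ent {v} f \<sigma> \<le> (4 * q) * (av {v} f \<sigma> - av {v} g \<sigma> * av {v} g \<sigma>)"
        by (simp add: power2_eq_square)
    qed
    also have "\<dots> = (4 * q) * (?E f - ?E (\<lambda>\<sigma>. av {v} g \<sigma> * g \<sigma>))"
    proof -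
      have "?E (\<lambda>\<sigma>. av {v} g \<sigma> * g \<sigma>) = ?E (\<lambda>\<sigma>. av {v} g \<sigma> * av {v} g \<sigma>)"
        by (rule av_inv[OF vV]) (simp add: av_eq)
      thus ?thesis by (simp only: av_cmult av_diff av_tower[OF vV])
    qed
    also have "?E f - ?E (\<lambda>\<sigma>. av {v} g \<sigma> * g \<sigma>) = ?E (\<lambda>\<sigma>. g \<sigma> * (g \<sigma> - av {v} g \<sigma>))"
      unfolding av_diff[symmetric] using f block_subset
      by (intro av_cong) (auto simp: g_def algebra_simps subset_iff)
    finally show ?thesis .
  qed
  have "ent V f \<tau> \<le> tensor_const a D * (\<Sum>v\<in>V. ?E (ent {v} f))"
    by (rule approximate_tensorization[OF subset_refl \<tau> f])
  also have "\<dots> \<le> tensor_const a D * (\<Sum>v\<in>V. (4 * q) * ?E (\<lambda>\<sigma>. g \<sigma> * (g \<sigma> - av {v} g \<sigma>)))"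
    using single K by (intro mult_left_mono sum_mono) auto
  also have "\<dots> = tensor_const a D * (4 * q) * (\<Sum>v\<in>V. ?E (\<lambda>\<sigma>. g \<sigma> * (g \<sigma> - av {v} g \<sigma>)))"
    by (simp add: sum_distrib_left[symmetric])
  also have "(\<Sum>v\<in>V. ?E (\<lambda>\<sigma>. g \<sigma> * (g \<sigma> - av {v} g \<sigma>))) = ?E (\<lambda>\<sigma>. card V * (g \<sigma> * (g \<sigma> - chain_op g \<sigma>)))"
    unfolding av_sum[symmetric]
  proof (rule av_cong)
    fix \<sigma> assume "\<sigma> \<in> block V \<tau>"
    hence "chain_op g \<sigma> = (\<Sum>v\<in>V. av {v} g \<sigma>) / card V" using block_subset by (intro chain_op_eq_av) auto
    moreover have "(\<Sum>v\<in>V. g \<sigma> * (g \<sigma> - av {v} g \<sigma>)) = g \<sigma> * (card V * g \<sigma> - (\<Sum>v\<in>V. av {v} g \<sigma>))"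
      by (simp add: sum_distrib_left[symmetric] sum_subtractf)
    ultimately show "(\<Sum>v\<in>V. g \<sigma> * (g \<sigma> - av {v} g \<sigma>)) = card V * (g \<sigma> * (g \<sigma> - chain_op g \<sigma>))"
      using card_V_ge_1 by (simp add: field_simps)
  qed
  also have "\<dots> = card V * ?E (\<lambda>\<sigma>. g \<sigma> * (g \<sigma> - chain_op g \<sigma>))" by (rule av_cmult)
  finally show ?thesis using K q0 card_V_ge_1 by (simp add: divide_le_eq mult_ac)
qed

section \<open>The kernel and its functional inequalities\<close>

definition kernel :: "('v \<Rightarrow> 'c) \<Rightarrow> ('v \<Rightarrow> 'c) pmf" where
  "kernel \<sigma> = do {
     v \<leftarrow> pmf_of_set V;
     c \<leftarrow> pmf_of_set (avail \<sigma> v);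
     return_pmf (\<sigma>(v := c))
   }"

lemma set_pmf_kernel: "set_pmf (kernel \<sigma>) = (\<Union>v\<in>V. (\<lambda>c. \<sigma>(v := c)) ` avail \<sigma> v)"
  unfolding kernel_def using finite_V V_nonempty finite_avail avail_nonempty
  by (auto simp: set_pmf_of_set)

lemma finite_set_pmf_kernel: "finite (set_pmf (kernel \<sigma>))"
  unfolding set_pmf_kernel using finite_V finite_avail by auto

lemma set_pmf_kernel_coloring:
  "\<sigma> \<in> colorings \<Longrightarrow> set_pmf (kernel \<sigma>) = (\<Union>v\<in>V. block {v} \<sigma>)"
  unfolding set_pmf_kernel by (simp add: block_single)

lemma expectation_kernel: "measure_pmf.expectation (kernel \<sigma>) g = chain_op g \<sigma>"
proof -
  have "measure_pmf.expectation (pmf_of_set (avail \<sigma> v) \<bind> (\<lambda>c. return_pmf (\<sigma>(v := c)))) g = resample v g \<sigma>"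
    if v: "v \<in> V" for v
    using finite_avail[OF v] avail_nonempty[OF v]
    by (subst pmf_expectation_bind_pmf_of_set) (auto simp: resample_def divide_inverse sum_distrib_left mult.commute)
  thus ?thesis
    unfolding kernel_def using finite_V V_nonempty finite_avail avail_nonempty
    by (subst pmf_expectation_bind_pmf_of_set) (auto simp: chain_op_def divide_inverse sum_distrib_left mult.commute set_pmf_of_set)
qed

abbreviation stationary :: "('v \<Rightarrow> 'c) pmf" where
  "stationary \<equiv> pmf_of_set colorings"

lemma set_pmf_stationary: "set_pmf stationary = colorings"
  by (simp add: set_pmf_of_set colorings_nonempty finite_colorings)

lemma expectation_stationary:
  "\<tau> \<in> colorings \<Longrightarrow> measure_pmf.expectation stationary g = av V g \<tau>"
  by (simp add: integral_pmf_of_set colorings_nonempty finite_colorings av_def block_V)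

lemma dirichlet_form_eq:
  assumes "\<tau> \<in> colorings"
  shows "dirichlet_form stationary kernel \<phi> \<psi> = av V (\<lambda>\<sigma>. \<phi> \<sigma> * (\<psi> \<sigma> - chain_op \<psi> \<sigma>)) \<tau>"
  unfolding dirichlet_form_def expectation_kernel by (rule expectation_stationary[OF assms])

lemma entropy_functional_eq: "\<tau> \<in> colorings \<Longrightarrow> entropy_functional stationary f = ent V f \<tau>"
  by (simp add: entropy_functional_def expectation_stationary ent_def)

lemma spectral_gap_ge: "ereal (1 / (2 * card V)) \<le> spectral_gap stationary kernel"
proof -
  obtain \<tau> where \<tau>: "\<tau> \<in> colorings" using colorings_nonempty by auto
  show ?thesis
    unfolding spectral_gap_def
  proof (rule INF_greatest)
    fix f :: "('v \<Rightarrow> 'c) \<Rightarrow> real"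
    assume "f \<in> {f. measure_pmf.variance stationary f \<noteq> 0}"
    hence "measure_pmf.variance stationary f \<noteq> 0" by simp
    moreover have "0 \<le> measure_pmf.variance stationary f"
      by (rule Bochner_Integration.integral_nonneg) simp
    ultimately have pos: "0 < measure_pmf.variance stationary f" by (rule le_neq_trans[OF _ not_sym, rotated])
    have "measure_pmf.variance stationary f / (2 * card V) \<le> dirichlet_form stationary kernel f f"
      using dirichlet_ge_variance[OF \<tau>, of f] by (simp add: dirichlet_form_eq[OF \<tau>] expectation_stationary[OF \<tau>])
    hence "1 / (2 * card V) \<le> dirichlet_form stationary kernel f f / measure_pmf.variance stationary f"
      using pos card_V_ge_1 by (simp add: field_simps)
    thus "ereal (1 / (2 * card V)) \<le> ereal (dirichlet_form stationary kernel f f / measure_pmf.variance stationary f)"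
      by simp
  qed
qed

lemma modified_log_sobolev_ge: "ereal (1 / tensor_const a D / card V) \<le> modified_log_sobolev stationary kernel"
proof -
  obtain \<tau> where \<tau>: "\<tau> \<in> colorings" using colorings_nonempty by auto
  show ?thesis
    unfolding modified_log_sobolev_def
  proof (rule INF_greatest)
    fix f :: "('v \<Rightarrow> 'c) \<Rightarrow> real"
    assume "f \<in> {f. (\<forall>x\<in>set_pmf stationary. 0 \<le> f x) \<and> entropy_functional stationary f \<noteq> 0}"
    hence f: "\<And>\<sigma>. \<sigma> \<in> colorings \<Longrightarrow> 0 \<le> f \<sigma>" and ne: "ent V f \<tau> \<noteq> 0"
      by (auto simp: set_pmf_stationary entropy_functional_eq[OF \<tau>])
    have "0 \<le> ent V f \<tau>" using f block_subset by (intro ent_nonneg[OF \<tau>]) auto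
    hence pos: "0 < ent V f \<tau>" using ne by simp
    show "ereal (1 / tensor_const a D / card V) \<le>
      dirichlet_log stationary kernel f / ereal (entropy_functional stationary f)"
    proof (cases "\<exists>x\<in>set_pmf stationary. \<exists>y\<in>set_pmf (kernel x). 0 < f x \<and> f y = 0")
      case True
      \<comment> \<open>The form is \<open>\<infinity>\<close> here, and so is its quotient by a
        positive real.\<close>
      thus ?thesis using pos by (simp add: dirichlet_log_def entropy_functional_eq[OF \<tau>])
    next
      case False
      have "ent V f \<tau> / (tensor_const a D * card V) \<le> av V (\<lambda>\<sigma>. f \<sigma> * (ln (f \<sigma>) - chain_op (\<lambda>\<eta>. ln (f \<eta>)) \<sigma>)) \<tau>"
      proof (rule dirichlet_log_ge[OF \<tau> f])
        fix \<sigma> v \<eta> assume "\<sigma> \<in> colorings" "v \<in> V" "\<eta> \<in> block {v} \<sigma>" "0 < f \<sigma>"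
        thus "f \<eta> \<noteq> 0" using False by (auto simp: set_pmf_stationary set_pmf_kernel_coloring)
      qed
      hence "1 / tensor_const a D / card V \<le> dirichlet_form stationary kernel f (\<lambda>\<eta>. ln (f \<eta>)) / ent V f \<tau>"
        using pos tensor_const_pos card_V_ge_1 by (simp add: dirichlet_form_eq[OF \<tau>] field_simps)
      moreover have "dirichlet_log stationary kernel f = ereal (dirichlet_form stationary kernel f (\<lambda>\<eta>. ln (f \<eta>)))"
        using False by (simp only: dirichlet_log_def if_False)
      ultimately show ?thesis using ne by (simp add: entropy_functional_eq[OF \<tau>])
    qed
  qed
qed

text \<open>The summand 1 slightly weakens the bound; it keeps the constant positive at
  \<open>q = 0\<close>, as the theorem asks for all \<open>q\<close>.\<close>

lemma standard_log_sobolev_ge: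
  assumes q: "\<And>v. v \<in> V \<Longrightarrow> card (L v) \<le> q"
  shows "ereal (1 / (tensor_const a D * (4 * q + 1)) / card V) \<le> standard_log_sobolev stationary kernel"
proof -
  obtain \<tau> where \<tau>: "\<tau> \<in> colorings" using colorings_nonempty by auto
  have q0: "0 < q"
  proof -
    obtain v where v: "v \<in> V" using V_nonempty by auto
    thus ?thesis using q[OF v] card_L[OF v] a_gt_1 by linarith
  qed
  show ?thesis
    unfolding standard_log_sobolev_def
  proof (rule INF_greatest)
    fix f :: "('v \<Rightarrow> 'c) \<Rightarrow> real"
    assume "f \<in> {f. (\<forall>x\<in>set_pmf stationary. 0 \<le> f x) \<and> entropy_functional stationary f \<noteq> 0}"
    hence f: "\<And>\<sigma>. \<sigma> \<in> colorings \<Longrightarrow> 0 \<le> f \<sigma>" and ne: "ent V f \<tau> \<noteq> 0"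
      by (auto simp: set_pmf_stationary entropy_functional_eq[OF \<tau>])
    have "0 \<le> ent V f \<tau>" using f block_subset by (intro ent_nonneg[OF \<tau>]) auto
    hence pos: "0 < ent V f \<tau>" using ne by simp
    let ?D = "dirichlet_form stationary kernel (\<lambda>x. sqrt (f x)) (\<lambda>x. sqrt (f x))"
    have "ent V f \<tau> / (tensor_const a D * (4 * q) * card V) \<le> ?D"
      unfolding dirichlet_form_eq[OF \<tau>] by (rule dirichlet_sqrt_ge[OF \<tau> f q])
    hence "1 / (tensor_const a D * (4 * q) * card V) \<le> ?D / ent V f \<tau>"
      using pos tensor_const_pos card_V_ge_1 q0 by (simp add: field_simps)
    moreover have "1 / (tensor_const a D * (4 * q + 1)) / card V \<le> 1 / (tensor_const a D * (4 * q) * card V)"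
      using tensor_const_pos card_V_ge_1 q0 unfolding divide_divide_eq_left
      by (intro divide_left_mono mult_right_mono mult_left_mono mult_pos_pos) (auto intro: less_imp_le)
    ultimately have "1 / (tensor_const a D * (4 * q + 1)) / card V \<le> ?D / ent V f \<tau>" by linarith
    thus "ereal (1 / (tensor_const a D * (4 * q + 1)) / card V) \<le> ereal (?D / entropy_functional stationary f)"
      by (simp add: entropy_functional_eq[OF \<tau>])
  qed
qed

section \<open>Mixing time\<close>

lemma chain_law_support:
  assumes "set_pmf \<mu> \<subseteq> colorings"
  shows "set_pmf (chain_law kernel \<mu> t) \<subseteq> colorings"
proof (induction t)
  case 0
  thus ?case using assms by (simp add: chain_law_def)
next
  case (Suc t)
  have "chain_law kernel \<mu> (Suc t) = bind_pmf (chain_law kernel \<mu> t) kernel" by (simp add: chain_law_def)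
  moreover have "set_pmf (kernel \<sigma>) \<subseteq> colorings" if "\<sigma> \<in> colorings" for \<sigma>
    unfolding set_pmf_kernel_coloring[OF that] using block_subset by auto
  ultimately show ?case using Suc by auto
qed

lemma expectation_chain_law:
  assumes \<mu>: "set_pmf \<mu> \<subseteq> colorings"
  shows "measure_pmf.expectation (chain_law kernel \<mu> t) g = measure_pmf.expectation \<mu> ((chain_op ^^ t) g)"
proof (induction t arbitrary: g)
  case 0
  thus ?case by (simp add: chain_law_def)
next
  case (Suc t)
  let ?\<nu> = "chain_law kernel \<mu> t"
  note sup = chain_law_support[OF \<mu>, of t]
  have "measure_pmf.expectation (chain_law kernel \<mu> (Suc t)) g = measure_pmf.expectation (bind_pmf ?\<nu> kernel) g"
    by (simp add: chain_law_def)
  also have "\<dots> = (\<Sum>\<sigma>\<in>colorings. pmf ?\<nu> \<sigma> *\<^sub>R measure_pmf.expectation (kernel \<sigma>) g)"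
    by (rule pmf_expectation_bind[OF finite_colorings finite_set_pmf_kernel sup])
  also have "\<dots> = measure_pmf.expectation ?\<nu> (chain_op g)"
    using sup by (subst integral_measure_pmf[OF finite_colorings]) (auto simp: expectation_kernel)
  also have "\<dots> = measure_pmf.expectation \<mu> ((chain_op ^^ Suc t) g)"
    unfolding Suc by (simp add: funpow_swap1)
  finally show ?case .
qed

text \<open>Every event is tested through its indicator, whose oscillations are at most 1; duality
  moves the \<open>t\<close> steps from the law to the indicator.\<close>

lemma total_variation_le:
  assumes \<mu>: "set_pmf \<mu> \<subseteq> colorings"
  shows "total_variation_distance (chain_law kernel \<mu> t) stationary \<le> card V * contraction ^ t"
  unfolding total_variation_distance_def
proof (rule cSUP_least)
  fix A :: "('v \<Rightarrow> 'c) set"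
  obtain \<tau> where \<tau>: "\<tau> \<in> colorings" using colorings_nonempty by auto
  let ?I = "indicator A :: ('v \<Rightarrow> 'c) \<Rightarrow> real" and ?b = "card V * contraction ^ t"
  have osc: "osc_le ?I (\<lambda>_. 1)" by (auto simp: osc_le_def indicator_def)
  define h where "h = (chain_op ^^ t) ?I"
  define c where "c = av V ?I \<tau>"
  have h: "\<bar>h \<sigma> - c\<bar> \<le> ?b" if "\<sigma> \<in> colorings" for \<sigma>
    using chain_op_iterate_mean_le[OF osc _ that \<tau>, of t] by (simp add: h_def c_def)
  have one: "(\<Sum>\<sigma>\<in>colorings. pmf \<mu> \<sigma>) = 1" by (rule sum_pmf_eq_1[OF finite_colorings \<mu>])
  have "measure_pmf.prob (chain_law kernel \<mu> t) A = measure_pmf.expectation (chain_law kernel \<mu> t) ?I" by simp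
  also have "\<dots> = measure_pmf.expectation \<mu> h" unfolding h_def by (rule expectation_chain_law[OF \<mu>])
  also have "\<dots> = (\<Sum>\<sigma>\<in>colorings. pmf \<mu> \<sigma> * h \<sigma>)"
    using \<mu> by (subst integral_measure_pmf[OF finite_colorings]) auto
  finally have 1: "measure_pmf.prob (chain_law kernel \<mu> t) A = (\<Sum>\<sigma>\<in>colorings. pmf \<mu> \<sigma> * h \<sigma>)" .
  have 2: "measure_pmf.prob stationary A = c"
    using expectation_stationary[OF \<tau>, of ?I] by (simp add: c_def)
  have "(\<Sum>\<sigma>\<in>colorings. pmf \<mu> \<sigma> * h \<sigma>) - c = (\<Sum>\<sigma>\<in>colorings. pmf \<mu> \<sigma> * (h \<sigma> - c))"
    using one by (simp add: right_diff_distrib sum_subtractf sum_distrib_right[symmetric])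
  moreover have "\<bar>\<Sum>\<sigma>\<in>colorings. pmf \<mu> \<sigma> * (h \<sigma> - c)\<bar> \<le> (\<Sum>\<sigma>\<in>colorings. pmf \<mu> \<sigma> * ?b)"
    using h by (intro order_trans[OF sum_abs] sum_mono) (auto simp: abs_mult intro!: mult_left_mono)
  moreover have "(\<Sum>\<sigma>\<in>colorings. pmf \<mu> \<sigma> * ?b) = ?b" using one by (simp add: sum_distrib_right[symmetric])
  ultimately show "\<bar>measure_pmf.prob (chain_law kernel \<mu> t) A - measure_pmf.prob stationary A\<bar> \<le> ?b"
    unfolding 1 2 by simp
qed simp

text \<open>At time 8 n^2 the distance is at most n exp(-4n), and this is at most 1/4 because 4n
  \<le> exp(4n).\<close>

lemma mixing_time_le: "mixing_time stationary kernel \<le> enat (8 * (card V)\<^sup>2)"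
  unfolding mixing_time_def
proof (rule INF_lower, intro CollectI allI impI)
  fix \<mu> :: "('v \<Rightarrow> 'c) pmf" assume "set_pmf \<mu> \<subseteq> set_pmf stationary"
  hence \<mu>: "set_pmf \<mu> \<subseteq> colorings" by (simp add: set_pmf_stationary)
  define n where "n = real (card V)"
  let ?t = "8 * (card V)\<^sup>2"
  have n: "1 \<le> n" using card_V_ge_1 by (simp add: n_def)
  have "contraction ^ ?t \<le> exp (- 1 / (2 * n)) ^ ?t"
    using contraction_bounds exp_ge_add_one_self[of "- 1 / (2 * n)"]
    by (intro power_mono) (auto simp: contraction_def n_def)
  also have "\<dots> = exp (- (4 * n))"
    using n by (simp add: exp_of_nat_mult[symmetric] n_def[symmetric] power2_eq_square)
  finally have "n * contraction ^ ?t \<le> n * exp (- (4 * n))" using n by (intro mult_left_mono) auto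
  also have "\<dots> \<le> 1 / 4"
  proof -
    have "4 * n \<le> exp (4 * n)" using exp_ge_add_one_self[of "4 * n"] by linarith
    thus ?thesis by (simp add: exp_minus field_simps)
  qed
  finally show "total_variation_distance (chain_law kernel \<mu> ?t) stationary \<le> 1 / 4"
    using total_variation_le[OF \<mu>, of ?t] by (simp add: n_def)
qed

end

text \<open>From ln 2 \<ge> 2/3 the condition gives \<epsilon>^2 \<Delta> \<ge> 400/9 > 16.
  Multiplying by \<Delta> and taking roots gives the second bound, which implies the first as sqrt
  \<Delta> \<ge> 1.\<close>

lemma list_size_excess_bounds:
  fixes \<epsilon> :: real and \<Delta> :: nat
  assumes "2 \<le> \<Delta>" "0 < \<epsilon>" and cond: "(ln (real \<Delta>))\<^sup>2 / real \<Delta> \<le> \<epsilon>\<^sup>2 / 100"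
  shows "1 < \<epsilon> * real \<Delta>" "4 * sqrt (real \<Delta>) \<le> \<epsilon> * real \<Delta>"
proof -
  have \<Delta>: "2 \<le> real \<Delta>" using assms by simp
  have "2 / 3 \<le> ln (2::real)" by (rule ln2_ge_two_thirds)
  also have "\<dots> \<le> ln (real \<Delta>)" using \<Delta> by simp
  finally have "(2 / 3)\<^sup>2 \<le> (ln (real \<Delta>))\<^sup>2" by (intro power_mono) auto
  moreover have "(ln (real \<Delta>))\<^sup>2 \<le> \<epsilon>\<^sup>2 / 100 * real \<Delta>" using cond \<Delta> by (simp add: divide_simps)
  ultimately have "16 \<le> \<epsilon>\<^sup>2 * real \<Delta>" by (simp add: power2_eq_square)
  hence "16 * real \<Delta> \<le> (\<epsilon>\<^sup>2 * real \<Delta>) * real \<Delta>" using \<Delta> by (intro mult_right_mono) auto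
  moreover have "(4 * sqrt (real \<Delta>))\<^sup>2 = 16 * real \<Delta>" by (simp add: power_mult_distrib)
  moreover have "(\<epsilon> * real \<Delta>)\<^sup>2 = (\<epsilon>\<^sup>2 * real \<Delta>) * real \<Delta>" by (simp add: power2_eq_square)
  ultimately have "(4 * sqrt (real \<Delta>))\<^sup>2 \<le> (\<epsilon> * real \<Delta>)\<^sup>2" by linarith
  thus le: "4 * sqrt (real \<Delta>) \<le> \<epsilon> * real \<Delta>"
    by (rule power2_le_imp_le) (use assms in auto)
  have "1 \<le> sqrt (real \<Delta>)" using \<Delta> by simp
  thus "1 < \<epsilon> * real \<Delta>" using le by linarith
qed

section \<open>From undirected trees to coloring instances\<close>

lemma degree_of_eq: "degree_of G v = card {u. (v, u) \<in> parcs G}"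
proof -
  have "out_arcs (with_proj G) v = Pair v ` {u. (v, u) \<in> parcs G}"
    by (auto simp: out_arcs_def)
  thus ?thesis unfolding out_degree_def by (simp add: card_image inj_on_def)
qed

lemma undirected_tree_coloring_instance:
  assumes T: "undirected_tree G" and \<Delta>: "\<Delta> = max_degree G" "2 \<le> \<Delta>" and \<epsilon>: "0 < \<epsilon>"
    and cond: "(ln (real \<Delta>))\<^sup>2 / real \<Delta> \<le> \<epsilon>\<^sup>2 / 100"
    and L: "\<forall>v\<in>pverts G. finite (L v) \<and> real (card (L v)) \<ge> real (degree_of G v) + \<epsilon> * real \<Delta>"
  obtains p where "coloring_instance (pverts G) (\<lambda>v. {u. (v, u) \<in> parcs G}) L (\<epsilon> * \<Delta>) \<Delta> p"
proof -
  interpret pair_graph G using T by (simp add: undirected_tree_def)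
  obtain p where p: "\<forall>u v. (u, v) \<in> parcs G \<longrightarrow> u = p v \<or> v = p u" using undirected_tree_parent[OF T] by blast
  have "coloring_instance (pverts G) (\<lambda>v. {u. (v, u) \<in> parcs G}) L (\<epsilon> * \<Delta>) \<Delta> p"
  proof
    show "finite (pverts G)" by (rule pair_finite_verts)
    show "pverts G \<noteq> {}"
      using T by (auto simp: undirected_tree_def connected_def strongly_connected_def mk_symmetric_def)
    show "{u. (v, u) \<in> parcs G} \<subseteq> pverts G" for v using in_arcsD2 by auto
    show "v \<in> {v. (u, v) \<in> parcs G}" if "u \<in> {u. (v, u) \<in> parcs G}" for u v
      using pair_sym_arcs that by (auto simp: symmetric_def sym_def)
    show "v \<notin> {u. (v, u) \<in> parcs G}" for v using pair_no_loops by fastforce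
    show "u = p v \<or> v = p u" if "u \<in> {u. (v, u) \<in> parcs G}" for u v using p that by auto
    show "finite (L v)" if "v \<in> pverts G" for v using L that by auto
    show "real (card {u. (v, u) \<in> parcs G}) + \<epsilon> * real \<Delta> \<le> real (card (L v))" if "v \<in> pverts G" for v
      using L that by (simp add: degree_of_eq)
    show "card {u. (v, u) \<in> parcs G} \<le> \<Delta>" if "v \<in> pverts G" for v
      unfolding \<Delta>(1) max_degree_def degree_of_eq[symmetric] using that pair_finite_verts by (intro Max_ge) auto
    show "1 < \<epsilon> * real \<Delta>" "4 * sqrt (real \<Delta>) \<le> \<epsilon> * real \<Delta>"
      using list_size_excess_bounds[OF \<Delta>(2) \<epsilon> cond] by auto
  qed
  thus thesis using that by blast
qed

theorem theorem1p2:
  shows "\<exists>(c::real) (C::real) (b::real) (B::real)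
      (c_mls :: real \<Rightarrow> nat \<Rightarrow> real) (c_ls :: real \<Rightarrow> nat \<Rightarrow> nat \<Rightarrow> real).
    0 < c \<and> 0 < C \<and> 0 < b \<and> 0 < B \<and>
    (\<forall>\<epsilon> \<Delta>. 0 < c_mls \<epsilon> \<Delta>) \<and> (\<forall>\<epsilon> \<Delta> q. 0 < c_ls \<epsilon> \<Delta> q) \<and>
    (\<forall>(G :: 'v pair_pre_digraph) (L :: 'v \<Rightarrow> 'c set) (n::nat) (\<Delta>::nat) (\<epsilon>::real).
      undirected_tree G \<longrightarrow> n = card (pverts G) \<longrightarrow> \<Delta> = max_degree G \<longrightarrow> 2 \<le> \<Delta> \<longrightarrow>
      0 < \<epsilon> \<longrightarrow> \<epsilon> \<le> 1 \<longrightarrow> (ln (real \<Delta>))\<^sup>2 / real \<Delta> \<le> \<epsilon>\<^sup>2 / 100 \<longrightarrow>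
      (\<forall>v\<in>pverts G. finite (L v) \<and> real (card (L v)) \<ge> real (degree_of G v) + \<epsilon> * real \<Delta>) \<longrightarrow>
      (let \<pi> = coloring_distribution G L; K = glauber G L in
        spectral_gap \<pi> K \<ge> ereal (c * real n powr (- (C / \<epsilon>))) \<and>
        ereal_of_enat (mixing_time \<pi> K) \<le> ereal (b * real n powr (B / \<epsilon>)) \<and>
        modified_log_sobolev \<pi> K \<ge> ereal (c_mls \<epsilon> \<Delta> / real n) \<and>
        standard_log_sobolev \<pi> K \<ge>
          ereal (c_ls \<epsilon> \<Delta> (MAX v\<in>pverts G. card (L v)) / real n)))"
proof -
  define c_mls :: "real \<Rightarrow> nat \<Rightarrow> real" where
    "c_mls \<epsilon> \<Delta> = 1 / tensor_const (\<epsilon> * \<Delta>) \<Delta>" for \<epsilon> \<Delta>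
  define c_ls :: "real \<Rightarrow> nat \<Rightarrow> nat \<Rightarrow> real" where
    "c_ls \<epsilon> \<Delta> q = 1 / (tensor_const (\<epsilon> * \<Delta>) \<Delta> * (4 * q + 1))" for \<epsilon> \<Delta> q
  have c_pos: "0 < c_mls \<epsilon> \<Delta>" "0 < c_ls \<epsilon> \<Delta> q" for \<epsilon> \<Delta> q
    unfolding c_mls_def c_ls_def using tensor_const_pos by (auto intro!: divide_pos_pos mult_pos_pos)
  have bounds: "ereal (1 / 2 * real n powr (- (1 / \<epsilon>))) \<le> spectral_gap (coloring_distribution G L) (glauber G L) \<and>
      ereal_of_enat (mixing_time (coloring_distribution G L) (glauber G L)) \<le> ereal (8 * real n powr (2 / \<epsilon>)) \<and>
      ereal (c_mls \<epsilon> \<Delta> / real n) \<le> modified_log_sobolev (coloring_distribution G L) (glauber G L) \<and>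
      ereal (c_ls \<epsilon> \<Delta> (MAX v\<in>pverts G. card (L v)) / real n) \<le>
        standard_log_sobolev (coloring_distribution G L) (glauber G L)"
    if T: "undirected_tree G" and n: "n = card (pverts G)" and \<Delta>: "\<Delta> = max_degree G" "2 \<le> \<Delta>"
      and \<epsilon>: "0 < \<epsilon>" "\<epsilon> \<le> 1" and cond: "(ln (real \<Delta>))\<^sup>2 / real \<Delta> \<le> \<epsilon>\<^sup>2 / 100"
      and L: "\<forall>v\<in>pverts G. finite (L v) \<and> real (card (L v)) \<ge> real (degree_of G v) + \<epsilon> * real \<Delta>"
    for G :: "'v pair_pre_digraph" and L :: "'v \<Rightarrow> 'c set" and n \<Delta> :: nat and \<epsilon> :: real
  proof -
    obtain p where "coloring_instance (pverts G) (\<lambda>v. {u. (v, u) \<in> parcs G}) L (\<epsilon> * \<Delta>) \<Delta> p"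
      using undirected_tree_coloring_instance[OF T \<Delta> \<epsilon>(1) cond L] by blast
    then interpret coloring_instance "pverts G" "\<lambda>v. {u. (v, u) \<in> parcs G}" L "\<epsilon> * \<Delta>" \<Delta> p .
    \<comment> \<open>\<open>proper_colorings\<close> ranges over arcs, whereas
      \<open>colorings\<close> ranges over vertices and their neighbours.\<close>
    have wf: "fst e \<in> pverts G" if "e \<in> parcs G" for e using N_subset[of "fst e"] N_sym[of "snd e" "fst e"] N_subset[of "snd e"] that by auto
    have "proper_colorings G L = colorings"
      unfolding proper_colorings_def colorings_def configs_def using wf by fastforce
    hence \<pi>: "coloring_distribution G L = stationary" by (simp add: coloring_distribution_def)
    have "available_colors G L = avail"
      by (auto simp: fun_eq_iff available_colors_def avail_def)
    hence K: "glauber G L = kernel" by (simp add: fun_eq_iff glauber_def kernel_def)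
    have n1: "1 \<le> real n" using card_V_ge_1 by (simp add: n)
    \<comment> \<open>As \<epsilon> \<le> 1, the exponents 1/\<epsilon> and 2/\<epsilon> are at
      least 1 and 2, so 1/(2n) and 8 n^2 imply the claimed bounds.\<close>
    have powr: "real n powr (- (1 / \<epsilon>)) \<le> 1 / real n" "real n ^ 2 \<le> real n powr (2 / \<epsilon>)"
    proof -
      have "1 \<le> 1 / \<epsilon>" "2 \<le> 2 / \<epsilon>" using \<epsilon> by (simp_all add: le_divide_eq)
      hence "real n powr (- (1 / \<epsilon>)) \<le> real n powr - 1" "real n powr 2 \<le> real n powr (2 / \<epsilon>)"
        using n1 by (intro powr_mono; linarith)+
      thus "real n powr (- (1 / \<epsilon>)) \<le> 1 / real n" "real n ^ 2 \<le> real n powr (2 / \<epsilon>)"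
        using n1 by (simp_all add: powr_minus_divide powr_numeral)
    qed
    have "ereal (1 / 2 * real n powr (- (1 / \<epsilon>))) \<le> ereal (1 / (2 * card (pverts G)))"
      using powr(1) by (simp add: n)
    also have "\<dots> \<le> spectral_gap stationary kernel" by (rule spectral_gap_ge)
    finally have gap: "ereal (1 / 2 * real n powr (- (1 / \<epsilon>))) \<le> spectral_gap stationary kernel" .
    have "ereal_of_enat (mixing_time stationary kernel) \<le> ereal_of_enat (enat (8 * (card (pverts G))\<^sup>2))"
      using mixing_time_le by (simp only: ereal_of_enat_le_iff)
    also have "\<dots> \<le> ereal (8 * real n powr (2 / \<epsilon>))" using powr(2) by (simp add: n)
    finally have mix: "ereal_of_enat (mixing_time stationary kernel) \<le> ereal (8 * real n powr (2 / \<epsilon>))" .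
    have "ereal (c_ls \<epsilon> \<Delta> (MAX v\<in>pverts G. card (L v)) / real n) \<le> standard_log_sobolev stationary kernel"
      unfolding c_ls_def n using finite_V by (intro standard_log_sobolev_ge Max_ge) auto
    thus ?thesis
      using gap mix modified_log_sobolev_ge unfolding \<pi> K c_mls_def n by blast
  qed
  show ?thesis
    unfolding Let_def
    by (rule exI[of _ "1 / 2"], rule exI[of _ 1], rule exI[of _ 8], rule exI[of _ 2],
        rule exI[of _ c_mls], rule exI[of _ c_ls]) (use c_pos bounds in auto)
qed

end
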